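(* Let $n,s,h\ge1$, let $\delta:\Sigma\times Q\to\Sigma\times Q\times\{\text{left},\text{right}\}$ be a transition function with $\Sigma=\{0,\dots,s-1\}$, $Q=\{0,\dots,n-1\}$, left $=0$, right $=1$, let $H=\{0,\dots,h-1\}$, let $A$ be a formula, and let ${}_h\underline{\mathrm{absstep}}$ be the proof constructed in the context. Let $a_i^m,b_q,c_l\in k$ and $$\alpha^m=\sum_{i\in\Sigma}a_i^m[\![\underline{i}]\!]\in[\![{}_s\mathbf{bool}_A]\!]\ (m\in H),\quad\beta=\sum_{q\in Q}b_q[\![\underline{q}]\!]\in[\![{}_n\mathbf{bool}_A]\!],\quad\gamma=\sum_{l\in H}c_l[\![\underline{l}]\!]\in[\![{}_h\mathbf{bool}_A]\!].$$ Write $(\hat\sigma_i^q,\hat q_i^q,\hat d_i^q)=\delta(i,q)$, and let $\delta_P$ be $1$ if $P$ holds and $0$ otherwise. Then $$[\![{}_h\underline{\mathrm{absstep}}]\!]\big(|\emptyset\rangle_{\alpha^0}\otimes\cdots\otimes|\emptyset\rangle_{\alpha^{h-1}}\otimes|\emptyset\rangle_\beta\otimes|\emptyset\rangle_\gamma\big)=|\emptyset\rangle_{\theta^0}\otimes\cdots\otimes|\emptyset\rangle_{\theta^{h-1}}\otimes|\emptyset\rangle_\mu\otimes|\emptyset\rangle_\nu,$$ where $$\theta^m=[\![{}^m\underline{\mathrm{symbol}}]\!](\alpha^m\otimes\beta\otimes\gamma)=\sum_{i\in\Sigma}\sum_{q\in Q}a_i^mb_q\Big(c_m[\![\underline{\hat\sigma_i^q}]\!]+\sum_{l\in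 H,\,l\ne m}c_l[\![\underline{i}]\!]\Big),$$ $$\mu=[\![\underline{\mathrm{state}}]\!](\alpha^0\otimes\cdots\otimes\alpha^{h-1}\otimes\beta\otimes\gamma)=\sum_{l\in H}c_l\Big(\sum_{i\in\Sigma}\sum_{q\in Q}a_i^lb_q[\![\underline{\hat q_i^q}]\!]\Big)\prod_{m\in H,\,m\ne l}\Big(\sum_{i\in\Sigma}a_i^m\Big),$$ $$\nu=[\![\underline{\mathrm{tapehead}}]\!](\alpha^0\otimes\cdots\otimes\alpha^{h-1}\otimes\beta\otimes\gamma^{\otimes2})=\sum_{l\in H}c_l\Big(\sum_{i\in\Sigma}\sum_{q\in Q}\sum_{r\in H}a_i^lb_qc_r\big(\delta_{\hat d_i^q=0}[\![\underline{r-1}]\!]+\delta_{\hat d_i^q=1}[\![\underline{r+1}]\!]\big)\Big)\prod_{m\in H,\,m\ne l}\Big(\sum_{i\in\Sigma}a_i^m\Big),$$ with $r\pm1$ computed modulo $h$.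
   Context: **Logic and semantics.** Linear logic means propositional intuitionistic linear logic with connectives $\otimes,\&,\multimap,!$ (sequent calculus with one formula on the right; rules for $!$: dereliction, weakening, contraction, promotion). $k$ is an algebraically closed field. The *Sweedler semantics* $[\![-]\!]$: chosen vector spaces for atoms, $[\![A\otimes B]\!]=[\![A]\!]\otimes[\![B]\!]$, $[\![A\&B]\!]=[\![A]\!]\oplus[\![B]\!]$, $[\![A\multimap B]\!]=\mathrm{Hom}_k([\![A]\!],[\![B]\!])$, $[\![!A]\!]={!}[\![A]\!]$, where $!V$ is the universal (cofree) cocommutative coassociative counital coalgebra with universal linear map $d:{!}V\to V$. Proofs denote linear maps in the standard way: dereliction is $d$, contraction is comultiplication, weakening is the counit, promotion is the unique lift to a coalgebra morphism, cut is composition. For $P\in V$, $|\emptyset\rangle_P\in{!}V$ is the unique group-like element with $d|\emptyset\rangle_P=P$. $A^m=A\&\cdots\&A$, ${}_m\mathbf{bool}_A=A^m\multimap A$, and $\underline{i}$ is the proof of ${}_m\mathbf{bool}_A$ given by projection onto the $i$-th coordinate (counted from $0$). **Construction of ${}_h\underline{\mathrm{absstep}}$.** Proofs are written as linear $\lambda$-terms: $\langle\dots\rangle$ is $\&R$ (components share the same hypotheses), $x_i$ is the $i$-th projection. Let $\delta_0,\delta_1,\delta_2$ be the components of $\delta$. - ${}^i_\delta\underline{\mathrm{trans}}:{}_s\mathbf{bool}_A,{}_n\mathbf{bool}_A\vdash{}_m\mathbf{bool}_A$ ($m=s,n,2$ for $i=0,1,2$) is $\sigma,q\vdash\lambda x.\,\sigma\big\langle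 q\langle x_{\delta_i(j,0)},\dots,x_{\delta_i(j,n-1)}\rangle\big\rangle_{j=0}^{s-1}$. - Discarding: for a proof $t$ with conclusion $A$ and a fresh hypothesis $\sigma:{}_m\mathbf{bool}_A$, put $\mathrm{drop}_\sigma(t)=\sigma\langle t,\dots,t\rangle$ ($m$ copies); for several hypotheses iterate. - ${}^m\underline{\mathrm{symbol}}:{}_s\mathbf{bool}_A,{}_n\mathbf{bool}_A,{}_h\mathbf{bool}_A\vdash{}_s\mathbf{bool}_A$ ($0\le m\le h-1$) is $\sigma,q,i\vdash\lambda x.\,i\langle t_0,\dots,t_{h-1}\rangle$ with $t_m={}^0_\delta\underline{\mathrm{trans}}(\sigma,q)\,x$ and $t_j=\mathrm{drop}_q(\sigma x)$ for $j\ne m$. - $\underline{\mathrm{state}}:h\,{}_s\mathbf{bool}_A,{}_n\mathbf{bool}_A,{}_h\mathbf{bool}_A\vdash{}_n\mathbf{bool}_A$ is $\sigma_0,\dots,\sigma_{h-1},q,i\vdash\lambda x.\,i\langle w_0,\dots,w_{h-1}\rangle$, where $w_j$ is ${}^1_\delta\underline{\mathrm{trans}}(\sigma_j,q)\,x$ with all $\sigma_{j'}$, $j'\ne j$, dropped. - $\underline{\mathrm{tapehead}}:h\,{}_s\mathbf{bool}_A,{}_n\mathbf{bool}_A,{}_h\mathbf{bool}_A,{}_h\mathbf{bool}_A\vdash{}_h\mathbf{bool}_A$ is $\sigma_0,\dots,\sigma_{h-1},q,i,j\vdash\lambda x.\,j\langle\rho_0,\dots,\rho_{h-1}\rangle$,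 where $\rho_l=D_l\big\langle i\langle x_{h-1},x_0,\dots,x_{h-2}\rangle,\ i\langle x_1,\dots,x_{h-1},x_0\rangle\big\rangle$ and $D_l=\lambda y.\,\big({}^2_\delta\underline{\mathrm{trans}}(\sigma_l,q)\,y$ with all $\sigma_{l'}$, $l'\ne l$, dropped$\big)$. - ${}_h\underline{\mathrm{absstep}}:({!}{}_s\mathbf{bool}_A)^{\otimes h}\otimes{!}{}_n\mathbf{bool}_A\otimes{!}{}_h\mathbf{bool}_A\vdash({!}{}_s\mathbf{bool}_A)^{\otimes h}\otimes{!}{}_n\mathbf{bool}_A\otimes{!}{}_h\mathbf{bool}_A$ is obtained by derelicting the hypotheses of, and promoting, each of ${}^0\underline{\mathrm{symbol}},\dots,{}^{h-1}\underline{\mathrm{symbol}}$ (the $m$-th applied to the $m$-th tape symbol), $\underline{\mathrm{state}}$, $\underline{\mathrm{tapehead}}$ (both position inputs being the head position), tensoring them in order, contracting all hypotheses corresponding to the same input, and applying $\otimes L$. *)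

theory Defs
  imports
    "HOL-Computational_Algebra.Polynomial"
    "HOL-Library.FuncSet"
    "HOL-Library.Function_Algebras"
    "HOL-Library.Product_Plus"
begin

section \<open>Linear algebra on subspaces\<close>

text \<open>
  A vector space over \<open>'k\<close> is a subspace \<open>V\<close> of a type carrying a scalar multiplication
  \<open>s\<close> with \<open>vector_space s\<close>.
\<close>

definition lin_map ::
  "('k::field \<Rightarrow> 'v::ab_group_add \<Rightarrow> 'v) \<Rightarrow> ('k \<Rightarrow> 'w::ab_group_add \<Rightarrow> 'w)
    \<Rightarrow> 'v set \<Rightarrow> 'w set \<Rightarrow> ('v \<Rightarrow> 'w) \<Rightarrow> bool" where
  "lin_map s t V W f \<longleftrightarrow>
     f \<in> V \<rightarrow> W \<and>
     (\<forall>x\<in>V. \<forall>y\<in>V. f (x + y) = f x + f y) \<and>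
     (\<forall>c. \<forall>x\<in>V. f (s c x) = t c (f x))"

text \<open>Functions agreeing on \<open>V\<close> are identified by requiring the value \<open>0\<close> off \<open>V\<close>; then
  \<open>Hom(V, W)\<close> is a subspace of the space of all functions.\<close>

definition Hom ::
  "('k::field \<Rightarrow> 'v::ab_group_add \<Rightarrow> 'v) \<Rightarrow> ('k \<Rightarrow> 'w::ab_group_add \<Rightarrow> 'w)
    \<Rightarrow> 'v set \<Rightarrow> 'w set \<Rightarrow> ('v \<Rightarrow> 'w) set" where
  "Hom s t V W = {f. lin_map s t V W f \<and> (\<forall>x. x \<notin> V \<longrightarrow> f x = 0)}"

definition lin_iso ::
  "('k::field \<Rightarrow> 'v::ab_group_add \<Rightarrow> 'v) \<Rightarrow> ('k \<Rightarrow> 'w::ab_group_add \<Rightarrow> 'w)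
    \<Rightarrow> 'v set \<Rightarrow> 'w set \<Rightarrow> ('v \<Rightarrow> 'w) \<Rightarrow> bool" where
  "lin_iso s t V W f \<longleftrightarrow> lin_map s t V W f \<and> bij_betw f V W"

definition fun_scale :: "('k \<Rightarrow> 'w \<Rightarrow> 'w) \<Rightarrow> 'k \<Rightarrow> ('x \<Rightarrow> 'w) \<Rightarrow> 'x \<Rightarrow> 'w" where
  "fun_scale t c f = (\<lambda>x. t c (f x))"

definition prod_scale :: "('k \<Rightarrow> 'v \<Rightarrow> 'v) \<Rightarrow> 'k \<Rightarrow> 'v \<times> 'v \<Rightarrow> 'v \<times> 'v" where
  "prod_scale s c p = (s c (fst p), s c (snd p))"


section \<open>Tensor products\<close>

text \<open>
  Tensors of any rank over the space \<open>'v\<close> are functionals on multilinear forms, the pure tensor of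
  a list of vectors being evaluation at that list.  \<open>tensor s [V1,\<dots>,Vr]\<close> is the span of
  the pure tensors with factors in \<open>V1,\<dots>,Vr\<close>.  Over a field this is the tensor product of
  these spaces, since multilinear maps on subspaces extend to the whole space and functionals
  separate points (see \<open>tensor_universal\<close> below).  The empty tensor product is the line
  spanned by \<open>pure s []\<close>.
\<close>

type_synonym ('k, 'v) tens = "('v list \<Rightarrow> 'k) \<Rightarrow> 'k"

definition multilinear ::
  "('k::field \<Rightarrow> 'v::ab_group_add \<Rightarrow> 'v) \<Rightarrow> ('k \<Rightarrow> 'w::ab_group_add \<Rightarrow> 'w)
    \<Rightarrow> ('v list \<Rightarrow> 'w) \<Rightarrow> bool" where
  "multilinear s t f \<longleftrightarrow> (\<forall>xs ys. Vector_Spaces.linear s t (\<lambda>v. f (xs @ v # ys)))"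

definition pure :: "('k::field \<Rightarrow> 'v::ab_group_add \<Rightarrow> 'v) \<Rightarrow> 'v list \<Rightarrow> ('k, 'v) tens" where
  "pure s xs = (\<lambda>\<phi>. if multilinear s (*) \<phi> then \<phi> xs else 0)"

abbreviation tscale :: "'k::field \<Rightarrow> ('k, 'v) tens \<Rightarrow> ('k, 'v) tens" where
  "tscale \<equiv> fun_scale (*)"

definition tensor ::
  "('k::field \<Rightarrow> 'v::ab_group_add \<Rightarrow> 'v) \<Rightarrow> 'v set list \<Rightarrow> ('k, 'v) tens set" where
  "tensor s Vs = module.span tscale (pure s ` listset Vs)"

text \<open>For \<open>f\<close> multilinear on \<open>Vs\<close>, \<open>lift s t Vs f\<close> is the linear map on \<open>tensor s Vs\<close> induced by \<open>f\<close>.\<close>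

definition lift ::
  "('k::field \<Rightarrow> 'v::ab_group_add \<Rightarrow> 'v) \<Rightarrow> ('k \<Rightarrow> 'w::ab_group_add \<Rightarrow> 'w)
    \<Rightarrow> 'v set list \<Rightarrow> ('v list \<Rightarrow> 'w) \<Rightarrow> ('k, 'v) tens \<Rightarrow> 'w" where
  "lift s t Vs f =
     (THE F. F \<in> Hom tscale t (tensor s Vs) UNIV \<and> (\<forall>xs\<in>listset Vs. F (pure s xs) = f xs))"

lemma vector_space_fun_scale:
  fixes t :: "'k::field \<Rightarrow> 'w::ab_group_add \<Rightarrow> 'w"
  assumes "vector_space t"
  shows "vector_space (fun_scale t :: 'k \<Rightarrow> ('x \<Rightarrow> 'w) \<Rightarrow> 'x \<Rightarrow> 'w)"
proof -
  interpret vector_space t by fact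
  show ?thesis
    by unfold_locales (auto simp: fun_scale_def fun_eq_iff algebra_simps scale_left_distrib scale_right_distrib)
qed

lemma vector_space_mult: "vector_space ((*) :: 'k::field \<Rightarrow> 'k \<Rightarrow> 'k)"
  by unfold_locales (auto simp: algebra_simps)

lemma length_listset: "xs \<in> listset Vs \<Longrightarrow> length xs = length Vs"
  by (induction Vs arbitrary: xs) (auto simp: set_Cons_def)

lemma in_listset_iff: "xs \<in> listset Vs \<longleftrightarrow> list_all2 (\<in>) xs Vs"
  by (induction Vs arbitrary: xs) (auto simp: set_Cons_def list_all2_Cons2)

definition multilinear_on ::
  "('k::field \<Rightarrow> 'v::ab_group_add \<Rightarrow> 'v) \<Rightarrow> ('k \<Rightarrow> 'w::ab_group_add \<Rightarrow> 'w)
    \<Rightarrow> 'v set list \<Rightarrow> ('v list \<Rightarrow> 'w) \<Rightarrow> bool" where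
  "multilinear_on s t Vs f \<longleftrightarrow>
     (\<forall>Us V Ws. Vs = Us @ V # Ws \<longrightarrow>
       (\<forall>xs\<in>listset Us. \<forall>ys\<in>listset Ws. lin_map s t V UNIV (\<lambda>v. f (xs @ v # ys))))"

lemma projection_exists:
  fixes s :: "'k::field \<Rightarrow> 'v::ab_group_add \<Rightarrow> 'v"
  assumes "vector_space s" "module.subspace s V"
  obtains p where "Vector_Spaces.linear s s p" "\<And>x. p x \<in> V" "\<And>x. x \<in> V \<Longrightarrow> p x = x"
proof -
  interpret vector_space_pair s s using assms by (simp add: vector_space_pair_def)
  have "Vector_Spaces.linear s s id"
    by (rule vs1.linear_id)
  from linear_exists_left_inverse_on[OF this assms(2)] that show thesis
    by (auto simp: image_subset_iff)
qed

lemma functional_exists: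
  fixes t :: "'k::field \<Rightarrow> 'w::ab_group_add \<Rightarrow> 'w"
  assumes "vector_space t" "w \<noteq> 0"
  obtains l where "Vector_Spaces.linear t (*) l" "l w = 1"
proof -
  interpret vector_space_pair t "(*) :: 'k \<Rightarrow> 'k \<Rightarrow> 'k"
    using assms vector_space_mult by (simp add: vector_space_pair_def)
  have "vs1.independent {w}" using assms(2) by (simp add: vs1.independent_insert)
  from linear_independent_extend[OF this, of "\<lambda>_. 1"] that show thesis by auto
qed

lemma multilinear_extend:
  fixes s :: "'k::field \<Rightarrow> 'v::ab_group_add \<Rightarrow> 'v"
  assumes s: "vector_space s" and Vs: "\<And>V. V \<in> set Vs \<Longrightarrow> module.subspace s V"
    and f: "multilinear_on s (*) Vs f"
  obtains \<phi> :: "'v list \<Rightarrow> 'k" where "multilinear s (*) \<phi>" "\<And>xs. xs \<in> listset Vs \<Longrightarrow> \<phi> xs = f xs"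
proof -
  interpret sk: vector_space_pair s "(*) :: 'k \<Rightarrow> 'k \<Rightarrow> 'k"
    using s vector_space_mult by (simp add: vector_space_pair_def)
  have "\<exists>p. \<forall>V\<in>set Vs. Vector_Spaces.linear s s (p V) \<and> (\<forall>x. p V x \<in> V) \<and> (\<forall>x\<in>V. p V x = x)"
    by (rule bchoice) (metis projection_exists[OF s] Vs)
  then obtain p where p: "\<And>V. V \<in> set Vs \<Longrightarrow> Vector_Spaces.linear s s (p V)"
    "\<And>V x. V \<in> set Vs \<Longrightarrow> p V x \<in> V" "\<And>V x. V \<in> set Vs \<Longrightarrow> x \<in> V \<Longrightarrow> p V x = x" by blast
  define \<phi> where "\<phi> xs = (if length xs = length Vs then f (map2 p Vs xs) else 0)" for xs
  have mem: "map2 p Us xs \<in> listset Us" if "set Us \<subseteq> set Vs" "length xs = length Us" for Us xs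
    using that by (auto simp: in_listset_iff list_all2_conv_all_nth intro!: p(2) dest: subsetD)
  have "multilinear s (*) \<phi>"
    unfolding multilinear_def
  proof (intro allI)
    fix xs ys :: "'v list"
    show "Vector_Spaces.linear s (*) (\<lambda>v. \<phi> (xs @ v # ys))"
    proof (cases "length xs + Suc (length ys) = length Vs")
      case False
      then have "(\<lambda>v. \<phi> (xs @ v # ys)) = (\<lambda>_. 0)" by (auto simp: \<phi>_def)
      then show ?thesis using sk.linear_zero by simp
    next
      case True
      define Us V Ws where "Us = take (length xs) Vs" "V = Vs ! length xs" "Ws = drop (Suc (length xs)) Vs"
      have dec: "Vs = Us @ V # Ws" using True by (auto simp: Us_V_Ws_def id_take_nth_drop)
      have len: "length xs = length Us" "length ys = length Ws" using True by (auto simp: Us_V_Ws_def)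
      have eq: "\<phi> (xs @ v # ys) = f (map2 p Us xs @ p V v # map2 p Ws ys)" for v
        using len by (simp add: \<phi>_def dec)
      have L: "lin_map s (*) V UNIV (\<lambda>v. f (map2 p Us xs @ v # map2 p Ws ys))"
      proof -
        have "map2 p Us xs \<in> listset Us" "map2 p Ws ys \<in> listset Ws"
          using mem[of Us xs] mem[of Ws ys] len by (auto simp: dec)
        with f dec show ?thesis unfolding multilinear_on_def by blast
      qed
      have V: "V \<in> set Vs" by (simp add: dec)
      interpret P: Vector_Spaces.linear s s "p V" using p(1) V .
      show ?thesis
        unfolding eq using L p(2)[OF V] s vector_space_mult
        by (auto simp: Vector_Spaces.linear_iff lin_map_def P.add P.scale)
    qed
  qed
  moreover have "\<phi> xs = f xs" if "xs \<in> listset Vs" for xs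
  proof -
    have "map2 p Vs xs = xs"
      using that p(3) by (intro nth_equalityI) (auto simp: in_listset_iff list_all2_conv_all_nth)
    then show ?thesis using length_listset[OF that] by (simp add: \<phi>_def)
  qed
  ultimately show thesis using that by blast
qed

lemma tensor_universal:
  fixes s :: "'k::field \<Rightarrow> 'v::ab_group_add \<Rightarrow> 'v" and t :: "'k \<Rightarrow> 'w::ab_group_add \<Rightarrow> 'w"
  assumes s: "vector_space s" and t: "vector_space t"
    and Vs: "\<And>V. V \<in> set Vs \<Longrightarrow> module.subspace s V"
    and f: "multilinear_on s t Vs f"
  shows "\<exists>!F. F \<in> Hom tscale t (tensor s Vs) UNIV \<and> (\<forall>xs\<in>listset Vs. F (pure s xs) = f xs)"
proof -
  interpret T: vector_space_pair "tscale :: 'k \<Rightarrow> ('k, 'v) tens \<Rightarrow> ('k, 'v) tens" t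
    using t vector_space_fun_scale[OF vector_space_mult] by (simp add: vector_space_pair_def)
  interpret TK: vector_space_pair "tscale :: 'k \<Rightarrow> ('k, 'v) tens \<Rightarrow> ('k, 'v) tens" "(*) :: 'k \<Rightarrow> 'k \<Rightarrow> 'k"
    using vector_space_mult vector_space_fun_scale[OF vector_space_mult] by (simp add: vector_space_pair_def)
  let ?P = "pure s ` listset Vs"
  obtain B where B: "B \<subseteq> ?P" "T.vs1.independent B" "?P \<subseteq> T.vs1.span B"
    by (rule T.vs1.maximal_independent_subset)
  then have "\<forall>b\<in>B. \<exists>xs. xs \<in> listset Vs \<and> b = pure s xs" by auto
  then obtain r where r: "\<And>b. b \<in> B \<Longrightarrow> r b \<in> listset Vs" "\<And>b. b \<in> B \<Longrightarrow> b = pure s (r b)"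
    by metis
  obtain g where g: "Vector_Spaces.linear tscale t g" "\<And>b. b \<in> B \<Longrightarrow> g b = f (r b)"
    using T.linear_independent_extend[OF B(2), of "\<lambda>b. f (r b)"] by blast
  have gf: "g (pure s xs) = f xs" if xs: "xs \<in> listset Vs" for xs
  proof (rule ccontr)
    assume "g (pure s xs) \<noteq> f xs"
    then have "g (pure s xs) - f xs \<noteq> 0" by simp
    from functional_exists[OF t this] obtain l where
      l: "Vector_Spaces.linear t (*) l" "l (g (pure s xs) - f xs) = (1::'k)" .
    interpret l: Vector_Spaces.linear t "(*)" l by (rule l(1))
    have "multilinear_on s (*) Vs (\<lambda>xs. l (f xs))"
      using f by (fastforce simp: multilinear_on_def lin_map_def l.add l.scale)
    from multilinear_extend[OF s Vs this] obtain \<phi> where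
      \<phi>: "multilinear s (*) \<phi>" "\<And>xs. xs \<in> listset Vs \<Longrightarrow> \<phi> xs = l (f xs)" by blast
    have 1: "Vector_Spaces.linear tscale (*) (\<lambda>u :: ('k, 'v) tens. u \<phi>)"
      using vector_space_mult vector_space_fun_scale[OF vector_space_mult]
      by (auto simp: Vector_Spaces.linear_iff fun_scale_def)
    have 2: "Vector_Spaces.linear tscale (*) (\<lambda>u. l (g u))"
      using Vector_Spaces.linear_compose[OF g(1) l(1)] by (simp add: o_def)
    have "l (g (pure s xs)) = pure s xs \<phi>"
    proof (rule TK.linear_eq_on[OF 2 1])
      show "pure s xs \<in> T.vs1.span B" using B(3) xs by auto
      fix b assume b: "b \<in> B"
      have "b \<phi> = pure s (r b) \<phi>" using r(2)[OF b] by simp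
      also have "\<dots> = l (f (r b))" using \<phi> r(1)[OF b] by (simp add: pure_def)
      finally show "l (g b) = b \<phi>" using g(2)[OF b] by simp
    qed
    then have "l (g (pure s xs)) = l (f xs)" using \<phi> xs by (simp add: pure_def)
    with l(2) show False by (simp add: l.diff)
  qed
  interpret g: Vector_Spaces.linear tscale t g by (rule g(1))
  show ?thesis
  proof (rule ex1I)
    let ?F = "\<lambda>u. if u \<in> tensor s Vs then g u else 0"
    have pt: "pure s xs \<in> tensor s Vs" if "xs \<in> listset Vs" for xs
      unfolding tensor_def using that by (auto intro: T.vs1.span_base)
    show "?F \<in> Hom tscale t (tensor s Vs) UNIV \<and> (\<forall>xs\<in>listset Vs. ?F (pure s xs) = f xs)"
      using gf pt by (auto simp: Hom_def lin_map_def g.add g.scale tensor_def T.vs1.span_add T.vs1.span_scale)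
    fix F assume F: "F \<in> Hom tscale t (tensor s Vs) UNIV \<and> (\<forall>xs\<in>listset Vs. F (pure s xs) = f xs)"
    have "u \<in> T.vs1.span ?P \<and> F u = g u" if "u \<in> T.vs1.span ?P" for u
      using that
    proof (induction rule: T.vs1.span_induct_alt)
      case base
      have "F (0 + 0) = F 0 + F 0"
        using F T.vs1.span_zero unfolding Hom_def lin_map_def tensor_def by blast
      then have "F 0 = 0" by simp
      then show ?case using g.zero T.vs1.span_zero by metis
    next
      case (step c x y)
      from step(1) obtain xs where xs: "xs \<in> listset Vs" "x = pure s xs" by blast
      have x: "x \<in> T.vs1.span ?P" using step(1) by (rule T.vs1.span_base)
      have add: "F (u + v) = F u + F v" and scale: "F (tscale c u) = t c (F u)"
        if "u \<in> T.vs1.span ?P" "v \<in> T.vs1.span ?P" for u v c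
        using F that unfolding Hom_def lin_map_def tensor_def by blast+
      have y: "y \<in> T.vs1.span ?P" "F y = g y" using step(2) by auto
      have "F (tscale c x + y) = t c (F x) + F y"
        using add[OF T.vs1.span_scale[OF x] y(1)] scale[OF x x] by simp
      also have "F x = g x" using F gf xs by simp
      finally have "F (tscale c x + y) = g (tscale c x + y)" by (simp only: y(2) g.add g.scale)
      with T.vs1.span_add[OF T.vs1.span_scale[OF x] y(1)] show ?case by blast
    qed
    then show "F = ?F" using F by (auto simp: Hom_def tensor_def fun_eq_iff)
  qed
qed

definition lift2 ::
  "('k::field \<Rightarrow> 'v::ab_group_add \<Rightarrow> 'v) \<Rightarrow> ('k \<Rightarrow> 'w::ab_group_add \<Rightarrow> 'w)
    \<Rightarrow> 'v set \<Rightarrow> 'v set \<Rightarrow> ('v \<Rightarrow> 'v \<Rightarrow> 'w) \<Rightarrow> ('k, 'v) tens \<Rightarrow> 'w" where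
  "lift2 s t V W f = lift s t [V, W] (\<lambda>xs. f (xs ! 0) (xs ! 1))"


section \<open>Coalgebras\<close>

text \<open>
  In Sweedler notation, \<open>lift2 s t C C f (\<Delta> c)\<close> is the sum of the \<open>f c' c''\<close>.
\<close>

definition cocomm_coalgebra ::
  "('k::field \<Rightarrow> 'v::ab_group_add \<Rightarrow> 'v) \<Rightarrow> 'v set \<Rightarrow> ('v \<Rightarrow> ('k, 'v) tens) \<Rightarrow> ('v \<Rightarrow> 'k) \<Rightarrow> bool"
where
  "cocomm_coalgebra s C \<Delta> \<epsilon> \<longleftrightarrow>
     vector_space s \<and> module.subspace s C \<and>
     lin_map s tscale C (tensor s [C, C]) \<Delta> \<and>
     lin_map s (*) C UNIV \<epsilon> \<and>
     (\<forall>c\<in>C.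
        lift2 s tscale C C (\<lambda>x z. lift2 s tscale C C (\<lambda>x1 x2. pure s [x1, x2, z]) (\<Delta> x)) (\<Delta> c) =
        lift2 s tscale C C (\<lambda>x z. lift2 s tscale C C (\<lambda>z1 z2. pure s [x, z1, z2]) (\<Delta> z)) (\<Delta> c) \<and>
        lift2 s s C C (\<lambda>x y. s (\<epsilon> x) y) (\<Delta> c) = c \<and>
        lift2 s s C C (\<lambda>x y. s (\<epsilon> y) x) (\<Delta> c) = c \<and>
        lift2 s tscale C C (\<lambda>x y. pure s [y, x]) (\<Delta> c) = \<Delta> c)"

definition coalgebra_hom ::
  "('k::field \<Rightarrow> 'v::ab_group_add \<Rightarrow> 'v) \<Rightarrow> 'v set \<Rightarrow> ('v \<Rightarrow> ('k, 'v) tens) \<Rightarrow> ('v \<Rightarrow> 'k)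
    \<Rightarrow> ('k \<Rightarrow> 'w::ab_group_add \<Rightarrow> 'w) \<Rightarrow> 'w set \<Rightarrow> ('w \<Rightarrow> ('k, 'w) tens) \<Rightarrow> ('w \<Rightarrow> 'k)
    \<Rightarrow> ('v \<Rightarrow> 'w) \<Rightarrow> bool"
where
  "coalgebra_hom s C \<Delta>C \<epsilon>C t D \<Delta>D \<epsilon>D F \<longleftrightarrow>
     F \<in> Hom s t C D \<and>
     (\<forall>c\<in>C. lift2 s tscale C C (\<lambda>x y. pure t [F x, F y]) (\<Delta>C c) = \<Delta>D (F c) \<and>
            \<epsilon>D (F c) = \<epsilon>C c)"

text \<open>
  \<open>(C, \<Delta>, \<epsilon>)\<close> with \<open>d\<close> is the cofree cocommutative coalgebra on \<open>V\<close>.  Test coalgebras range over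
  all subspaces of the tensor type over \<open>'v\<close>.  Every subspace of \<open>'v\<close> is isomorphic to one of
  these (tensors of rank one), and so are the tensor products of subspaces of \<open>'v\<close>.  The trivial coalgebra
  on the line spanned by \<open>pure s []\<close> is a test coalgebra, so \<open>C\<close> is nonzero; hence tensors of
  different ranks provide test coalgebras of every finite dimension, and by the fundamental theorem of
  coalgebras this is the universal property with respect to all cocommutative coalgebras.
\<close>

definition cofree ::
  "('k::field \<Rightarrow> 'v::ab_group_add \<Rightarrow> 'v) \<Rightarrow> 'v set
    \<Rightarrow> 'v set \<Rightarrow> ('v \<Rightarrow> ('k, 'v) tens) \<Rightarrow> ('v \<Rightarrow> 'k) \<Rightarrow> ('v \<Rightarrow> 'v) \<Rightarrow> bool"
where
  "cofree s V C \<Delta> \<epsilon> d \<longleftrightarrow>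
     cocomm_coalgebra s C \<Delta> \<epsilon> \<and> lin_map s s C V d \<and>
     (\<forall>(D :: ('k, 'v) tens set) \<Delta>D \<epsilon>D f.
        cocomm_coalgebra tscale D \<Delta>D \<epsilon>D \<and> lin_map tscale s D V f \<longrightarrow>
        (\<exists>!F. coalgebra_hom tscale D \<Delta>D \<epsilon>D s C \<Delta> \<epsilon> F \<and> (\<forall>x\<in>D. d (F x) = f x)))"

text \<open>
  The tensor product of coalgebras \<open>(C, \<Delta>, \<epsilon>)\<close>, listed as triples: \<open>co_expand s Cs cs g\<close> is the sum of
  \<open>g [c1',\<dots>,cr'] [c1'',\<dots>,cr'']\<close>.
\<close>

fun co_expand ::
  "('k::field \<Rightarrow> 'v::ab_group_add \<Rightarrow> 'v) \<Rightarrow> ('k \<Rightarrow> 'w::ab_group_add \<Rightarrow> 'w)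
    \<Rightarrow> ('v set \<times> ('v \<Rightarrow> ('k, 'v) tens) \<times> ('v \<Rightarrow> 'k)) list \<Rightarrow> 'v list
    \<Rightarrow> ('v list \<Rightarrow> 'v list \<Rightarrow> 'w) \<Rightarrow> 'w"
where
  "co_expand s t ((C, \<Delta>, \<epsilon>) # Cs) (c # cs) g =
     lift2 s t C C (\<lambda>x y. co_expand s t Cs cs (\<lambda>xs ys. g (x # xs) (y # ys))) (\<Delta> c)"
| "co_expand s t _ _ g = g [] []"

definition tensor_comult ::
  "('k::field \<Rightarrow> 'v::ab_group_add \<Rightarrow> 'v)
    \<Rightarrow> ('v set \<times> ('v \<Rightarrow> ('k, 'v) tens) \<times> ('v \<Rightarrow> 'k)) list
    \<Rightarrow> ('k, 'v) tens \<Rightarrow> ('k, ('k, 'v) tens) tens"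
where
  "tensor_comult s Cs =
     lift s tscale (map fst Cs)
       (\<lambda>cs. co_expand s tscale Cs cs (\<lambda>xs ys. pure tscale [pure s xs, pure s ys]))"

definition tensor_counit ::
  "('k::field \<Rightarrow> 'v::ab_group_add \<Rightarrow> 'v)
    \<Rightarrow> ('v set \<times> ('v \<Rightarrow> ('k, 'v) tens) \<times> ('v \<Rightarrow> 'k)) list \<Rightarrow> ('k, 'v) tens \<Rightarrow> 'k"
where
  "tensor_counit s Cs =
     lift s (*) (map fst Cs) (\<lambda>cs. \<Prod>i<length Cs. (snd (snd (Cs ! i))) (cs ! i))"


section \<open>Intuitionistic linear logic\<close>

datatype 'a form =
    Atom 'a
  | Tensor "'a form" "'a form"
  | With "'a form" "'a form"
  | Lolli "'a form" "'a form"
  | Bang "'a form"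

text \<open>
  Derivations in the sequent calculus.  The number in a left rule is the length of the context to
  the left of the principal formula.  In \<open>Exch \<Gamma> js \<pi>\<close> the \<open>k\<close>-th hypothesis of \<open>\<pi>\<close> is the
  \<open>(js ! k)\<close>-th element of \<open>\<Gamma>\<close>.
\<close>

datatype 'a deriv =
    Ax "'a form"
  | Exch "'a form list" "nat list" "'a deriv"
  | Cut nat "'a form" "'a deriv" "'a deriv"
  | TensorL nat "'a form" "'a form" "'a deriv"
  | TensorR "'a form" "'a form" "'a deriv" "'a deriv"
  | WithL1 nat "'a form" "'a form" "'a deriv"
  | WithL2 nat "'a form" "'a form" "'a deriv"
  | WithR "'a form" "'a form" "'a deriv" "'a deriv"
  | LolliL nat "'a form" "'a form" "'a deriv" "'a deriv"
  | LolliR "'a form" "'a form" "'a deriv"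
  | Derelict nat "'a form" "'a deriv"
  | Weaken nat "'a form" "'a deriv"
  | Contract nat "'a form" "'a deriv"
  | Promote "'a form list" "'a form" "'a deriv"

inductive proves :: "'a deriv \<Rightarrow> 'a form list \<Rightarrow> 'a form \<Rightarrow> bool" where
  ax: "proves (Ax A) [A] A"
| exch: "proves \<pi> (map ((!) \<Gamma>) js) C \<Longrightarrow> distinct js \<Longrightarrow> set js = {..<length \<Gamma>} \<Longrightarrow>
    proves (Exch \<Gamma> js \<pi>) \<Gamma> C"
| cut: "proves \<pi> \<Gamma> A \<Longrightarrow> proves \<rho> (\<Delta>' @ A # \<Delta>) C \<Longrightarrow>
    proves (Cut (length \<Delta>') A \<pi> \<rho>) (\<Delta>' @ \<Gamma> @ \<Delta>) C"
| tensorL: "proves \<pi> (\<Gamma> @ A # B # \<Delta>) C \<Longrightarrow>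
    proves (TensorL (length \<Gamma>) A B \<pi>) (\<Gamma> @ Tensor A B # \<Delta>) C"
| tensorR: "proves \<pi> \<Gamma> A \<Longrightarrow> proves \<rho> \<Delta> B \<Longrightarrow> proves (TensorR A B \<pi> \<rho>) (\<Gamma> @ \<Delta>) (Tensor A B)"
| withL1: "proves \<pi> (\<Gamma> @ A # \<Delta>) C \<Longrightarrow> proves (WithL1 (length \<Gamma>) A B \<pi>) (\<Gamma> @ With A B # \<Delta>) C"
| withL2: "proves \<pi> (\<Gamma> @ B # \<Delta>) C \<Longrightarrow> proves (WithL2 (length \<Gamma>) A B \<pi>) (\<Gamma> @ With A B # \<Delta>) C"
| withR: "proves \<pi> \<Gamma> A \<Longrightarrow> proves \<rho> \<Gamma> B \<Longrightarrow> proves (WithR A B \<pi> \<rho>) \<Gamma> (With A B)"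
| lolliL: "proves \<pi> \<Gamma> A \<Longrightarrow> proves \<rho> (\<Delta>' @ B # \<Delta>) C \<Longrightarrow>
    proves (LolliL (length \<Delta>') A B \<pi> \<rho>) (\<Delta>' @ Lolli A B # \<Gamma> @ \<Delta>) C"
| lolliR: "proves \<pi> (\<Gamma> @ [A]) B \<Longrightarrow> proves (LolliR A B \<pi>) \<Gamma> (Lolli A B)"
| derelict: "proves \<pi> (\<Gamma> @ A # \<Delta>) C \<Longrightarrow>
    proves (Derelict (length \<Gamma>) A \<pi>) (\<Gamma> @ Bang A # \<Delta>) C"
| weaken: "proves \<pi> (\<Gamma> @ \<Delta>) C \<Longrightarrow> proves (Weaken (length \<Gamma>) A \<pi>) (\<Gamma> @ Bang A # \<Delta>) C"
| contract: "proves \<pi> (\<Gamma> @ Bang A # Bang A # \<Delta>) C \<Longrightarrow>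
    proves (Contract (length \<Gamma>) A \<pi>) (\<Gamma> @ Bang A # \<Delta>) C"
| promote: "proves \<pi> (map Bang \<Gamma>) A \<Longrightarrow> proves (Promote \<Gamma> A \<pi>) (map Bang \<Gamma>) (Bang A)"

primrec hyps :: "'a deriv \<Rightarrow> 'a form list" where
  "hyps (Ax A) = [A]"
| "hyps (Exch \<Gamma> js \<pi>) = \<Gamma>"
| "hyps (Cut n A \<pi> \<rho>) = take n (hyps \<rho>) @ hyps \<pi> @ drop (Suc n) (hyps \<rho>)"
| "hyps (TensorL n A B \<pi>) = take n (hyps \<pi>) @ Tensor A B # drop (n + 2) (hyps \<pi>)"
| "hyps (TensorR A B \<pi> \<rho>) = hyps \<pi> @ hyps \<rho>"
| "hyps (WithL1 n A B \<pi>) = (hyps \<pi>)[n := With A B]"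
| "hyps (WithL2 n A B \<pi>) = (hyps \<pi>)[n := With A B]"
| "hyps (WithR A B \<pi> \<rho>) = hyps \<pi>"
| "hyps (LolliL n A B \<pi> \<rho>) = take n (hyps \<rho>) @ Lolli A B # hyps \<pi> @ drop (Suc n) (hyps \<rho>)"
| "hyps (LolliR A B \<pi>) = butlast (hyps \<pi>)"
| "hyps (Derelict n A \<pi>) = (hyps \<pi>)[n := Bang A]"
| "hyps (Weaken n A \<pi>) = take n (hyps \<pi>) @ Bang A # drop n (hyps \<pi>)"
| "hyps (Contract n A \<pi>) = take (Suc n) (hyps \<pi>) @ drop (n + 2) (hyps \<pi>)"
| "hyps (Promote \<Gamma> A \<pi>) = map Bang \<Gamma>"

lemma hyps_eq: "proves \<pi> \<Gamma> A \<Longrightarrow> hyps \<pi> = \<Gamma>"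
  by (induction rule: proves.induct) simp_all


section \<open>The Sweedler semantics\<close>

text \<open>
  All spaces \<open>sem B\<close> are subspaces of one ambient space \<open>'v\<close>.  Since a tensor product, a direct sum or a
  space of linear maps is not literally such a subspace, an interpretation also contains
  isomorphisms from these spaces onto the subspaces that denote compound formulas.  A set \<open>F\<close>
  of formulas closed under subformulas is interpreted: for \<open>F = UNIV\<close> the dimensions of the spaces
  are unbounded in the nesting depth and can exceed every type that is definable from \<open>'k\<close>,
  whereas for finite \<open>F\<close> there is always an ambient space.
\<close>

record ('a, 'k, 'v) interp =
  smul :: "'k \<Rightarrow> 'v \<Rightarrow> 'v"
  sem :: "'a form \<Rightarrow> 'v set"
  tensor_iso :: "'a form \<Rightarrow> 'a form \<Rightarrow> ('k, 'v) tens \<Rightarrow> 'v"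
  with_iso :: "'a form \<Rightarrow> 'a form \<Rightarrow> 'v \<times> 'v \<Rightarrow> 'v"
  lolli_iso :: "'a form \<Rightarrow> 'a form \<Rightarrow> ('v \<Rightarrow> 'v) \<Rightarrow> 'v"
  comult :: "'a form \<Rightarrow> 'v \<Rightarrow> ('k, 'v) tens"
  counit :: "'a form \<Rightarrow> 'v \<Rightarrow> 'k"
  univ_map :: "'a form \<Rightarrow> 'v \<Rightarrow> 'v"

definition sweedler_semantics ::
  "'a form set \<Rightarrow> ('a, 'k::field, 'v::ab_group_add) interp \<Rightarrow> bool"
where
  "sweedler_semantics F M \<longleftrightarrow>
     vector_space (smul M) \<and>
     (\<forall>X\<in>F. module.subspace (smul M) (sem M X) \<and>
       (case X of
          Atom p \<Rightarrow> True
        | Tensor A B \<Rightarrow> A \<in> F \<and> B \<in> F \<and>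
            lin_iso tscale (smul M) (tensor (smul M) [sem M A, sem M B]) (sem M X) (tensor_iso M A B)
        | With A B \<Rightarrow> A \<in> F \<and> B \<in> F \<and>
            lin_iso (prod_scale (smul M)) (smul M) (sem M A \<times> sem M B) (sem M X) (with_iso M A B)
        | Lolli A B \<Rightarrow> A \<in> F \<and> B \<in> F \<and>
            lin_iso (fun_scale (smul M)) (smul M) (Hom (smul M) (smul M) (sem M A) (sem M B))
              (sem M X) (lolli_iso M A B)
        | Bang A \<Rightarrow> A \<in> F \<and>
            cofree (smul M) (sem M A) (sem M X) (comult M A) (counit M A) (univ_map M A)))"

abbreviation pure_of :: "('a, 'k::field, 'v::ab_group_add) interp \<Rightarrow> 'v list \<Rightarrow> ('k, 'v) tens" where
  "pure_of M \<equiv> pure (smul M)"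

text \<open>The linear map on the tensor product of the hypotheses of \<open>\<pi>\<close> with the given values on pure
  tensors.\<close>

definition on_hyps ::
  "('a, 'k::field, 'v::ab_group_add) interp \<Rightarrow> 'a deriv \<Rightarrow> ('v list \<Rightarrow> 'v) \<Rightarrow> ('k, 'v) tens \<Rightarrow> 'v"
where
  "on_hyps M \<pi> f = lift (smul M) (smul M) (map (sem M) (hyps \<pi>)) f"

definition split_tensor ::
  "('a, 'k::field, 'v::ab_group_add) interp \<Rightarrow> 'a form \<Rightarrow> 'a form \<Rightarrow> 'v \<Rightarrow> ('k, 'v) tens" where
  "split_tensor M A B = inv_into (tensor (smul M) [sem M A, sem M B]) (tensor_iso M A B)"

definition split_with ::
  "('a, 'k::field, 'v::ab_group_add) interp \<Rightarrow> 'a form \<Rightarrow> 'a form \<Rightarrow> 'v \<Rightarrow> 'v \<times> 'v" where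
  "split_with M A B = inv_into (sem M A \<times> sem M B) (with_iso M A B)"

definition apply_lolli ::
  "('a, 'k::field, 'v::ab_group_add) interp \<Rightarrow> 'a form \<Rightarrow> 'a form \<Rightarrow> 'v \<Rightarrow> 'v \<Rightarrow> 'v" where
  "apply_lolli M A B =
     inv_into (Hom (smul M) (smul M) (sem M A) (sem M B)) (lolli_iso M A B)"

abbreviation bang_coalgebra ::
  "('a, 'k::field, 'v::ab_group_add) interp \<Rightarrow> 'a form
    \<Rightarrow> 'v set \<times> ('v \<Rightarrow> ('k, 'v) tens) \<times> ('v \<Rightarrow> 'k)" where
  "bang_coalgebra M A \<equiv> (sem M (Bang A), comult M A, counit M A)"

text \<open>A proof of \<open>A1, \<dots>, Ar \<turnstile> B\<close> denotes a linear map from the tensor product of the \<open>sem M Ai\<close> to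
  \<open>sem M B\<close>.\<close>

primrec den ::
  "('a, 'k::field, 'v::ab_group_add) interp \<Rightarrow> 'a deriv \<Rightarrow> ('k, 'v) tens \<Rightarrow> 'v"
where
  "den M (Ax A) = on_hyps M (Ax A) (\<lambda>xs. xs ! 0)"
| "den M (Exch \<Gamma> js \<pi>) = on_hyps M (Exch \<Gamma> js \<pi>) (\<lambda>xs. den M \<pi> (pure_of M (map ((!) xs) js)))"
| "den M (Cut n A \<pi> \<rho>) = on_hyps M (Cut n A \<pi> \<rho>) (\<lambda>xs.
     let r = length (hyps \<pi>) in
     den M \<rho> (pure_of M
       (take n xs @ den M \<pi> (pure_of M (take r (drop n xs))) # drop (n + r) xs)))"
| "den M (TensorL n A B \<pi>) = on_hyps M (TensorL n A B \<pi>) (\<lambda>xs.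
     lift2 (smul M) (smul M) (sem M A) (sem M B)
       (\<lambda>a b. den M \<pi> (pure_of M (take n xs @ a # b # drop (Suc n) xs)))
       (split_tensor M A B (xs ! n)))"
| "den M (TensorR A B \<pi> \<rho>) = on_hyps M (TensorR A B \<pi> \<rho>) (\<lambda>xs.
     let r = length (hyps \<pi>) in
     tensor_iso M A B
       (pure_of M [den M \<pi> (pure_of M (take r xs)), den M \<rho> (pure_of M (drop r xs))]))"
| "den M (WithL1 n A B \<pi>) = on_hyps M (WithL1 n A B \<pi>) (\<lambda>xs.
     den M \<pi> (pure_of M (xs[n := fst (split_with M A B (xs ! n))])))"
| "den M (WithL2 n A B \<pi>) = on_hyps M (WithL2 n A B \<pi>) (\<lambda>xs.
     den M \<pi> (pure_of M (xs[n := snd (split_with M A B (xs ! n))])))"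
| "den M (WithR A B \<pi> \<rho>) = on_hyps M (WithR A B \<pi> \<rho>) (\<lambda>xs.
     with_iso M A B (den M \<pi> (pure_of M xs), den M \<rho> (pure_of M xs)))"
| "den M (LolliL n A B \<pi> \<rho>) = on_hyps M (LolliL n A B \<pi> \<rho>) (\<lambda>xs.
     let r = length (hyps \<pi>) in
     den M \<rho> (pure_of M
       (take n xs
        @ apply_lolli M A B (xs ! n) (den M \<pi> (pure_of M (take r (drop (Suc n) xs))))
        # drop (Suc n + r) xs)))"
| "den M (LolliR A B \<pi>) = on_hyps M (LolliR A B \<pi>) (\<lambda>xs.
     lolli_iso M A B (\<lambda>a. if a \<in> sem M A then den M \<pi> (pure_of M (xs @ [a])) else 0))"
| "den M (Derelict n A \<pi>) = on_hyps M (Derelict n A \<pi>) (\<lambda>xs.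
     den M \<pi> (pure_of M (xs[n := univ_map M A (xs ! n)])))"
| "den M (Weaken n A \<pi>) = on_hyps M (Weaken n A \<pi>) (\<lambda>xs.
     smul M (counit M A (xs ! n)) (den M \<pi> (pure_of M (take n xs @ drop (Suc n) xs))))"
| "den M (Contract n A \<pi>) = on_hyps M (Contract n A \<pi>) (\<lambda>xs.
     lift2 (smul M) (smul M) (sem M (Bang A)) (sem M (Bang A))
       (\<lambda>a b. den M \<pi> (pure_of M (take n xs @ a # b # drop (Suc n) xs)))
       (comult M A (xs ! n)))"
| "den M (Promote \<Gamma> A \<pi>) =
     (THE F.
        coalgebra_hom tscale (tensor (smul M) (map (sem M) (map Bang \<Gamma>)))
          (tensor_comult (smul M) (map (bang_coalgebra M) \<Gamma>))
          (tensor_counit (smul M) (map (bang_coalgebra M) \<Gamma>))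
          (smul M) (sem M (Bang A)) (comult M A) (counit M A) F \<and>
        (\<forall>x\<in>tensor (smul M) (map (sem M) (map Bang \<Gamma>)). univ_map M A (F x) = den M \<pi> x))"

text \<open>The unique group-like element over \<open>P\<close>, written as a ket \<open>|\<emptyset>\<rangle>\<close> with index \<open>P\<close>.\<close>

definition vacuum ::
  "('a, 'k::field, 'v::ab_group_add) interp \<Rightarrow> 'a form \<Rightarrow> 'v \<Rightarrow> 'v" where
  "vacuum M A P =
     (THE g. g \<in> sem M (Bang A) \<and> comult M A g = pure_of M [g, g] \<and> counit M A g = 1 \<and>
             univ_map M A g = P)"

text \<open>Iterated tensors (associated to the right).\<close>

fun tensor_form :: "'a form list \<Rightarrow> 'a form" where
  "tensor_form [A] = A"
| "tensor_form (A # B # As) = Tensor A (tensor_form (B # As))"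

fun tensor_elt :: "('a, 'k::field, 'v::ab_group_add) interp \<Rightarrow> 'a form list \<Rightarrow> 'v list \<Rightarrow> 'v" where
  "tensor_elt M [A] [x] = x"
| "tensor_elt M (A # B # As) (x # y # xs) =
     tensor_iso M A (tensor_form (B # As)) (pure_of M [x, tensor_elt M (B # As) (y # xs)])"


section \<open>Booleans\<close>

fun pow_form :: "'a form \<Rightarrow> nat \<Rightarrow> 'a form" where
  "pow_form A (Suc 0) = A"
| "pow_form A (Suc (Suc m)) = With A (pow_form A (Suc m))"

definition bool_form :: "nat \<Rightarrow> 'a form \<Rightarrow> 'a form" where
  "bool_form m A = Lolli (pow_form A m) A"

text \<open>The proof \<open>x_i\<close> of \<open>A^m \<turnstile> A\<close>.\<close>

fun proj :: "'a form \<Rightarrow> nat \<Rightarrow> nat \<Rightarrow> 'a deriv" where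
  "proj A (Suc 0) i = Ax A"
| "proj A (Suc (Suc m)) 0 = WithL1 0 A (pow_form A (Suc m)) (Ax A)"
| "proj A (Suc (Suc m)) (Suc i) = WithL2 0 A (pow_form A (Suc m)) (proj A (Suc m) i)"

definition bool_proof :: "'a form \<Rightarrow> nat \<Rightarrow> nat \<Rightarrow> 'a deriv" where
  "bool_proof A m i = LolliR (pow_form A m) A (proj A m i)"

definition bool_vec :: "('a, 'k::field, 'v::ab_group_add) interp \<Rightarrow> 'a form \<Rightarrow> nat \<Rightarrow> nat \<Rightarrow> 'v" where
  "bool_vec M A m i = den M (bool_proof A m i) (pure_of M [])"

text \<open>The term \<open>\<langle>t_0, \<dots>, t_(m-1)\<rangle>\<close>.\<close>

fun tuple :: "'a form \<Rightarrow> 'a deriv list \<Rightarrow> 'a deriv" where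
  "tuple A [t] = t"
| "tuple A (t # u # ts) = WithR A (pow_form A (Suc (length ts))) t (tuple A (u # ts))"

text \<open>The term \<open>\<sigma>\<langle>t_0, \<dots>, t_(m-1)\<rangle>\<close>; the fresh hypothesis \<open>\<sigma>\<close> comes first in the context.\<close>

definition branch :: "'a form \<Rightarrow> 'a deriv list \<Rightarrow> 'a deriv" where
  "branch A ts = LolliL 0 (pow_form A (length ts)) A (tuple A ts) (Ax A)"

definition discard :: "'a form \<Rightarrow> nat \<Rightarrow> 'a deriv \<Rightarrow> 'a deriv" where
  "discard A m t = branch A (replicate m t)"

text \<open>The term \<open>\<sigma> x\<close>, in the context \<open>\<sigma>, x\<close>.\<close>

definition apply_var :: "'a form \<Rightarrow> nat \<Rightarrow> 'a deriv" where
  "apply_var A m = LolliL 0 (pow_form A m) A (Ax (pow_form A m)) (Ax A)"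

text \<open>The term \<open>t x\<close> for a proof \<open>t\<close> of \<open>bool_form m A\<close>; the hypothesis \<open>x\<close> comes last.\<close>

definition apply_to_var :: "'a form \<Rightarrow> nat \<Rightarrow> 'a deriv \<Rightarrow> 'a deriv" where
  "apply_to_var A m t = Cut 0 (bool_form m A) t (apply_var A m)"


section \<open>The step proof\<close>

text \<open>Here \<open>p\<close> is one of the three components of \<open>\<delta>\<close>, with values below \<open>m\<close>.\<close>

definition trans_proof ::
  "'a form \<Rightarrow> nat \<Rightarrow> nat \<Rightarrow> (nat \<times> nat \<Rightarrow> nat) \<Rightarrow> nat \<Rightarrow> 'a deriv" where
  "trans_proof A s n p m =
     LolliR (pow_form A m) A
       (branch A [branch A [proj A m (p (j, r)). r \<leftarrow> [0..<n]]. j \<leftarrow> [0..<s]])"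

definition symbol ::
  "'a form \<Rightarrow> nat \<Rightarrow> nat \<Rightarrow> nat \<Rightarrow> (nat \<times> nat \<Rightarrow> nat \<times> nat \<times> nat) \<Rightarrow> nat \<Rightarrow> 'a deriv" where
  "symbol A s n h \<delta> m =
     LolliR (pow_form A s) A
       (Exch [bool_form s A, bool_form n A, bool_form h A, pow_form A s] [2, 0, 1, 3]
         (branch A
           [if j = m
            then apply_to_var A s (trans_proof A s n (\<lambda>x. fst (\<delta> x)) s)
            else Exch [bool_form s A, bool_form n A, pow_form A s] [1, 0, 2]
                   (discard A n (apply_var A s)).
            j \<leftarrow> [0..<h]]))"

text \<open>
  In the context \<open>\<sigma>_0, \<dots>, \<sigma>_(h-1), q, x\<close>: the transition proof for the component \<open>p\<close> applied to
  \<open>\<sigma>_j, q\<close> and then to \<open>x\<close>, with all other \<open>\<sigma>\<close>'s dropped.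
\<close>

definition trans_at ::
  "'a form \<Rightarrow> nat \<Rightarrow> nat \<Rightarrow> nat \<Rightarrow> (nat \<times> nat \<Rightarrow> nat) \<Rightarrow> nat \<Rightarrow> nat \<Rightarrow> 'a deriv" where
  "trans_at A s n h p m j =
     Exch (replicate h (bool_form s A) @ [bool_form n A, pow_form A m])
       ([l. l \<leftarrow> [0..<h], l \<noteq> j] @ [j, h, h + 1])
       ((discard A s ^^ (h - 1)) (apply_to_var A m (trans_proof A s n p m)))"

definition state ::
  "'a form \<Rightarrow> nat \<Rightarrow> nat \<Rightarrow> nat \<Rightarrow> (nat \<times> nat \<Rightarrow> nat \<times> nat \<times> nat) \<Rightarrow> 'a deriv" where
  "state A s n h \<delta> =
     LolliR (pow_form A n) A
       (Exch (replicate h (bool_form s A) @ [bool_form n A, bool_form h A, pow_form A n])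
         ((h + 1) # [0..<h + 1] @ [h + 2])
         (branch A [trans_at A s n h (\<lambda>x. fst (snd (\<delta> x))) n j. j \<leftarrow> [0..<h]]))"

definition tapehead ::
  "'a form \<Rightarrow> nat \<Rightarrow> nat \<Rightarrow> nat \<Rightarrow> (nat \<times> nat \<Rightarrow> nat \<times> nat \<times> nat) \<Rightarrow> 'a deriv" where
  "tapehead A s n h \<delta> =
     LolliR (pow_form A h) A
       (Exch (replicate h (bool_form s A) @
               [bool_form n A, bool_form h A, bool_form h A, pow_form A h])
         ((h + 2) # [0..<h + 2] @ [h + 3])
         (branch A
           [Cut 0 (bool_form 2 A)
             (LolliR (pow_form A 2) A (trans_at A s n h (\<lambda>x. snd (snd (\<delta> x))) 2 l))
             (branch A
               [branch A [proj A h ((k + h - 1) mod h). k \<leftarrow> [0..<h]],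
                branch A [proj A h ((k + 1) mod h). k \<leftarrow> [0..<h]]]).
            l \<leftarrow> [0..<h]]))"

definition derelict_promote :: "'a form list \<Rightarrow> 'a form \<Rightarrow> 'a deriv \<Rightarrow> 'a deriv" where
  "derelict_promote \<Gamma> A \<pi> =
     Promote \<Gamma> A (fold (\<lambda>k. Derelict k (\<Gamma> ! k)) [0..<length \<Gamma>] \<pi>)"

fun tensor_proofs :: "('a form \<times> 'a deriv) list \<Rightarrow> 'a deriv" where
  "tensor_proofs [(A, \<pi>)] = \<pi>"
| "tensor_proofs ((A, \<pi>) # (B, \<rho>) # ps) =
     TensorR A (tensor_form (B # map fst ps)) \<pi> (tensor_proofs ((B, \<rho>) # ps))"

definition step_forms :: "'a form \<Rightarrow> nat \<Rightarrow> nat \<Rightarrow> nat \<Rightarrow> 'a form list" where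
  "step_forms A s n h =
     replicate h (Bang (bool_form s A)) @ [Bang (bool_form n A), Bang (bool_form h A)]"

text \<open>The components, promoted and tensored.  Its context consists of \<open>h\<close> blocks
  \<open>\<sigma>_m, q, i\<close>, one block \<open>\<sigma>_0, \<dots>, \<sigma>_(h-1), q, i\<close> and one block
  \<open>\<sigma>_0, \<dots>, \<sigma>_(h-1), q, i, i\<close>.\<close>

definition step_components ::
  "'a form \<Rightarrow> nat \<Rightarrow> nat \<Rightarrow> nat \<Rightarrow> (nat \<times> nat \<Rightarrow> nat \<times> nat \<times> nat) \<Rightarrow> 'a deriv" where
  "step_components A s n h \<delta> =
     (let S = bool_form s A; N = bool_form n A; H = bool_form h A in
      tensor_proofs
        ([(Bang S, derelict_promote [S, N, H] S (symbol A s n h \<delta> m)). m \<leftarrow> [0..<h]] @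
         [(Bang N, derelict_promote (replicate h S @ [N, H]) N (state A s n h \<delta>)),
          (Bang H, derelict_promote (replicate h S @ [N, H, H]) H (tapehead A s n h \<delta>))]))"

text \<open>Exchange collects the hypotheses by input: first the three copies of each \<open>\<sigma>_m\<close>, then \<open>h + 2\<close>
  copies of \<open>q\<close>, then \<open>h + 3\<close> copies of \<open>i\<close>.  The copies are contracted and the
  resulting context \<open>step_forms\<close> is tensored together from the right.\<close>

definition absstep ::
  "'a form \<Rightarrow> nat \<Rightarrow> nat \<Rightarrow> nat \<Rightarrow> (nat \<times> nat \<Rightarrow> nat \<times> nat \<times> nat) \<Rightarrow> 'a deriv" where
  "absstep A s n h \<delta> =
     (let S = bool_form s A; N = bool_form n A; H = bool_form h A; \<Gamma> = step_forms A s n h;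
          collected = Exch
            (replicate (3 * h) (Bang S) @ replicate (h + 2) (Bang N) @ replicate (h + 3) (Bang H))
            (concat [[3 * m, 3 * h + m, 4 * h + 2 + m]. m \<leftarrow> [0..<h]] @
             [3 * m + 1. m \<leftarrow> [0..<h]] @ [4 * h, 5 * h + 2] @
             [3 * m + 2. m \<leftarrow> [0..<h]] @ [4 * h + 1, 5 * h + 3, 5 * h + 4])
            (step_components A s n h \<delta>);
          contracted =
            (Contract (h + 1) H ^^ (h + 2)) ((Contract h N ^^ (h + 1))
              (fold (\<lambda>m. Contract m S ^^ 2) [0..<h] collected))
      in fold (\<lambda>k. TensorL k (\<Gamma> ! k) (tensor_form (drop (Suc k) \<Gamma>))) (rev [0..<h + 1]) contracted)"

text \<open>The proofs above are derivations of the intended sequents.\<close>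

lemma proves_branch:
  assumes "ts \<noteq> []" "\<And>t. t \<in> set ts \<Longrightarrow> proves t \<Gamma> A"
  shows "proves (branch A ts) (bool_form (length ts) A # \<Gamma>) A"
proof -
  have "proves (tuple A ts) \<Gamma> (pow_form A (length ts))"
    using assms by (induction A ts rule: tuple.induct) (auto intro: proves.withR)
  from proves.lolliL[OF this, of "Ax A" "[]" A "[]" A] show ?thesis
    by (simp add: branch_def bool_form_def proves.ax)
qed

lemma proves_proj: "i < m \<Longrightarrow> proves (proj A m i) [pow_form A m] A"
proof (induction A m i rule: proj.induct)
  case (2 A m)
  show ?case using proves.withL1[of "Ax A" "[]" A "[]" A] by (simp add: proves.ax)
next
  case (3 A m i)
  then show ?case using proves.withL2[of _ "[]" _ "[]"] by simp
qed (auto intro: proves.ax)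

lemma proves_branch_map:
  assumes "m \<ge> 1" "\<And>j. j < m \<Longrightarrow> proves (f j) \<Gamma> A"
  shows "proves (branch A (map f [0..<m])) (bool_form m A # \<Gamma>) A"
proof -
  have "proves (branch A (map f [0..<m])) (bool_form (length (map f [0..<m])) A # \<Gamma>) A"
    by (rule proves_branch) (use assms in auto)
  then show ?thesis by simp
qed

lemma proves_discard:
  assumes "m \<ge> 1" "proves t \<Gamma> A"
  shows "proves (discard A m t) (bool_form m A # \<Gamma>) A"
  using proves_branch[of "replicate m t"] assms by (auto simp: discard_def)

lemma proves_apply_var: "proves (apply_var A m) [bool_form m A, pow_form A m] A"
  using proves.lolliL[of "Ax (pow_form A m)" _ _ "Ax A" "[]" A "[]"]
  by (simp add: apply_var_def bool_form_def proves.ax)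

lemma proves_apply_to_var:
  "proves t \<Gamma> (bool_form m A) \<Longrightarrow> proves (apply_to_var A m t) (\<Gamma> @ [pow_form A m]) A"
  using proves.cut[of t \<Gamma> "bool_form m A" "apply_var A m" "[]"] proves_apply_var[of A m]
  by (simp add: apply_to_var_def)

lemma proves_bool: "proves t (\<Gamma> @ [pow_form A m]) A \<Longrightarrow> proves (LolliR (pow_form A m) A t) \<Gamma> (bool_form m A)"
  unfolding bool_form_def by (rule proves.lolliR)

lemma proves_trans:
  assumes "s \<ge> 1" "n \<ge> 1" "\<And>i q. i < s \<Longrightarrow> q < n \<Longrightarrow> p (i, q) < m"
  shows "proves (trans_proof A s n p m) [bool_form s A, bool_form n A] (bool_form m A)"
  unfolding trans_proof_def
  apply (rule proves_bool)
  apply simp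
  apply (intro proves_branch_map proves_proj assms; assumption?)
  done

lemma proves_symbol:
  assumes "s \<ge> 1" "n \<ge> 1" "h \<ge> 1" "\<And>i q. i < s \<Longrightarrow> q < n \<Longrightarrow> fst (\<delta> (i, q)) < s"
  shows "proves (symbol A s n h \<delta> m) [bool_form s A, bool_form n A, bool_form h A] (bool_form s A)"
proof -
  have 1: "proves (apply_to_var A s (trans_proof A s n (\<lambda>x. fst (\<delta> x)) s))
      [bool_form s A, bool_form n A, pow_form A s] A"
    using proves_apply_to_var[OF proves_trans, of s n "\<lambda>x. fst (\<delta> x)" s] assms by simp
  have 2: "proves (Exch [bool_form s A, bool_form n A, pow_form A s] [1, 0, 2]
                   (discard A n (apply_var A s))) [bool_form s A, bool_form n A, pow_form A s] A"
    by (rule proves.exch) (auto intro: proves_discard proves_apply_var assms)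
  show ?thesis unfolding symbol_def
    apply (rule proves_bool)
    apply (simp only: append_Cons append_Nil)
    apply (rule proves.exch)
    using 1 2 assms apply (auto intro!: proves_branch_map simp: numeral_3_eq_3)
    done
qed

lemma proves_discards:
  "m \<ge> 1 \<Longrightarrow> proves t \<Gamma> A \<Longrightarrow> proves ((discard A m ^^ k) t) (replicate k (bool_form m A) @ \<Gamma>) A"
  by (induction k) (auto intro: proves_discard)

lemma proves_trans_at:
  assumes "s \<ge> 1" "n \<ge> 1" "\<And>i q. i < s \<Longrightarrow> q < n \<Longrightarrow> p (i, q) < m" "j < h"
  shows "proves (trans_at A s n h p m j)
           (replicate h (bool_form s A) @ [bool_form n A, pow_form A m]) A"
proof -
  have L: "length (filter (\<lambda>l. l \<noteq> j) [0..<h]) = h - 1"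
  proof -
    have "length (filter (\<lambda>l. l \<noteq> j) [0..<h]) = card ({..<h} - {j})"
      by (subst distinct_card[symmetric]) (auto intro!: arg_cong[of _ _ card])
    with assms show ?thesis by simp
  qed
  have E: "concat (map (\<lambda>l. if l \<noteq> j then [l] else []) [0..<h]) = filter (\<lambda>l. l \<noteq> j) [0..<h]"
    by (induction h) auto
  have M: "map ((!) (replicate h (bool_form s A) @ [bool_form n A, pow_form A m]))
      (filter (\<lambda>l. l \<noteq> j) [0..<h]) = replicate (h - 1) (bool_form s A)"
    by (rule replicate_eqI) (auto simp: L nth_append)
  show ?thesis unfolding trans_at_def E
    apply (rule proves.exch)
    apply (simp only: map_append M)
    apply (rule proves_discards[OF assms(1)])
    using proves_apply_to_var[OF proves_trans[of s n p m, OF assms(1,2,3)]] assms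
    apply (auto simp: nth_append)
    done
qed

lemma proves_state:
  assumes "s \<ge> 1" "n \<ge> 1" "h \<ge> 1" "\<And>i q. i < s \<Longrightarrow> q < n \<Longrightarrow> fst (snd (\<delta> (i, q))) < n"
  shows "proves (state A s n h \<delta>)
    (replicate h (bool_form s A) @ [bool_form n A, bool_form h A]) (bool_form n A)"
proof -
  have E: "map ((!) (replicate h (bool_form s A) @ [bool_form n A, bool_form h A, pow_form A n]))
     ((h + 1) # [0..<h + 1] @ [h + 2]) =
     bool_form h A # replicate h (bool_form s A) @ [bool_form n A, pow_form A n]"
    by (rule nth_equalityI) (auto simp: nth_append nth_Cons' simp del: upt_Suc)
  show ?thesis unfolding state_def
    apply (rule proves_bool, simp only: append_assoc append_Cons append_Nil, rule proves.exch)
      apply (unfold E)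
    by (auto intro!: proves_branch_map proves_trans_at assms simp del: upt_Suc)
qed

lemma proves_tapehead:
  assumes "s \<ge> 1" "n \<ge> 1" "h \<ge> 1" "\<And>i q. i < s \<Longrightarrow> q < n \<Longrightarrow> snd (snd (\<delta> (i, q))) < 2"
  shows "proves (tapehead A s n h \<delta>)
    (replicate h (bool_form s A) @ [bool_form n A, bool_form h A, bool_form h A]) (bool_form h A)"
proof -
  have E: "map ((!) (replicate h (bool_form s A) @ [bool_form n A, bool_form h A, bool_form h A, pow_form A h]))
     ((h + 2) # [0..<h + 2] @ [h + 3]) =
     bool_form h A # replicate h (bool_form s A) @ [bool_form n A, bool_form h A, pow_form A h]"
    by (rule nth_equalityI) (auto simp: nth_append nth_Cons' numeral_3_eq_3 simp del: upt_Suc)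
  let ?rot = "branch A
               [branch A [proj A h ((k + h - 1) mod h). k \<leftarrow> [0..<h]],
                branch A [proj A h ((k + 1) mod h). k \<leftarrow> [0..<h]]]"
  have R: "proves ?rot ([] @ bool_form 2 A # [bool_form h A, pow_form A h]) A"
    using proves_branch[of "[branch A [proj A h ((k + h - 1) mod h). k \<leftarrow> [0..<h]],
                branch A [proj A h ((k + 1) mod h). k \<leftarrow> [0..<h]]]" "[bool_form h A, pow_form A h]" A] assms
    apply (simp add: numeral_2_eq_2)
    apply (erule meta_mp)
    apply (elim disjE; simp)
    by (rule proves_branch_map, simp, rule proves_proj, simp)+
  have C: "proves (Cut 0 (bool_form 2 A)
             (LolliR (pow_form A 2) A (trans_at A s n h (\<lambda>x. snd (snd (\<delta> x))) 2 l)) ?rot)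
        (replicate h (bool_form s A) @ [bool_form n A, bool_form h A, pow_form A h]) A" if "l < h" for l
  proof -
    have "proves (LolliR (pow_form A 2) A (trans_at A s n h (\<lambda>x. snd (snd (\<delta> x))) 2 l))
        (replicate h (bool_form s A) @ [bool_form n A]) (bool_form 2 A)"
      by (rule proves_bool) (auto intro!: proves_trans_at assms that)
    from proves.cut[OF this R] show ?thesis by simp
  qed
  show ?thesis unfolding tapehead_def
    apply (rule proves_bool, simp only: append_assoc append_Cons append_Nil, rule proves.exch)
      apply (unfold E)
      apply (rule proves_branch_map[OF assms(3) C], assumption)
    by (auto simp del: upt_Suc)
qed


lemma proves_derelict_promote:
  assumes "proves \<pi> \<Gamma> A"
  shows "proves (derelict_promote \<Gamma> A \<pi>) (map Bang \<Gamma>) (Bang A)"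
proof -
  have "j \<le> length \<Gamma> \<Longrightarrow>
      proves (fold (\<lambda>k. Derelict k (\<Gamma> ! k)) [0..<j] \<pi>) (map Bang (take j \<Gamma>) @ drop j \<Gamma>) A" for j
  proof (induction j)
    case (Suc j)
    then have "proves (fold (\<lambda>k. Derelict k (\<Gamma> ! k)) [0..<j] \<pi>)
        (map Bang (take j \<Gamma>) @ \<Gamma> ! j # drop (Suc j) \<Gamma>) A"
      by (simp add: Cons_nth_drop_Suc)
    from proves.derelict[OF this] Suc.prems show ?case
      by (simp add: take_Suc_conv_app_nth min_absorb2)
  qed (use assms in simp)
  from this[of "length \<Gamma>"] show ?thesis
    unfolding derelict_promote_def by (intro proves.promote) simp
qed

lemma proves_tensor_proofs:
  assumes "ps \<noteq> []" "list_all2 (\<lambda>(A, \<pi>) \<Gamma>. proves \<pi> \<Gamma> A) ps \<Gamma>s"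
  shows "proves (tensor_proofs ps) (concat \<Gamma>s) (tensor_form (map fst ps))"
  using assms
proof (induction ps arbitrary: \<Gamma>s rule: tensor_proofs.induct)
  case (1 A \<pi>)
  then show ?case by (auto simp: list_all2_Cons1)
next
  case (2 A \<pi> B \<rho> ps)
  then obtain \<Gamma> \<Gamma>s' where G: "\<Gamma>s = \<Gamma> # \<Gamma>s'" "proves \<pi> \<Gamma> A"
    "list_all2 (\<lambda>(A, \<pi>) \<Gamma>. proves \<pi> \<Gamma> A) ((B, \<rho>) # ps) \<Gamma>s'"
    by (auto simp: list_all2_Cons1)
  from 2(1)[OF _ G(3)] G show ?case by (auto intro: proves.tensorR)
qed simp

lemma proves_contracts:
  "proves \<pi> (\<Gamma> @ replicate (Suc c) (Bang A) @ \<Delta>) C \<Longrightarrow>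
   proves ((Contract (length \<Gamma>) A ^^ c) \<pi>) (\<Gamma> @ Bang A # \<Delta>) C"
proof (induction c arbitrary: \<pi>)
  case (Suc c)
  from Suc.prems have "proves \<pi> (\<Gamma> @ Bang A # Bang A # replicate c (Bang A) @ \<Delta>) C" by simp
  from proves.contract[OF this] have "proves (Contract (length \<Gamma>) A \<pi>)
    (\<Gamma> @ replicate (Suc c) (Bang A) @ \<Delta>) C" by simp
  from Suc.IH[OF this] show ?case by (simp add: funpow_swap1)
qed simp

lemma proves_contract_triples:
  assumes "proves \<pi> (replicate (3 * h) (Bang A) @ \<Delta>) C"
  shows "proves (fold (\<lambda>m. Contract m A ^^ 2) [0..<h] \<pi>) (replicate h (Bang A) @ \<Delta>) C"
proof -
  have "k \<le> h \<Longrightarrow> proves (fold (\<lambda>m. Contract m A ^^ 2) [0..<k] \<pi>)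
      (replicate k (Bang A) @ replicate (3 * (h - k)) (Bang A) @ \<Delta>) C" for k
  proof (induction k)
    case (Suc k)
    then have "3 * (h - k) = Suc 2 + 3 * (h - Suc k)" by simp
    with Suc have "proves (fold (\<lambda>m. Contract m A ^^ 2) [0..<k] \<pi>)
      (replicate k (Bang A) @ replicate (Suc 2) (Bang A) @ replicate (3 * (h - Suc k)) (Bang A) @ \<Delta>) C"
      by (simp only: replicate_add append_assoc)
    from proves_contracts[OF this] show ?case
      by (simp add: replicate_app_Cons_same)
  qed (use assms in simp)
  from this[of h] show ?thesis by simp
qed

lemma proves_tensorL_all:
  "k < length \<Gamma> \<Longrightarrow> proves \<pi> (take k \<Gamma> @ [tensor_form (drop k \<Gamma>)]) C \<Longrightarrow>
   proves (fold (\<lambda>k. TensorL k (\<Gamma> ! k) (tensor_form (drop (Suc k) \<Gamma>))) (rev [0..<k]) \<pi>)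
     [tensor_form \<Gamma>] C"
proof (induction k arbitrary: \<pi>)
  case (Suc k)
  then have "proves \<pi> (take k \<Gamma> @ \<Gamma> ! k # tensor_form (drop (Suc k) \<Gamma>) # []) C"
    by (simp add: take_Suc_conv_app_nth)
  note * = proves.tensorL[OF this]
  from Suc.prems have "drop k \<Gamma> = \<Gamma> ! k # drop (Suc k) \<Gamma>" "drop (Suc k) \<Gamma> \<noteq> []"
    by (auto simp: Cons_nth_drop_Suc)
  then have "tensor_form (drop k \<Gamma>) = Tensor (\<Gamma> ! k) (tensor_form (drop (Suc k) \<Gamma>))"
    by (cases "drop (Suc k) \<Gamma>") auto
  with * Suc.prems Suc.IH show ?case by (simp add: min_absorb2)
qed simp

lemma proves_absstep:
  assumes "s \<ge> 1" "n \<ge> 1" "h \<ge> 1" "\<delta> \<in> {..<s} \<times> {..<n} \<rightarrow> {..<s} \<times> {..<n} \<times> {0, 1}"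
  shows "proves (absstep A s n h \<delta>) [tensor_form (step_forms A s n h)] (tensor_form (step_forms A s n h))"
proof -
  have d: "fst (\<delta> (i, q)) < s \<and> fst (snd (\<delta> (i, q))) < n \<and> snd (snd (\<delta> (i, q))) < 2"
    if "i < s" "q < n" for i q
    using funcset_mem[OF assms(4), of "(i, q)"] that by (auto simp: mem_Times_iff)
  define S N H where SNH: "S = bool_form s A" "N = bool_form n A" "H = bool_form h A"
  define ctx where "ctx = concat (map (\<lambda>m. [Bang S, Bang N, Bang H]) [0..<h]) @
     (replicate h (Bang S) @ [Bang N, Bang H]) @ (replicate h (Bang S) @ [Bang N, Bang H, Bang H])"
  have comp: "proves (step_components A s n h \<delta>) ctx (tensor_form (step_forms A s n h))"
  proof -
    let ?ps = "[(Bang S, derelict_promote [S, N, H] S (symbol A s n h \<delta> m)). m \<leftarrow> [0..<h]] @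
         [(Bang N, derelict_promote (replicate h S @ [N, H]) N (state A s n h \<delta>)),
          (Bang H, derelict_promote (replicate h S @ [N, H, H]) H (tapehead A s n h \<delta>))]"
    let ?Gs = "map (\<lambda>m. [Bang S, Bang N, Bang H]) [0..<h] @
     [replicate h (Bang S) @ [Bang N, Bang H], replicate h (Bang S) @ [Bang N, Bang H, Bang H]]"
    have "list_all2 (\<lambda>(A, \<pi>) \<Gamma>. proves \<pi> \<Gamma> A) ?ps ?Gs"
    proof (rule list_all2_appendI)
      show "list_all2 (\<lambda>(A, \<pi>) \<Gamma>. proves \<pi> \<Gamma> A)
         (map (\<lambda>m. (Bang S, derelict_promote [S, N, H] S (symbol A s n h \<delta> m))) [0..<h])
         (map (\<lambda>m. [Bang S, Bang N, Bang H]) [0..<h])"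
        using proves_derelict_promote[OF proves_symbol[of s n h \<delta> A]] assms(1-3) d
        by (simp add: list_all2_conv_all_nth SNH)
      show "list_all2 (\<lambda>(A, \<pi>) \<Gamma>. proves \<pi> \<Gamma> A)
         [(Bang N, derelict_promote (replicate h S @ [N, H]) N (state A s n h \<delta>)),
          (Bang H, derelict_promote (replicate h S @ [N, H, H]) H (tapehead A s n h \<delta>))]
         [replicate h (Bang S) @ [Bang N, Bang H], replicate h (Bang S) @ [Bang N, Bang H, Bang H]]"
        using proves_derelict_promote[OF proves_state[of s n h \<delta> A]]
          proves_derelict_promote[OF proves_tapehead[of s n h \<delta> A]] assms(1-3) d
        by (simp add: SNH)
    qed
    from proves_tensor_proofs[OF _ this] show ?thesis
      by (simp add: step_components_def step_forms_def Let_def ctx_def SNH comp_def map_replicate_const)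
  qed
  define js where "js = concat [[3 * m, 3 * h + m, 4 * h + 2 + m]. m \<leftarrow> [0..<h]] @
             [3 * m + 1. m \<leftarrow> [0..<h]] @ [4 * h, 5 * h + 2] @
             [3 * m + 2. m \<leftarrow> [0..<h]] @ [4 * h + 1, 5 * h + 3, 5 * h + 4]"
  define \<Gamma> where "\<Gamma> = replicate (3 * h) (Bang S) @ replicate (h + 2) (Bang N) @ replicate (h + 3) (Bang H)"
  have lenc: "length (concat (map (\<lambda>m. [3 * m, 3 * h + m, 4 * h + 2 + m]) [0..<k])) = 3 * k" for k
    by (induction k) auto
  have set_js: "set js = {..<5 * h + 5}"
  proof
    show "set js \<subseteq> {..<5 * h + 5}" by (auto simp: js_def)
    have mem: "\<And>m. m < h \<Longrightarrow> 3 * m \<in> set js" "\<And>m. m < h \<Longrightarrow> 3 * m + 1 \<in> set js"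
      "\<And>m. m < h \<Longrightarrow> 3 * m + 2 \<in> set js" "\<And>m. m < h \<Longrightarrow> 3 * h + m \<in> set js"
      "\<And>m. m < h \<Longrightarrow> 4 * h + 2 + m \<in> set js"
      "{4 * h, 5 * h + 2, 4 * h + 1, 5 * h + 3, 5 * h + 4} \<subseteq> set js"
      unfolding js_def by (simp; blast)+
    show "{..<5 * h + 5} \<subseteq> set js"
    proof
      fix x assume x: "x \<in> {..<5 * h + 5}"
      consider "x < 3 * h" | "3 * h \<le> x" "x < 4 * h" | "4 * h + 2 \<le> x" "x < 5 * h + 2"
        | "x \<in> {4 * h, 5 * h + 2, 4 * h + 1, 5 * h + 3, 5 * h + 4}"
        using x by force
      then show "x \<in> set js"
      proof cases
        case 1
        then have "x div 3 < h" by (simp add: div_less_iff_less_mult mult.commute)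
        moreover have "x = 3 * (x div 3) \<or> x = 3 * (x div 3) + 1 \<or> x = 3 * (x div 3) + 2" by presburger
        ultimately show ?thesis using mem(1-3)[of "x div 3"] by metis
      next
        case 2
        then show ?thesis using mem(4)[of "x - 3 * h"] by simp
      next
        case 3
        then have "x = 4 * h + 2 + (x - (4 * h + 2))" "x - (4 * h + 2) < h" by simp_all
        then show ?thesis using mem(5) by metis
      qed (use mem(6) in blast)
    qed
  qed
  have len_js: "length js = 5 * h + 5" unfolding js_def by (simp only: length_append lenc) simp
  have dist: "distinct js" using set_js len_js by (intro card_distinct) simp
  have mapjs: "map ((!) \<Gamma>) js = ctx"
  proof -
    have "map ((!) \<Gamma>) (concat (map (\<lambda>m. [3 * m, 3 * h + m, 4 * h + 2 + m]) [0..<h])) =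
        concat (map (\<lambda>m. [Bang S, Bang N, Bang H]) [0..<h])"
      unfolding map_concat map_map
      by (rule arg_cong[of _ _ concat]) (auto simp: \<Gamma>_def nth_append nth_Cons')
    moreover have "map ((!) \<Gamma>) (map (\<lambda>m. 3 * m + 1) [0..<h]) = replicate h (Bang S)"
      by (rule nth_equalityI) (auto simp: \<Gamma>_def nth_append nth_Cons')
    moreover have "map ((!) \<Gamma>) (map (\<lambda>m. 3 * m + 2) [0..<h]) = replicate h (Bang S)"
      by (rule nth_equalityI) (auto simp: \<Gamma>_def nth_append nth_Cons')
    moreover have "map ((!) \<Gamma>) [4 * h, 5 * h + 2] = [Bang N, Bang H]"
      using assms(3) by (auto simp: \<Gamma>_def nth_append nth_Cons')
    moreover have "map ((!) \<Gamma>) [4 * h + 1, 5 * h + 3, 5 * h + 4] = [Bang N, Bang H, Bang H]"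
      using assms(3) by (auto simp: \<Gamma>_def nth_append nth_Cons')
    ultimately show ?thesis unfolding js_def ctx_def by (simp only: map_append append_assoc)
  qed
  have "proves (Exch \<Gamma> js (step_components A s n h \<delta>)) \<Gamma> (tensor_form (step_forms A s n h))"
    by (rule proves.exch) (use comp mapjs dist set_js in \<open>auto simp: \<Gamma>_def\<close>)
  note 1 = proves_contract_triples[OF this[unfolded \<Gamma>_def]]
  have "replicate h (Bang S) @ replicate (h + 2) (Bang N) @ replicate (h + 3) (Bang H) =
      replicate h (Bang S) @ replicate (Suc (h + 1)) (Bang N) @ replicate (h + 3) (Bang H)" by simp
  from proves_contracts[OF 1[unfolded this]]
  have 2: "proves ((Contract h N ^^ (h + 1)) (fold (\<lambda>m. Contract m S ^^ 2) [0..<h]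
        (Exch \<Gamma> js (step_components A s n h \<delta>))))
     ((replicate h (Bang S) @ [Bang N]) @ replicate (Suc (h + 2)) (Bang H) @ [])
     (tensor_form (step_forms A s n h))"
    by (simp add: \<Gamma>_def numeral_3_eq_3)
  let ?G = "step_forms A s n h"
  have G: "take (h + 1) ?G @ [tensor_form (drop (h + 1) ?G)] = (replicate h (Bang S) @ [Bang N]) @ Bang H # []"
    by (simp add: step_forms_def SNH)
  from proves_contracts[OF 2] have "proves ((Contract (h + 1) H ^^ (h + 2))
     ((Contract h N ^^ (h + 1)) (fold (\<lambda>m. Contract m S ^^ 2) [0..<h]
        (Exch \<Gamma> js (step_components A s n h \<delta>)))))
     (take (h + 1) ?G @ [tensor_form (drop (h + 1) ?G)]) (tensor_form ?G)"
    unfolding G by simp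
  from proves_tensorL_all[OF _ this] show ?thesis
    unfolding absstep_def Let_def SNH[symmetric] \<Gamma>_def[symmetric] js_def[symmetric]
    by (simp add: step_forms_def del: upt_Suc)
qed

end

theory Submission
  imports Defs
begin

text \<open>
  A morphism of coalgebras maps group-like elements to group-like elements, a pure tensor of
  group-like elements is group-like in the tensor product coalgebra, and a group-like element of a
  cofree coalgebra is determined by its image under the universal map.  Hence a promoted proof,
  evaluated at vacua over \<open>P1, \<dots>, Pr\<close>, yields the vacuum over the value of the derelicted
  proof at \<open>P1, \<dots>, Pr\<close>; since contraction merely duplicates group-like elements, the
  step acts on vacua componentwise through its three kinds of components.  These
  are computed by linearity, as applying \<open>\<Sum>i. p i \<cdot> bool_vec i\<close> to a tuple
  gives the combination of its entries with coefficients \<open>p i\<close>; a discarded hypothesis contributes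
  the factor \<open>\<Sum>i. p i\<close>.

  Promotion denotes a coalgebra morphism only because the tensor product of cocommutative coalgebras
  is one.  This is checked on pure tensors, where all iterated coproducts are finite sums
  over lists of Sweedler components.
\<close>

section \<open>Multilinear maps between subspaces\<close>

text \<open>The obstacle is that \<open>lift\<close>, \<open>vacuum\<close> and the denotation of
  promotion are definite descriptions: their values are unknown until existence and uniqueness are.
  For \<open>lift\<close> this is multilinearity of the lifted function, so each rule of the
  calculus needs its own multilinearity proof before it can be evaluated anywhere; for promotion it
  is cofreeness, applied to the tensor product of the hypotheses. The universal property quantifies
  over coalgebras inside the tensor type, and both coalgebras needed here live there: the products
  of the hypotheses and the ground field \<open>tensor sm []\<close>. Lifts are moreover nested, as
  coproducts of coproducts. They are replaced by sums over a chosen list of Sweedler components: the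
  list does not depend on the other arguments, which makes linearity in those visible, and linear
  maps out of the tensor space remove the dependence on the choice. The final computation only needs
  denotations at pure tensors, so each derivation is replayed on a context of formulas paired with
  vectors.\<close>

definition vspace :: "('k::field \<Rightarrow> 'v::ab_group_add \<Rightarrow> 'v) \<Rightarrow> 'v set \<Rightarrow> bool" where
  "vspace s V \<longleftrightarrow> vector_space s \<and> module.subspace s V"

lemma vspace_vector_space: "vspace s V \<Longrightarrow> vector_space s"
  by (simp add: vspace_def)

lemma vspace_module: "vspace s V \<Longrightarrow> module s"
  by (simp add: vspace_def module_iff_vector_space)

lemma vspace_UNIV: "vector_space s \<Longrightarrow> vspace s UNIV"
  by (simp add: vspace_def module.subspace_UNIV module_iff_vector_space)

lemma
  assumes "vspace s V"
  shows vspace_zero: "0 \<in> V"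
    and vspace_add: "x \<in> V \<Longrightarrow> y \<in> V \<Longrightarrow> x + y \<in> V"
    and vspace_scale: "x \<in> V \<Longrightarrow> s c x \<in> V"
    and vspace_sum: "\<forall>i\<in>I. f i \<in> V \<Longrightarrow> sum f I \<in> V"
  using assms vspace_module[OF assms]
  by (auto simp: vspace_def module.subspace_0 module.subspace_add module.subspace_scale module.subspace_sum)

lemma
  assumes "vspace s V"
  shows scale_add: "s c (x + y) = s c x + s c y"
    and scale_add_left: "s (c + d) x = s c x + s d x"
    and scale_scale: "s c (s d x) = s (c * d) x"
    and scale_one: "s 1 x = x"
    and scale_zero: "s c 0 = 0"
    and scale_zero_left: "s 0 x = 0"
    and scale_sum: "s c (sum f I) = (\<Sum>i\<in>I. s c (f i))"
    and scale_sum_left: "s (sum g I) x = (\<Sum>i\<in>I. s (g i) x)"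
proof -
  interpret vector_space s using assms by (simp add: vspace_def)
  show "s c (x + y) = s c x + s c y" "s (c + d) x = s c x + s d x" "s c (s d x) = s (c * d) x"
    "s 1 x = x" "s c 0 = 0" "s 0 x = 0" "s c (sum f I) = (\<Sum>i\<in>I. s c (f i))"
    "s (sum g I) x = (\<Sum>i\<in>I. s (g i) x)"
    by (simp_all add: scale_right_distrib scale_left_distrib scale_sum_right scale_sum_left)
qed

lemma vspace_sum_list: "vspace s V \<Longrightarrow> (\<And>i. i \<in> set is \<Longrightarrow> f i \<in> V) \<Longrightarrow> (\<Sum>i\<leftarrow>is. f i) \<in> V"
  by (induction "is") (auto intro: vspace_zero vspace_add)

lemma vspace_field: "vspace (*) (UNIV :: 'k::field set)"
  by (rule vspace_UNIV[OF vector_space_mult])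

lemma vspace_tensor:
  fixes s :: "'k::field \<Rightarrow> 'v::ab_group_add \<Rightarrow> 'v"
  shows "vspace tscale (tensor s Vs)"
proof -
  have "vector_space (tscale :: 'k::field \<Rightarrow> ('k, 'v) tens \<Rightarrow> ('k, 'v) tens)"
    by (rule vector_space_fun_scale[OF vector_space_mult])
  then show ?thesis
    by (simp add: vspace_def tensor_def module.subspace_span module_iff_vector_space)
qed

section \<open>Linear maps between subspaces\<close>

lemma
  assumes "lin_map s t V W f"
  shows lin_map_mem: "x \<in> V \<Longrightarrow> f x \<in> W"
    and lin_map_add: "x \<in> V \<Longrightarrow> y \<in> V \<Longrightarrow> f (x + y) = f x + f y"
    and lin_map_scale: "x \<in> V \<Longrightarrow> f (s c x) = t c (f x)"
  using assms by (auto simp: lin_map_def)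

lemma lin_mapI:
  assumes "\<And>x. x \<in> V \<Longrightarrow> f x \<in> W" "\<And>x y. x \<in> V \<Longrightarrow> y \<in> V \<Longrightarrow> f (x + y) = f x + f y"
    "\<And>c x. x \<in> V \<Longrightarrow> f (s c x) = t c (f x)"
  shows "lin_map s t V W f"
  using assms by (auto simp: lin_map_def)

lemma lin_map_zero: "vspace s V \<Longrightarrow> lin_map s t V W f \<Longrightarrow> f 0 = 0"
  using lin_map_add[of s t V W f 0 0] vspace_zero[of s V] by simp

lemma lin_map_sum:
  assumes "vspace s V" "lin_map s t V W f" "\<forall>i\<in>I. g i \<in> V"
  shows "f (sum g I) = (\<Sum>i\<in>I. f (g i))"
proof (cases "finite I")
  case True
  then show ?thesis using assms(3)
    by (induction I)
      (simp_all add: lin_map_zero[OF assms(1,2)] lin_map_add[OF assms(2)] vspace_sum[OF assms(1)])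
qed (simp add: lin_map_zero[OF assms(1,2)])

lemma lin_map_sum_list:
  assumes "vspace s V" "lin_map s t V W f" "\<And>i. i \<in> set is \<Longrightarrow> g i \<in> V"
  shows "f (\<Sum>i\<leftarrow>is. g i) = (\<Sum>i\<leftarrow>is. f (g i))"
  using assms(3)
  by (induction "is")
    (simp_all add: lin_map_zero[OF assms(1,2)] lin_map_add[OF assms(2)] vspace_sum_list[OF assms(1)])

lemma lin_map_comp: "lin_map s t V W f \<Longrightarrow> lin_map t u W X g \<Longrightarrow> lin_map s u V X (\<lambda>x. g (f x))"
  by (simp add: lin_map_def Pi_iff)

text \<open>Agreement is known on \<open>V\<close> only, so the sums and multiples occurring in
  linearity must stay in \<open>V\<close>; this is what \<open>vspace s V\<close> provides.\<close>

lemma lin_map_cong: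
  "(\<And>x. x \<in> V \<Longrightarrow> f x = g x) \<Longrightarrow> vspace s V \<Longrightarrow> lin_map s t V W g \<Longrightarrow> lin_map s t V W f"
  using vspace_add[of s V] vspace_scale[of s V] by (auto simp: lin_map_def)

lemma lin_map_id: "lin_map s s V V (\<lambda>x. x)"
  by (simp add: lin_map_def)

lemma lin_map_sum_list_fun:
  assumes "vspace t W" "\<And>i. i \<in> set is \<Longrightarrow> lin_map s t V W (f i)"
  shows "lin_map s t V W (\<lambda>x. \<Sum>i\<leftarrow>is. f i x)"
  using assms(2)
  by (induction "is")
    (auto simp: lin_map_def Pi_iff scale_zero[OF assms(1)] scale_add[OF assms(1)] vspace_zero[OF assms(1)]
      vspace_add[OF assms(1)])

lemma Hom_lin_map: "f \<in> Hom s t V W \<Longrightarrow> lin_map s t V W f"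
  by (simp add: Hom_def)

lemma Hom_off: "f \<in> Hom s t V W \<Longrightarrow> x \<notin> V \<Longrightarrow> f x = 0"
  by (simp add: Hom_def)

lemma Hom_restrict:
  "vspace s V \<Longrightarrow> lin_map s t V W f \<Longrightarrow> (\<lambda>x. if x \<in> V then f x else 0) \<in> Hom s t V W"
  using vspace_add[of s V] vspace_scale[of s V] by (auto simp: Hom_def lin_map_def)

section \<open>Tuples of vectors and multilinear maps\<close>

lemma listset_append: "zs \<in> listset (Us @ Vs) \<longleftrightarrow> (\<exists>xs\<in>listset Us. \<exists>ys\<in>listset Vs. zs = xs @ ys)"
  by (simp add: in_listset_iff list_all2_append2 Bex_def) (metis list_all2_lengthD)

lemma listset_Cons: "zs \<in> listset (V # Vs) \<longleftrightarrow> (\<exists>x\<in>V. \<exists>xs\<in>listset Vs. zs = x # xs)"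
  by (auto simp: set_Cons_def)

declare listset.simps(2)[simp del]

lemma ball_listset_Cons:
  "(\<forall>xs\<in>listset (V # Vs). P xs) \<longleftrightarrow> (\<forall>v\<in>V. \<forall>xs\<in>listset Vs. P (v # xs))"
  by (auto simp: listset_Cons)

lemma Cons_in_listset [simp]: "x # xs \<in> listset (V # Vs) \<longleftrightarrow> x \<in> V \<and> xs \<in> listset Vs"
  by (auto simp: listset_Cons)

lemma append_in_listset: "xs \<in> listset Us \<Longrightarrow> ys \<in> listset Vs \<Longrightarrow> xs @ ys \<in> listset (Us @ Vs)"
  by (auto simp: listset_append)

text \<open>\<open>multilinear_on\<close> does not restrict the values. The target subspace
  \<open>W\<close> is recorded here because the value of one proof becomes an argument of
  another.\<close>

definition mlin ::
  "('k::field \<Rightarrow> 'v::ab_group_add \<Rightarrow> 'v) \<Rightarrow> ('k \<Rightarrow> 'w::ab_group_add \<Rightarrow> 'w)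
    \<Rightarrow> 'v set list \<Rightarrow> 'w set \<Rightarrow> ('v list \<Rightarrow> 'w) \<Rightarrow> bool" where
  "mlin s t Vs W f \<longleftrightarrow> multilinear_on s t Vs f \<and> (\<forall>xs\<in>listset Vs. f xs \<in> W)"

lemma mlin_mem: "mlin s t Vs W f \<Longrightarrow> xs \<in> listset Vs \<Longrightarrow> f xs \<in> W"
  by (simp add: mlin_def)

lemma mlin_iff:
  "mlin s t Vs W f \<longleftrightarrow> (\<forall>xs\<in>listset Vs. f xs \<in> W) \<and>
     (\<forall>Us V Ws. Vs = Us @ V # Ws \<longrightarrow>
       (\<forall>xs\<in>listset Us. \<forall>ys\<in>listset Ws. lin_map s t V W (\<lambda>v. f (xs @ v # ys))))"
  by (auto simp: mlin_def multilinear_on_def lin_map_def append_in_listset)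

lemma mlin_slot:
  "mlin s t (Us @ V # Ws) W f \<Longrightarrow> xs \<in> listset Us \<Longrightarrow> ys \<in> listset Ws \<Longrightarrow>
    lin_map s t V W (\<lambda>v. f (xs @ v # ys))"
  by (simp add: mlin_iff)

lemma mlin_Nil [simp]: "mlin s t [] W f \<longleftrightarrow> f [] \<in> W"
  by (simp add: mlin_iff)

text \<open>Every slot of a concatenation lies in exactly one of the two blocks, and the entries of
  the other block are then constants. Multilinearity can therefore be checked block by
  block.\<close>

lemma mlin_append:
  "mlin s t (Us @ Vs) W f \<longleftrightarrow>
     (\<forall>ys\<in>listset Vs. mlin s t Us W (\<lambda>xs. f (xs @ ys))) \<and>
     (\<forall>xs\<in>listset Us. mlin s t Vs W (\<lambda>ys. f (xs @ ys)))" (is "?L \<longleftrightarrow> ?R")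
proof
  assume L: ?L
  show ?R
  proof (intro conjI ballI)
    fix ys assume ys: "ys \<in> listset Vs"
    show "mlin s t Us W (\<lambda>xs. f (xs @ ys))"
      unfolding mlin_iff
    proof (intro conjI ballI allI impI)
      fix Us1 V Us2 xs xs'
      assume "Us = Us1 @ V # Us2" "xs \<in> listset Us1" "xs' \<in> listset Us2"
      with L ys show "lin_map s t V W (\<lambda>v. f ((xs @ v # xs') @ ys))"
        using mlin_slot[of s t Us1 V "Us2 @ Vs" W f xs "xs' @ ys"] by (simp add: append_in_listset)
    qed (use L ys in \<open>auto simp: append_in_listset mlin_mem\<close>)
  next
    fix xs assume xs: "xs \<in> listset Us"
    show "mlin s t Vs W (\<lambda>ys. f (xs @ ys))"
      unfolding mlin_iff
    proof (intro conjI ballI allI impI)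
      fix Vs1 V Vs2 ys ys'
      assume "Vs = Vs1 @ V # Vs2" "ys \<in> listset Vs1" "ys' \<in> listset Vs2"
      with L xs show "lin_map s t V W (\<lambda>v. f (xs @ ys @ v # ys'))"
        using mlin_slot[of s t "Us @ Vs1" V "Vs2" W f "xs @ ys" ys'] by (simp add: append_in_listset)
    qed (use L xs in \<open>auto simp: append_in_listset mlin_mem\<close>)
  qed
next
  assume R: ?R
  show ?L
    unfolding mlin_iff
  proof (intro conjI ballI allI impI)
    fix zs assume "zs \<in> listset (Us @ Vs)"
    then show "f zs \<in> W" using R by (force simp: listset_append dest: mlin_mem)
  next
    fix As V Bs xs ys assume eq: "Us @ Vs = As @ V # Bs" and xs: "xs \<in> listset As" and ys: "ys \<in> listset Bs"
    from eq consider Us2 where "Us = As @ V # Us2" "Bs = Us2 @ Vs"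
      | Vs1 where "Vs = Vs1 @ V # Bs" "As = Us @ Vs1"
      by (auto simp: append_eq_append_conv2 append_eq_Cons_conv)
    then show "lin_map s t V W (\<lambda>v. f (xs @ v # ys))"
    proof cases
      case 1
      then obtain ys1 ys2 where "ys = ys1 @ ys2" "ys1 \<in> listset Us2" "ys2 \<in> listset Vs"
        using ys by (auto simp: listset_append)
      with 1 xs R show ?thesis using mlin_slot[of s t As V Us2 W "\<lambda>xs. f (xs @ ys2)" xs ys1] by simp
    next
      case 2
      then obtain xs1 xs2 where "xs = xs1 @ xs2" "xs1 \<in> listset Us" "xs2 \<in> listset Vs1"
        using xs by (auto simp: listset_append)
      with 2 ys R show ?thesis using mlin_slot[of s t Vs1 V Bs W "\<lambda>ys. f (xs1 @ ys)" xs2 ys] by simp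
    qed
  qed
qed

lemma mlin_single: "mlin s t [V] W f \<longleftrightarrow> lin_map s t V W (\<lambda>v. f [v])"
  by (auto simp: mlin_iff Cons_eq_append_conv listset_Cons dest: lin_map_mem)

lemma mlin_Cons:
  "mlin s t (V # Vs) W f \<longleftrightarrow>
     (\<forall>xs\<in>listset Vs. lin_map s t V W (\<lambda>v. f (v # xs))) \<and>
     (\<forall>v\<in>V. mlin s t Vs W (\<lambda>xs. f (v # xs)))"
  by (simp add: mlin_append[of s t "[V]" Vs W f, simplified] mlin_single ball_listset_Cons)

lemma mlin_comp: "mlin s t Vs W f \<Longrightarrow> lin_map t u W X h \<Longrightarrow> mlin s u Vs X (\<lambda>xs. h (f xs))"
  unfolding mlin_iff
  by (intro conjI ballI allI impI, simp add: lin_map_mem)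
    (rule lin_map_comp[of s t _ W], simp_all)

lemma mlin_cong:
  assumes "\<And>xs. xs \<in> listset Vs \<Longrightarrow> f xs = g xs" "\<And>V. V \<in> set Vs \<Longrightarrow> vspace s V" "mlin s t Vs W g"
  shows "mlin s t Vs W f"
  unfolding mlin_iff
proof (intro conjI ballI allI impI)
  fix Us V Ws xs ys assume *: "Vs = Us @ V # Ws" "xs \<in> listset Us" "ys \<in> listset Ws"
  show "lin_map s t V W (\<lambda>v. f (xs @ v # ys))"
    by (rule lin_map_cong[of V _ "\<lambda>v. g (xs @ v # ys)"])
      (use * assms in \<open>auto intro!: assms(1) append_in_listset mlin_slot\<close>)
qed (use assms(1,3) in \<open>simp add: mlin_mem\<close>)

lemma mlin_sum_list:
  assumes "vspace t W" "\<And>i. i \<in> set is \<Longrightarrow> mlin s t Vs W (f i)"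
  shows "mlin s t Vs W (\<lambda>xs. \<Sum>i\<leftarrow>is. f i xs)"
  using assms(2) unfolding mlin_iff
  by (auto intro!: lin_map_sum_list_fun[OF assms(1)] vspace_sum_list[OF assms(1)])

lemma mlin_scale:
  assumes "vspace t W" "mlin s t Vs W f"
  shows "mlin s t Vs W (\<lambda>xs. t c (f xs))"
  by (rule mlin_comp[OF assms(2)], rule lin_mapI)
    (auto simp: scale_add[OF assms(1)] scale_scale[OF assms(1)] vspace_scale[OF assms(1)] mult.commute)

section \<open>Tensor spaces and the linear maps induced on them\<close>

lemma mlin_pure:
  assumes "vector_space s" shows "mlin s tscale Vs (tensor s Vs) (pure s)"
  unfolding mlin_iff
proof (intro conjI ballI allI impI)
  have *: "pure s xs \<in> tensor s Vs" if "xs \<in> listset Vs" for xs and Vs :: "'b set list"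
    unfolding tensor_def using that
    by (intro module.span_base) (simp_all add: vector_space_fun_scale[OF vector_space_mult] module_iff_vector_space)
  show "\<And>xs. xs \<in> listset Vs \<Longrightarrow> pure s xs \<in> tensor s Vs" by (rule *)
  fix Us V Ws xs ys assume **: "Vs = Us @ V # Ws" "xs \<in> listset Us" "ys \<in> listset Ws"
  show "lin_map s tscale V (tensor s Vs) (\<lambda>v. pure s (xs @ v # ys))"
  proof (rule lin_mapI)
    fix x assume "x \<in> V"
    with ** show "pure s (xs @ x # ys) \<in> tensor s Vs" by (intro *) (simp add: append_in_listset)
  qed (auto simp: pure_def fun_eq_iff fun_scale_def multilinear_def Vector_Spaces.linear_iff)
qed

lemmas pure_in_tensor = mlin_mem[OF mlin_pure]

lemma mlin_lin_map_pure:
  "vector_space s \<Longrightarrow> lin_map tscale t (tensor s Vs) W g \<Longrightarrow> mlin s t Vs W (\<lambda>xs. g (pure s xs))"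
  by (rule mlin_comp[OF mlin_pure])

text \<open>The scalar is part of the induction step, so no separate case for scaling arises;
  membership of \<open>u\<close> is passed along because the maps considered are linear on
  \<open>tensor s Vs\<close> only.\<close>

lemma tensor_induct [consumes 1, case_names zero step]:
  fixes s :: "'k::field \<Rightarrow> 'v::ab_group_add \<Rightarrow> 'v"
  assumes u: "u \<in> tensor s Vs" and zero: "P 0"
    and step: "\<And>c xs u. xs \<in> listset Vs \<Longrightarrow> u \<in> tensor s Vs \<Longrightarrow> P u \<Longrightarrow> P (tscale c (pure s xs) + u)"
  shows "P u"
proof -
  interpret vector_space "tscale :: 'k \<Rightarrow> ('k, 'v) tens \<Rightarrow> ('k, 'v) tens"
    by (rule vector_space_fun_scale[OF vector_space_mult])
  have "u \<in> tensor s Vs \<and> P u"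
    using u unfolding tensor_def
  proof (induction rule: span_induct_alt)
    case base
    show ?case using zero span_zero by (rule conjI[rotated])
  next
    case (step c x y)
    then show "tscale c x + y \<in> span (pure s ` listset Vs) \<and> P (tscale c x + y)"
      using assms(3)[of _ y c] span_add[OF span_scale[OF span_base[OF step(1)]], of y c]
      by (auto simp: tensor_def)
  qed
  then show ?thesis ..
qed

lemma lin_map_tensor_eq:
  assumes s: "vector_space s" and f: "lin_map tscale t (tensor s Vs) W f" and g: "lin_map tscale t (tensor s Vs) X g"
    and eq: "\<And>xs. xs \<in> listset Vs \<Longrightarrow> f (pure s xs) = g (pure s xs)" and u: "u \<in> tensor s Vs"
  shows "f u = g u"
  using u
proof (induction rule: tensor_induct)
  case zero
  then show ?case by (simp only: lin_map_zero[OF vspace_tensor f] lin_map_zero[OF vspace_tensor g])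
next
  case (step c xs u)
  note m = pure_in_tensor[OF s step(1)]
  with step eq show "f (tscale c (pure s xs) + u) = g (tscale c (pure s xs) + u)"
    by (simp add: lin_map_add[OF f] lin_map_add[OF g] lin_map_scale[OF f] lin_map_scale[OF g]
        vspace_scale[OF vspace_tensor])
qed

text \<open>\<open>tensor_universal\<close> resolves the description in \<open>lift\<close>, but
  only for maps into the whole type. That the values stay in \<open>W\<close> is proved by induction
  over sums of pure tensors.\<close>

lemma
  assumes Vs: "\<And>V. V \<in> set Vs \<Longrightarrow> vspace s V" and s: "vector_space s" and W: "vspace t W"
    and f: "mlin s t Vs W f"
  shows lift_Hom: "lift s t Vs f \<in> Hom tscale t (tensor s Vs) W"
    and lift_pure: "xs \<in> listset Vs \<Longrightarrow> lift s t Vs f (pure s xs) = f xs"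
proof -
  have "\<exists>!F. F \<in> Hom tscale t (tensor s Vs) UNIV \<and> (\<forall>xs\<in>listset Vs. F (pure s xs) = f xs)"
    by (rule tensor_universal) (use assms in \<open>auto simp: vspace_def mlin_def\<close>)
  from theI'[OF this] have *: "lift s t Vs f \<in> Hom tscale t (tensor s Vs) UNIV"
    "\<And>xs. xs \<in> listset Vs \<Longrightarrow> lift s t Vs f (pure s xs) = f xs" by (auto simp: lift_def)
  then show "xs \<in> listset Vs \<Longrightarrow> lift s t Vs f (pure s xs) = f xs" by simp
  note L = Hom_lin_map[OF *(1)]
  have "lift s t Vs f u \<in> W" if "u \<in> tensor s Vs" for u
    using that
  proof (induction rule: tensor_induct)
    case zero
    then show ?case using vspace_zero[OF W] by (simp only: lin_map_zero[OF vspace_tensor L])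
  next
    case (step c xs u)
    note m = pure_in_tensor[OF s step(1)]
    with step *(2) mlin_mem[OF f] show "lift s t Vs f (tscale c (pure s xs) + u) \<in> W"
      by (simp add: lin_map_add[OF L] lin_map_scale[OF L]
        vspace_scale[OF vspace_tensor] vspace_add[OF W] vspace_scale[OF W])
  qed
  with * show "lift s t Vs f \<in> Hom tscale t (tensor s Vs) W" by (auto simp: Hom_def lin_map_def)
qed

definition bilin ::
  "('k::field \<Rightarrow> 'v::ab_group_add \<Rightarrow> 'v) \<Rightarrow> ('k \<Rightarrow> 'w::ab_group_add \<Rightarrow> 'w)
    \<Rightarrow> 'v set \<Rightarrow> 'v set \<Rightarrow> 'w set \<Rightarrow> ('v \<Rightarrow> 'v \<Rightarrow> 'w) \<Rightarrow> bool" where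
  "bilin s t U V W f \<longleftrightarrow>
     (\<forall>y\<in>V. lin_map s t U W (\<lambda>x. f x y)) \<and> (\<forall>x\<in>U. lin_map s t V W (f x))"

lemma bilin_mlin: "bilin s t U V W f \<longleftrightarrow> mlin s t [U, V] W (\<lambda>xs. f (xs ! 0) (xs ! 1))"
  by (auto simp: bilin_def mlin_Cons ball_listset_Cons lin_map_mem)

lemma bilin_comp: "bilin s t U V W f \<Longrightarrow> lin_map t u W X h \<Longrightarrow> bilin s u U V X (\<lambda>x y. h (f x y))"
  unfolding bilin_mlin by (rule mlin_comp)

lemma bilin_pure:
  assumes "vector_space s" shows "bilin s tscale U V (tensor s [U, V]) (\<lambda>x y. pure s [x, y])"
  unfolding bilin_def using mlin_pure[OF assms, of "[U, V]"]
  by (auto simp: mlin_Cons listset_Cons)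

lemma pure2_in_tensor: "vector_space s \<Longrightarrow> x \<in> U \<Longrightarrow> y \<in> V \<Longrightarrow> pure s [x, y] \<in> tensor s [U, V]"
  by (rule pure_in_tensor) simp_all

context
  fixes s :: "'k::field \<Rightarrow> 'v::ab_group_add \<Rightarrow> 'v" and t :: "'k \<Rightarrow> 'w::ab_group_add \<Rightarrow> 'w"
    and U V :: "'v set" and W :: "'w set" and f
  assumes U: "vspace s U" and V: "vspace s V" and W: "vspace t W" and f: "bilin s t U V W f"
begin

lemma lift2_Hom: "lift2 s t U V f \<in> Hom tscale t (tensor s [U, V]) W"
  unfolding lift2_def
  by (rule lift_Hom) (use U V W f in \<open>auto simp: bilin_mlin vspace_vector_space\<close>)

lemma lift2_pure: "x \<in> U \<Longrightarrow> y \<in> V \<Longrightarrow> lift2 s t U V f (pure s [x, y]) = f x y"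
  unfolding lift2_def using lift_pure[of "[U, V]" s t W "\<lambda>xs. f (xs ! 0) (xs ! 1)" "[x, y]"]
  U V W f by (auto simp: bilin_mlin vspace_vector_space)

text \<open>With \<open>I\<close>, \<open>g\<close> and \<open>k\<close> as parameters, the
  components may be taken as they are, swapped (for commutativity), or wrapped in
  \<open>pure s\<close> (for tensor products of coalgebras).\<close>

lemma lift2_sum_list_pure:
  assumes "set ps \<subseteq> I" "\<And>p. p \<in> I \<Longrightarrow> g p \<in> U" "\<And>p. p \<in> I \<Longrightarrow> k p \<in> V"
  shows "lift2 s t U V f (\<Sum>p\<leftarrow>ps. pure s [g p, k p]) = (\<Sum>p\<leftarrow>ps. f (g p) (k p))"
proof -
  have "lift2 s t U V f (\<Sum>p\<leftarrow>ps. pure s [g p, k p]) = (\<Sum>p\<leftarrow>ps. lift2 s t U V f (pure s [g p, k p]))"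
    by (rule lin_map_sum_list[OF vspace_tensor Hom_lin_map[OF lift2_Hom]])
      (use assms U in \<open>auto intro!: pure2_in_tensor vspace_vector_space\<close>)
  also have "\<dots> = (\<Sum>p\<leftarrow>ps. f (g p) (k p))"
    using assms by (intro arg_cong[of _ _ sum_list] map_cong refl lift2_pure) auto
  finally show ?thesis .
qed

end

text \<open>A choice of Sweedler components; \<open>sw\<close> stands for Sweedler.\<close>

definition sw ::
  "('k::field \<Rightarrow> 'v::ab_group_add \<Rightarrow> 'v) \<Rightarrow> 'v set \<Rightarrow> 'v set \<Rightarrow> ('k, 'v) tens \<Rightarrow> ('v \<times> 'v) list" where
  "sw s U V u = (SOME ps. set ps \<subseteq> U \<times> V \<and> u = (\<Sum>p\<leftarrow>ps. pure s [fst p, snd p]))"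

text \<open>The scalar of each summand is absorbed into its first factor, which stays in
  \<open>U\<close>; hence a list of pairs without coefficients suffices.\<close>

lemma
  assumes U: "vspace s U" and u: "u \<in> tensor s [U, V]"
  shows sw_subset: "set (sw s U V u) \<subseteq> U \<times> V"
    and sum_sw: "(\<Sum>p\<leftarrow>sw s U V u. pure s [fst p, snd p]) = u"
proof -
  have "\<exists>ps. set ps \<subseteq> U \<times> V \<and> u = (\<Sum>p\<leftarrow>ps. pure s [fst p, snd p])"
    using u
  proof (induction rule: tensor_induct)
    case zero
    then show ?case by (intro exI[of _ "[]"]) simp
  next
    case (step c xs u)
    then obtain ps where ps: "set ps \<subseteq> U \<times> V" "u = (\<Sum>p\<leftarrow>ps. pure s [fst p, snd p])" by auto
    from step(1) obtain x y where xs: "xs = [x, y]" "x \<in> U" "y \<in> V" by (auto simp: listset_Cons)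
    have "lin_map s tscale U (tensor s [U, V]) (\<lambda>x. pure s [x, y])"
      using bilin_pure[OF vspace_vector_space[OF U]] xs by (auto simp: bilin_def)
    from lin_map_scale[OF this xs(2)] have "tscale c (pure s [x, y]) = pure s [s c x, y]" by simp
    then show ?case using ps xs vspace_scale[OF U xs(2), of c]
      by (intro exI[of _ "(s c x, y) # ps"]) simp
  qed
  from someI_ex[OF this] show "set (sw s U V u) \<subseteq> U \<times> V"
    "(\<Sum>p\<leftarrow>sw s U V u. pure s [fst p, snd p]) = u" unfolding sw_def by auto
qed

text \<open>The components on the right do not depend on \<open>f\<close>. Linearity of a lift in
  any further parameter of \<open>f\<close> is therefore that of a fixed finite sum.\<close>

lemma lift2_sw:
  assumes "vspace s U" "vspace s V" "vspace t W" "bilin s t U V W f" "u \<in> tensor s [U, V]"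
  shows "lift2 s t U V f u = (\<Sum>p\<leftarrow>sw s U V u. f (fst p) (snd p))"
proof -
  have "lift2 s t U V f (\<Sum>p\<leftarrow>sw s U V u. pure s [fst p, snd p]) = (\<Sum>p\<leftarrow>sw s U V u. f (fst p) (snd p))"
    by (rule lift2_sum_list_pure[OF assms(1-4) sw_subset[OF assms(1,5)]]) auto
  then show ?thesis by (simp add: sum_sw[OF assms(1,5)])
qed

lemma lin_map_prod:
  "lin_map s t U V f \<Longrightarrow> lin_map s t U W g \<Longrightarrow> lin_map s (prod_scale t) U (V \<times> W) (\<lambda>x. (f x, g x))"
  by (auto simp: lin_map_def prod_scale_def)

text \<open>\<open>split_tensor\<close>, \<open>split_with\<close> and \<open>apply_lolli\<close>
  are defined as inverses of the isomorphisms of the interpretation; their linearity comes from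
  here.\<close>

lemma lin_iso_inv_into:
  assumes "lin_iso s t V W f" "vspace s V"
  shows "lin_map t s W V (inv_into V f)"
proof -
  have f: "lin_map s t V W f" and b: "inj_on f V" "f ` V = W"
    using assms(1) by (auto simp: lin_iso_def bij_betw_def)
  show ?thesis
  proof (rule lin_mapI)
    fix x assume "x \<in> W"
    then obtain x' where "x = f x'" "x' \<in> V" using b by auto
    then show "inv_into V f x \<in> V" "inv_into V f (t c x) = s c (inv_into V f x)" for c
      using b inv_into_f_eq[OF b(1), of "s c x'"] vspace_scale[OF assms(2)] lin_map_scale[OF f]
      by (auto simp: inv_into_f_f)
    fix y assume "y \<in> W"
    then obtain y' where "y = f y'" "y' \<in> V" using b by auto
    with \<open>x = f x'\<close> \<open>x' \<in> V\<close> show "inv_into V f (x + y) = inv_into V f x + inv_into V f y"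
      using b inv_into_f_eq[OF b(1), of "x' + y'"] vspace_add[OF assms(2)] lin_map_add[OF f]
      by (auto simp: inv_into_f_f)
  qed
qed

section \<open>Tensor products of coalgebras\<close>

lemma sum_list_swap:
  "(\<Sum>x\<leftarrow>xs. \<Sum>y\<leftarrow>ys. f x y) = (\<Sum>y\<leftarrow>ys. \<Sum>x\<leftarrow>xs. f x y :: 'a::comm_monoid_add)"
  by (induction xs) (simp_all add: sum_list_addf)

lemma sum_list_map_concat: "(\<Sum>x\<leftarrow>concat (map F xs). h x) = (\<Sum>x\<leftarrow>xs. \<Sum>y\<leftarrow>F x. h y)"
  by (induction xs) simp_all

lemma sum_list_cong: "(\<And>x. x \<in> set xs \<Longrightarrow> f x = g x) \<Longrightarrow> (\<Sum>x\<leftarrow>xs. f x) = (\<Sum>x\<leftarrow>xs. g x)"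
  by (simp cong: map_cong)

lemma lin_map_sum_list2:
  assumes V: "vspace s V" and f: "lin_map s t V W f"
    and "\<And>p q. p \<in> set ps \<Longrightarrow> q \<in> set (F p) \<Longrightarrow> h p q \<in> V"
    and "\<And>p q. p \<in> set ps \<Longrightarrow> q \<in> set (F p) \<Longrightarrow> f (h p q) = g p q"
  shows "f (\<Sum>p\<leftarrow>ps. \<Sum>q\<leftarrow>F p. h p q) = (\<Sum>p\<leftarrow>ps. \<Sum>q\<leftarrow>F p. g p q)"
proof -
  have "f (\<Sum>p\<leftarrow>ps. \<Sum>q\<leftarrow>F p. h p q) = (\<Sum>p\<leftarrow>ps. f (\<Sum>q\<leftarrow>F p. h p q))"
    by (rule lin_map_sum_list[OF V f], rule vspace_sum_list[OF V], rule assms(3))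
  also have "\<dots> = (\<Sum>p\<leftarrow>ps. \<Sum>q\<leftarrow>F p. g p q)"
    by (rule sum_list_cong) (simp add: lin_map_sum_list[OF V f] assms(3,4) cong: map_cong)
  finally show ?thesis .
qed

section \<open>One coalgebra: its axioms in Sweedler components\<close>

lemma
  assumes "cocomm_coalgebra s C \<Delta> \<epsilon>"
  shows coalgebra_vspace: "vspace s C"
    and comult_lin_map: "lin_map s tscale C (tensor s [C, C]) \<Delta>"
    and counit_lin_map: "lin_map s (*) C UNIV \<epsilon>"
  using assms by (auto simp: cocomm_coalgebra_def vspace_def)

lemma bilin_cong:
  assumes "vspace s U" "vspace s V" "\<And>x y. x \<in> U \<Longrightarrow> y \<in> V \<Longrightarrow> f x y = g x y" "bilin s t U V W g"
  shows "bilin s t U V W f"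
  unfolding bilin_def
proof (intro conjI ballI)
  fix y assume "y \<in> V"
  with assms show "lin_map s t U W (\<lambda>x. f x y)"
    by (intro lin_map_cong[of U "\<lambda>x. f x y" "\<lambda>x. g x y"]) (auto simp: bilin_def)
next
  fix x assume "x \<in> U"
  with assms show "lin_map s t V W (f x)"
    by (intro lin_map_cong[of V "f x" "g x"]) (auto simp: bilin_def)
qed

lemma bilin_sum_list:
  assumes "vspace t W" "\<And>i. i \<in> set is \<Longrightarrow> bilin s t U V W (f i)"
  shows "bilin s t U V W (\<lambda>x y. \<Sum>i\<leftarrow>is. f i x y)"
  using assms(2) unfolding bilin_def by (auto intro!: lin_map_sum_list_fun[OF assms(1)])

text \<open>The two bilinear families cover all three slots and match the two iterated coproducts:
  one expands the left factor with the third argument fixed, the other the right factor with the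
  first argument fixed.\<close>

definition trilin ::
  "('k::field \<Rightarrow> 'v::ab_group_add \<Rightarrow> 'v) \<Rightarrow> ('k \<Rightarrow> 'w::ab_group_add \<Rightarrow> 'w)
    \<Rightarrow> 'v set \<Rightarrow> 'w set \<Rightarrow> ('v \<Rightarrow> 'v \<Rightarrow> 'v \<Rightarrow> 'w) \<Rightarrow> bool" where
  "trilin s t C W f \<longleftrightarrow>
     (\<forall>z\<in>C. bilin s t C C W (\<lambda>x y. f x y z)) \<and> (\<forall>x\<in>C. bilin s t C C W (f x))"

lemma trilin_mlin:
  "vspace s C \<Longrightarrow> trilin s t C W f \<longleftrightarrow> mlin s t [C, C, C] W (\<lambda>xs. f (xs ! 0) (xs ! 1) (xs ! 2))"
  unfolding trilin_def bilin_def
  by (simp add: mlin_Cons ball_listset_Cons numeral_2_eq_2) (blast dest: lin_map_mem)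

lemma trilin_pure:
  assumes "vspace s C" shows "trilin s tscale C (tensor s [C, C, C]) (\<lambda>x y z. pure s [x, y, z])"
  using mlin_pure[OF vspace_vector_space[OF assms], of "[C, C, C]"]
  unfolding trilin_def bilin_def by (auto simp: mlin_Cons listset_Cons)

context
  fixes s :: "'k::field \<Rightarrow> 'v::ab_group_add \<Rightarrow> 'v" and t :: "'k \<Rightarrow> 'w::ab_group_add \<Rightarrow> 'w"
    and C :: "'v set" and \<Delta> and X :: "'w set" and G
  assumes C: "vspace s C" and \<Delta>: "lin_map s tscale C (tensor s [C, C]) \<Delta>" and X: "vspace t X"
    and G: "trilin s t C X G"
begin

text \<open>In \<open>x\<close> the map is a lift composed with the coproduct. In \<open>z\<close>
  the tensor \<open>\<Delta> x\<close> is constant, so its chosen components turn the lift into a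
  fixed finite sum of maps linear in \<open>z\<close>.\<close>

lemma bilin_expand_left: "bilin s t C C X (\<lambda>x z. lift2 s t C C (\<lambda>x1 x2. G x1 x2 z) (\<Delta> x))"
  unfolding bilin_def
proof (intro conjI ballI)
  fix z assume "z \<in> C"
  with G have "bilin s t C C X (\<lambda>x1 x2. G x1 x2 z)" by (simp add: trilin_def)
  from lin_map_comp[OF \<Delta> Hom_lin_map[OF lift2_Hom[OF C C X this]]]
  show "lin_map s t C X (\<lambda>x. lift2 s t C C (\<lambda>x1 x2. G x1 x2 z) (\<Delta> x))" .
next
  fix x assume x: "x \<in> C"
  note \<Delta>x = lin_map_mem[OF \<Delta> x]
  show "lin_map s t C X (\<lambda>z. lift2 s t C C (\<lambda>x1 x2. G x1 x2 z) (\<Delta> x))"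
  proof (rule lin_map_cong[OF _ C])
    fix z assume "z \<in> C"
    with G show "lift2 s t C C (\<lambda>x1 x2. G x1 x2 z) (\<Delta> x) = (\<Sum>p\<leftarrow>sw s C C (\<Delta> x). G (fst p) (snd p) z)"
      by (intro lift2_sw[OF C C X _ \<Delta>x]) (simp add: trilin_def)
  next
    show "lin_map s t C X (\<lambda>z. \<Sum>p\<leftarrow>sw s C C (\<Delta> x). G (fst p) (snd p) z)"
      by (rule lin_map_sum_list_fun[OF X])
        (use G sw_subset[OF C \<Delta>x] in \<open>auto simp: trilin_def bilin_def\<close>)
  qed
qed

lemma bilin_expand_right: "bilin s t C C X (\<lambda>x z. lift2 s t C C (\<lambda>z1 z2. G x z1 z2) (\<Delta> z))"
  unfolding bilin_def
proof (intro conjI ballI)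
  fix x assume "x \<in> C"
  with G have "bilin s t C C X (G x)" by (simp add: trilin_def)
  from lin_map_comp[OF \<Delta> Hom_lin_map[OF lift2_Hom[OF C C X this]]]
  show "lin_map s t C X (\<lambda>z. lift2 s t C C (G x) (\<Delta> z))" .
next
  fix z assume z: "z \<in> C"
  note \<Delta>z = lin_map_mem[OF \<Delta> z]
  show "lin_map s t C X (\<lambda>x. lift2 s t C C (G x) (\<Delta> z))"
  proof (rule lin_map_cong[OF _ C])
    fix x assume "x \<in> C"
    with G show "lift2 s t C C (G x) (\<Delta> z) = (\<Sum>p\<leftarrow>sw s C C (\<Delta> z). G x (fst p) (snd p))"
      by (intro lift2_sw[OF C C X _ \<Delta>z]) (simp add: trilin_def)
  next
    show "lin_map s t C X (\<lambda>x. \<Sum>p\<leftarrow>sw s C C (\<Delta> z). G x (fst p) (snd p))"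
      by (rule lin_map_sum_list_fun[OF X])
        (use G sw_subset[OF C \<Delta>z] in \<open>auto simp: trilin_def bilin_def\<close>)
  qed
qed

lemma lift2_expand_left:
  assumes c: "c \<in> C"
  shows "lift2 s t C C (\<lambda>x z. lift2 s t C C (\<lambda>x1 x2. G x1 x2 z) (\<Delta> x)) (\<Delta> c) =
    (\<Sum>p\<leftarrow>sw s C C (\<Delta> c). \<Sum>q\<leftarrow>sw s C C (\<Delta> (fst p)). G (fst q) (snd q) (snd p))"
proof -
  note \<Delta>c = lin_map_mem[OF \<Delta> c]
  show ?thesis unfolding lift2_sw[OF C C X bilin_expand_left \<Delta>c]
    by (rule sum_list_cong, rule lift2_sw[OF C C X])
      (use G sw_subset[OF C \<Delta>c] lin_map_mem[OF \<Delta>] in \<open>auto simp: trilin_def\<close>)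
qed

lemma lift2_expand_right:
  assumes c: "c \<in> C"
  shows "lift2 s t C C (\<lambda>x z. lift2 s t C C (\<lambda>z1 z2. G x z1 z2) (\<Delta> z)) (\<Delta> c) =
    (\<Sum>p\<leftarrow>sw s C C (\<Delta> c). \<Sum>q\<leftarrow>sw s C C (\<Delta> (snd p)). G (fst p) (fst q) (snd q))"
proof -
  note \<Delta>c = lin_map_mem[OF \<Delta> c]
  show ?thesis unfolding lift2_sw[OF C C X bilin_expand_right \<Delta>c]
    by (rule sum_list_cong, rule lift2_sw[OF C C X])
      (use G sw_subset[OF C \<Delta>c] lin_map_mem[OF \<Delta>] in \<open>auto simp: trilin_def\<close>)
qed

end

context
  fixes s :: "'k::field \<Rightarrow> 'v::ab_group_add \<Rightarrow> 'v" and t :: "'k \<Rightarrow> 'w::ab_group_add \<Rightarrow> 'w"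
    and C :: "'v set" and \<Delta> \<epsilon> and X :: "'w set"
  assumes coalg: "cocomm_coalgebra s C \<Delta> \<epsilon>" and X: "vspace t X"
begin

text \<open>The axiom of coassociativity speaks of pure tensors only. The trilinear \<open>G\<close>
  induces a linear map \<open>L\<close> on the triple tensor product, and applying \<open>L\<close>
  to both sides of the axiom gives the identity for \<open>G\<close>.\<close>

lemma sw_coassoc:
  assumes G: "trilin s t C X G" and c: "c \<in> C"
  shows "(\<Sum>p\<leftarrow>sw s C C (\<Delta> c). \<Sum>q\<leftarrow>sw s C C (\<Delta> (fst p)). G (fst q) (snd q) (snd p)) =
    (\<Sum>p\<leftarrow>sw s C C (\<Delta> c). \<Sum>q\<leftarrow>sw s C C (\<Delta> (snd p)). G (fst p) (fst q) (snd q))"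
proof -
  note C = coalgebra_vspace[OF coalg] and \<Delta> = comult_lin_map[OF coalg]
  note s = vspace_vector_space[OF C] and \<Delta>c = lin_map_mem[OF \<Delta> c]
  define L where "L = lift s t [C, C, C] (\<lambda>xs. G (xs ! 0) (xs ! 1) (xs ! 2))"
  have G': "mlin s t [C, C, C] X (\<lambda>xs. G (xs ! 0) (xs ! 1) (xs ! 2))"
    using G by (simp only: trilin_mlin[OF C])
  have L: "lin_map tscale t (tensor s [C, C, C]) X L"
    unfolding L_def by (rule Hom_lin_map, rule lift_Hom) (use s C X G' in auto)
  have Lp: "L (pure s [x, y, z]) = G x y z" if "x \<in> C" "y \<in> C" "z \<in> C" for x y z
    unfolding L_def
    using lift_pure[OF _ s X G', of "[x, y, z]"] that C by (auto simp: numeral_2_eq_2)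
  have mem: "pure s [x, y, z] \<in> tensor s [C, C, C]" if "x \<in> C" "y \<in> C" "z \<in> C" for x y z
    using that by (intro pure_in_tensor[OF s]) simp
  have sub: "fst p \<in> C" "snd p \<in> C" if "p \<in> set (sw s C C (\<Delta> x))" "x \<in> C" for p x
    using sw_subset[OF C lin_map_mem[OF \<Delta> that(2)]] that(1) by auto
  have "lift2 s tscale C C (\<lambda>x z. lift2 s tscale C C (\<lambda>x1 x2. pure s [x1, x2, z]) (\<Delta> x)) (\<Delta> c) =
        lift2 s tscale C C (\<lambda>x z. lift2 s tscale C C (\<lambda>z1 z2. pure s [x, z1, z2]) (\<Delta> z)) (\<Delta> c)"
    using coalg c by (simp add: cocomm_coalgebra_def)
  then have "(\<Sum>p\<leftarrow>sw s C C (\<Delta> c). \<Sum>q\<leftarrow>sw s C C (\<Delta> (fst p)). pure s [fst q, snd q, snd p]) =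
      (\<Sum>p\<leftarrow>sw s C C (\<Delta> c). \<Sum>q\<leftarrow>sw s C C (\<Delta> (snd p)). pure s [fst p, fst q, snd q])"
    unfolding lift2_expand_left[OF C \<Delta> vspace_tensor trilin_pure[OF C] c]
      lift2_expand_right[OF C \<Delta> vspace_tensor trilin_pure[OF C] c] .
  then have "L (\<Sum>p\<leftarrow>sw s C C (\<Delta> c). \<Sum>q\<leftarrow>sw s C C (\<Delta> (fst p)). pure s [fst q, snd q, snd p]) =
      L (\<Sum>p\<leftarrow>sw s C C (\<Delta> c). \<Sum>q\<leftarrow>sw s C C (\<Delta> (snd p)). pure s [fst p, fst q, snd q])"
    by (rule arg_cong)
  moreover have "L (\<Sum>p\<leftarrow>sw s C C (\<Delta> c). \<Sum>q\<leftarrow>sw s C C (\<Delta> (fst p)). pure s [fst q, snd q, snd p]) =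
      (\<Sum>p\<leftarrow>sw s C C (\<Delta> c). \<Sum>q\<leftarrow>sw s C C (\<Delta> (fst p)). G (fst q) (snd q) (snd p))"
    by (rule lin_map_sum_list2[OF vspace_tensor L]) (simp_all add: mem Lp sub[OF _ c] sub[OF _ sub(1)[OF _ c]])
  moreover have "L (\<Sum>p\<leftarrow>sw s C C (\<Delta> c). \<Sum>q\<leftarrow>sw s C C (\<Delta> (snd p)). pure s [fst p, fst q, snd q]) =
      (\<Sum>p\<leftarrow>sw s C C (\<Delta> c). \<Sum>q\<leftarrow>sw s C C (\<Delta> (snd p)). G (fst p) (fst q) (snd q))"
    by (rule lin_map_sum_list2[OF vspace_tensor L]) (simp_all add: mem Lp sub[OF _ c] sub[OF _ sub(2)[OF _ c]])
  ultimately show ?thesis by simp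
qed

text \<open>The linear \<open>f\<close> is applied to the expansion of \<open>c\<close> given by the
  counit law. Only this side of the law is recorded; the other side follows by commutativity where
  it is needed.\<close>

lemma sw_counit:
  assumes f: "lin_map s t C X f" and c: "c \<in> C"
  shows "(\<Sum>p\<leftarrow>sw s C C (\<Delta> c). t (\<epsilon> (fst p)) (f (snd p))) = f c"
proof -
  note C = coalgebra_vspace[OF coalg] and \<Delta> = comult_lin_map[OF coalg] and \<epsilon> = counit_lin_map[OF coalg]
  note \<Delta>c = lin_map_mem[OF \<Delta> c]
  have "bilin s s C C C (\<lambda>x y. s (\<epsilon> x) y)"
    unfolding bilin_def
    by (auto intro!: lin_mapI simp: vspace_scale[OF C] scale_add[OF C] scale_add_left[OF C]
        scale_scale[OF C] lin_map_add[OF \<epsilon>] lin_map_scale[OF \<epsilon>] mult.commute)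
  from lift2_sw[OF C C C this \<Delta>c] have "(\<Sum>p\<leftarrow>sw s C C (\<Delta> c). s (\<epsilon> (fst p)) (snd p)) = c"
    using coalg c by (simp add: cocomm_coalgebra_def)
  then have "f c = f (\<Sum>p\<leftarrow>sw s C C (\<Delta> c). s (\<epsilon> (fst p)) (snd p))" by simp
  also have "\<dots> = (\<Sum>p\<leftarrow>sw s C C (\<Delta> c). f (s (\<epsilon> (fst p)) (snd p)))"
    by (rule lin_map_sum_list[OF C f]) (use sw_subset[OF C \<Delta>c] in \<open>auto intro!: vspace_scale[OF C]\<close>)
  also have "\<dots> = (\<Sum>p\<leftarrow>sw s C C (\<Delta> c). t (\<epsilon> (fst p)) (f (snd p)))"
    by (rule sum_list_cong) (use sw_subset[OF C \<Delta>c] in \<open>auto simp: lin_map_scale[OF f]\<close>)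
  finally show ?thesis ..
qed

text \<open>By cocommutativity the swapped list of components represents the same tensor
  \<open>\<Delta> c\<close>, and the lift of \<open>f\<close> may be evaluated along either
  list.\<close>

lemma sw_commute:
  assumes f: "bilin s t C C X f" and c: "c \<in> C"
  shows "(\<Sum>p\<leftarrow>sw s C C (\<Delta> c). f (snd p) (fst p)) = (\<Sum>p\<leftarrow>sw s C C (\<Delta> c). f (fst p) (snd p))"
proof -
  note C = coalgebra_vspace[OF coalg] and \<Delta> = comult_lin_map[OF coalg]
  note s = vspace_vector_space[OF C] and \<Delta>c = lin_map_mem[OF \<Delta> c]
  have b: "bilin s tscale C C (tensor s [C, C]) (\<lambda>x y. pure s [y, x])"
    using bilin_pure[OF s, of C C] by (simp add: bilin_def)
  from lift2_sw[OF C C vspace_tensor b \<Delta>c]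
  have "(\<Sum>p\<leftarrow>sw s C C (\<Delta> c). pure s [snd p, fst p]) = \<Delta> c"
    using coalg c by (simp add: cocomm_coalgebra_def)
  then have "lift2 s t C C f (\<Delta> c) = lift2 s t C C f (\<Sum>p\<leftarrow>sw s C C (\<Delta> c). pure s [snd p, fst p])"
    by simp
  also have "\<dots> = (\<Sum>p\<leftarrow>sw s C C (\<Delta> c). f (snd p) (fst p))"
    by (rule lift2_sum_list_pure[OF C C X f sw_subset[OF C \<Delta>c]]) auto
  finally show ?thesis unfolding lift2_sw[OF C C X f \<Delta>c] ..
qed

end

text \<open>The componentwise Sweedler representation of the coproduct of \<open>pure s cs\<close>.\<close>

fun sws ::
  "('k::field \<Rightarrow> 'v::ab_group_add \<Rightarrow> 'v)
    \<Rightarrow> ('v set \<times> ('v \<Rightarrow> ('k, 'v) tens) \<times> ('v \<Rightarrow> 'k)) list \<Rightarrow> 'v list \<Rightarrow> ('v list \<times> 'v list) list"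
where
  "sws s ((C, \<Delta>, \<epsilon>) # Cs) (c # cs) =
     concat (map (\<lambda>p. map (\<lambda>q. (fst p # fst q, snd p # snd q)) (sws s Cs cs)) (sw s C C (\<Delta> c)))"
| "sws s _ _ = [([], [])]"

lemma sum_sws_Cons:
  "(\<Sum>r\<leftarrow>sws s ((C, \<Delta>, \<epsilon>) # Cs) (c # cs). h r) =
   (\<Sum>p\<leftarrow>sw s C C (\<Delta> c). \<Sum>q\<leftarrow>sws s Cs cs. h (fst p # fst q, snd p # snd q))"
  by (simp add: sum_list_map_concat o_def)

section \<open>Several coalgebras: the axioms for componentwise Sweedler lists\<close>

definition coalgebras ::
  "('k::field \<Rightarrow> 'v::ab_group_add \<Rightarrow> 'v)
    \<Rightarrow> ('v set \<times> ('v \<Rightarrow> ('k, 'v) tens) \<times> ('v \<Rightarrow> 'k)) list \<Rightarrow> bool" where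
  "coalgebras s Cs \<longleftrightarrow> (\<forall>(C, \<Delta>, \<epsilon>)\<in>set Cs. cocomm_coalgebra s C \<Delta> \<epsilon>)"

lemma coalgebras_Nil [simp]: "coalgebras s []"
  by (simp add: coalgebras_def)

lemma coalgebras_Cons [simp]:
  "coalgebras s ((C, \<Delta>, \<epsilon>) # Cs) \<longleftrightarrow> cocomm_coalgebra s C \<Delta> \<epsilon> \<and> coalgebras s Cs"
  by (auto simp: coalgebras_def)

lemma coalgebras_vspace: "coalgebras s Cs \<Longrightarrow> V \<in> set (map fst Cs) \<Longrightarrow> vspace s V"
  by (fastforce simp: coalgebras_def dest: coalgebra_vspace)

lemma sws_subset:
  "coalgebras s Cs \<Longrightarrow> cs \<in> listset (map fst Cs) \<Longrightarrow>
    set (sws s Cs cs) \<subseteq> listset (map fst Cs) \<times> listset (map fst Cs)"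
proof (induction s Cs cs rule: sws.induct)
  case (1 s C \<Delta> \<epsilon> Cs c cs)
  then have "set (sw s C C (\<Delta> c)) \<subseteq> C \<times> C"
    by (intro sw_subset) (auto dest: coalgebra_vspace comult_lin_map lin_map_mem)
  then show ?case using 1 by fastforce
qed (auto simp: listset_Cons)

definition bimlin ::
  "('k::field \<Rightarrow> 'v::ab_group_add \<Rightarrow> 'v) \<Rightarrow> ('k \<Rightarrow> 'w::ab_group_add \<Rightarrow> 'w)
    \<Rightarrow> 'v set list \<Rightarrow> 'w set \<Rightarrow> ('v list \<Rightarrow> 'v list \<Rightarrow> 'w) \<Rightarrow> bool" where
  "bimlin s t Vs W g \<longleftrightarrow>
     (\<forall>ys\<in>listset Vs. mlin s t Vs W (\<lambda>xs. g xs ys)) \<and> (\<forall>xs\<in>listset Vs. mlin s t Vs W (g xs))"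

lemma bimlin_Cons_tail:
  "bimlin s t (V # Vs) W g \<Longrightarrow> x \<in> V \<Longrightarrow> y \<in> V \<Longrightarrow> bimlin s t Vs W (\<lambda>xs ys. g (x # xs) (y # ys))"
  unfolding bimlin_def by (auto simp: mlin_Cons)

lemma bimlin_Cons_head:
  "bimlin s t (V # Vs) W g \<Longrightarrow> xs \<in> listset Vs \<Longrightarrow> ys \<in> listset Vs \<Longrightarrow>
    bilin s t V V W (\<lambda>x y. g (x # xs) (y # ys))"
  unfolding bimlin_def bilin_def by (auto simp: mlin_Cons)

lemma bilin_sws:
  assumes "coalgebras s Cs" "cs \<in> listset (map fst Cs)" "vspace t X" "bimlin s t (C # map fst Cs) X g"
  shows "bilin s t C C X (\<lambda>x y. \<Sum>q\<leftarrow>sws s Cs cs. g (x # fst q) (y # snd q))"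
  by (rule bilin_sum_list[OF assms(3)], rule bimlin_Cons_head[OF assms(4)])
    (use sws_subset[OF assms(1,2)] in auto)

text \<open>The outer lift can be evaluated only once its integrand is known to be bilinear. The
  induction hypothesis supplies this, since it rewrites the inner expansion as a finite sum of
  bilinear maps.\<close>

lemma co_expand_sws:
  assumes "coalgebras s Cs" "cs \<in> listset (map fst Cs)" "vspace t X" "bimlin s t (map fst Cs) X g"
  shows "co_expand s t Cs cs g = (\<Sum>q\<leftarrow>sws s Cs cs. g (fst q) (snd q))"
  using assms
proof (induction Cs arbitrary: cs g)
  case (Cons T Cs)
  obtain C \<Delta> \<epsilon> where T: "T = (C, \<Delta>, \<epsilon>)" by (cases T)
  from Cons.prems T obtain c cs' where cs: "cs = c # cs'" "c \<in> C" "cs' \<in> listset (map fst Cs)"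
    by (auto simp: listset_Cons)
  from Cons.prems T have Cs: "coalgebras s Cs" and co: "cocomm_coalgebra s C \<Delta> \<epsilon>" by auto
  from Cons.prems(4) T have g: "bimlin s t (C # map fst Cs) X g" by simp
  note C = coalgebra_vspace[OF co] and \<Delta>c = lin_map_mem[OF comult_lin_map[OF co] cs(2)]
  have IH: "co_expand s t Cs cs' (\<lambda>xs ys. g (x # xs) (y # ys)) =
      (\<Sum>q\<leftarrow>sws s Cs cs'. g (x # fst q) (y # snd q))" if "x \<in> C" "y \<in> C" for x y
    by (rule Cons.IH[OF Cs cs(3) assms(3) bimlin_Cons_tail[OF g that]])
  have "bilin s t C C X (\<lambda>x y. co_expand s t Cs cs' (\<lambda>xs ys. g (x # xs) (y # ys)))"
    by (rule bilin_cong[OF C C IH bilin_sws[OF Cs cs(3) assms(3) g]])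
  from lift2_sw[OF C C assms(3) this \<Delta>c] show ?case
    unfolding T cs(1) co_expand.simps sum_sws_Cons fst_conv snd_conv
    using IH sw_subset[OF C \<Delta>c] by (auto intro!: sum_list_cong)
qed simp

text \<open>This makes the lift in \<open>tensor_comult\<close> meaningful. In the head slot the map
  is a lift composed with a coproduct; in the tail slots it is a sum over the fixed components of
  the head.\<close>

lemma mlin_co_expand:
  assumes "coalgebras s Cs" "vspace t X" "bimlin s t (map fst Cs) X g"
  shows "mlin s t (map fst Cs) X (\<lambda>cs. co_expand s t Cs cs g)"
  using assms
proof (induction Cs arbitrary: g)
  case (Cons T Cs)
  obtain C \<Delta> \<epsilon> where T: "T = (C, \<Delta>, \<epsilon>)" by (cases T)
  from Cons.prems T have Cs: "coalgebras s Cs" and co: "cocomm_coalgebra s C \<Delta> \<epsilon>" by auto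
  from Cons.prems(3) T have g: "bimlin s t (C # map fst Cs) X g" by simp
  note C = coalgebra_vspace[OF co] and \<Delta> = comult_lin_map[OF co]
  have bil: "bilin s t C C X (\<lambda>x y. co_expand s t Cs cs (\<lambda>xs ys. g (x # xs) (y # ys)))"
    if cs: "cs \<in> listset (map fst Cs)" for cs
    by (rule bilin_cong[OF C C co_expand_sws[OF Cs cs assms(2) bimlin_Cons_tail[OF g]]
          bilin_sws[OF Cs cs assms(2) g]])
  show ?case unfolding T list.map fst_conv mlin_Cons
  proof (intro conjI ballI)
    fix cs assume "cs \<in> listset (map fst Cs)"
    from lin_map_comp[OF \<Delta> Hom_lin_map[OF lift2_Hom[OF C C assms(2) bil[OF this]]]]
    show "lin_map s t C X (\<lambda>c. co_expand s t ((C, \<Delta>, \<epsilon>) # Cs) (c # cs) g)" by simp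
  next
    fix c assume c: "c \<in> C"
    note \<Delta>c = lin_map_mem[OF \<Delta> c]
    have "mlin s t (map fst Cs) X (\<lambda>cs. \<Sum>p\<leftarrow>sw s C C (\<Delta> c).
        co_expand s t Cs cs (\<lambda>xs ys. g (fst p # xs) (snd p # ys)))"
      by (rule mlin_sum_list[OF assms(2)], rule Cons.IH[OF Cs assms(2)], rule bimlin_Cons_tail[OF g])
        (use sw_subset[OF C \<Delta>c] in auto)
    then show "mlin s t (map fst Cs) X (\<lambda>cs. co_expand s t ((C, \<Delta>, \<epsilon>) # Cs) (c # cs) g)"
      by (rule mlin_cong[rotated 2])
        (use lift2_sw[OF C C assms(2) bil \<Delta>c] coalgebras_vspace[OF Cs] in auto)
  qed
qed (simp add: bimlin_def)

definition trimlin ::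
  "('k::field \<Rightarrow> 'v::ab_group_add \<Rightarrow> 'v) \<Rightarrow> ('k \<Rightarrow> 'w::ab_group_add \<Rightarrow> 'w)
    \<Rightarrow> 'v set list \<Rightarrow> 'w set \<Rightarrow> ('v list \<Rightarrow> 'v list \<Rightarrow> 'v list \<Rightarrow> 'w) \<Rightarrow> bool" where
  "trimlin s t Vs W g \<longleftrightarrow>
     (\<forall>zs\<in>listset Vs. bimlin s t Vs W (\<lambda>xs ys. g xs ys zs)) \<and> (\<forall>xs\<in>listset Vs. bimlin s t Vs W (g xs))"

lemma trimlin_Cons_tail:
  "trimlin s t (V # Vs) W g \<Longrightarrow> x \<in> V \<Longrightarrow> y \<in> V \<Longrightarrow> z \<in> V \<Longrightarrow>
    trimlin s t Vs W (\<lambda>xs ys zs. g (x # xs) (y # ys) (z # zs))"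
  unfolding trimlin_def by (auto intro!: bimlin_Cons_tail[where g = "\<lambda>xs ys. g xs ys (z # _)"] bimlin_Cons_tail)

lemma trimlin_Cons_head:
  "trimlin s t (V # Vs) W g \<Longrightarrow> xs \<in> listset Vs \<Longrightarrow> ys \<in> listset Vs \<Longrightarrow> zs \<in> listset Vs \<Longrightarrow>
    trilin s t V W (\<lambda>x y z. g (x # xs) (y # ys) (z # zs))"
  unfolding trimlin_def trilin_def by (auto intro!: bimlin_Cons_head[where g = "\<lambda>xs ys. g xs ys (_ # zs)"] bimlin_Cons_head)

text \<open>Interchanging the sums separates the head coproduct from the coproducts of the tail. The
  tail is reassociated by induction with the head components fixed, then the head by coassociativity
  of \<open>C\<close>, and the sums are interchanged back.\<close>

lemma sws_coassoc:
  assumes "coalgebras s Cs" "cs \<in> listset (map fst Cs)" "vspace t X" "trimlin s t (map fst Cs) X g"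
  shows "(\<Sum>p\<leftarrow>sws s Cs cs. \<Sum>q\<leftarrow>sws s Cs (fst p). g (fst q) (snd q) (snd p)) =
    (\<Sum>p\<leftarrow>sws s Cs cs. \<Sum>q\<leftarrow>sws s Cs (snd p). g (fst p) (fst q) (snd q))"
  using assms
proof (induction Cs arbitrary: cs g)
  case (Cons T Cs)
  obtain C \<Delta> \<epsilon> where T: "T = (C, \<Delta>, \<epsilon>)" by (cases T)
  from Cons.prems T obtain c cs' where cs: "cs = c # cs'" "c \<in> C" "cs' \<in> listset (map fst Cs)"
    by (auto simp: listset_Cons)
  from Cons.prems T have Cs: "coalgebras s Cs" and co: "cocomm_coalgebra s C \<Delta> \<epsilon>" by auto
  from Cons.prems(4) T have g: "trimlin s t (C # map fst Cs) X g" by simp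
  note C = coalgebra_vspace[OF co] and \<Delta> = comult_lin_map[OF co]
  have sub: "fst p \<in> C" "snd p \<in> C" if "p \<in> set (sw s C C (\<Delta> x))" "x \<in> C" for p x
    using sw_subset[OF C lin_map_mem[OF \<Delta> that(2)]] that(1) by auto
  have subs: "fst q \<in> listset (map fst Cs)" "snd q \<in> listset (map fst Cs)"
    if "q \<in> set (sws s Cs xs)" "xs \<in> listset (map fst Cs)" for q xs
    using sws_subset[OF Cs that(2)] that(1) by auto
  let ?C = "\<lambda>x. sw s C C (\<Delta> x)" and ?Cs = "sws s Cs"
  have "(\<Sum>p\<leftarrow>?C c. \<Sum>ps\<leftarrow>?Cs cs'. \<Sum>q\<leftarrow>?C (fst p). \<Sum>qs\<leftarrow>?Cs (fst ps).
          g (fst q # fst qs) (snd q # snd qs) (snd p # snd ps)) =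
        (\<Sum>p\<leftarrow>?C c. \<Sum>q\<leftarrow>?C (fst p). \<Sum>ps\<leftarrow>?Cs cs'. \<Sum>qs\<leftarrow>?Cs (fst ps).
          g (fst q # fst qs) (snd q # snd qs) (snd p # snd ps))"
    by (intro sum_list_cong sum_list_swap)
  also have "\<dots> = (\<Sum>p\<leftarrow>?C c. \<Sum>q\<leftarrow>?C (fst p). \<Sum>ps\<leftarrow>?Cs cs'. \<Sum>qs\<leftarrow>?Cs (snd ps).
          g (fst q # fst ps) (snd q # fst qs) (snd p # snd qs))"
  proof (rule sum_list_cong, rule sum_list_cong)
    fix p q assume p: "p \<in> set (?C c)" and q: "q \<in> set (?C (fst p))"
    show "(\<Sum>ps\<leftarrow>?Cs cs'. \<Sum>qs\<leftarrow>?Cs (fst ps). g (fst q # fst qs) (snd q # snd qs) (snd p # snd ps)) =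
      (\<Sum>ps\<leftarrow>?Cs cs'. \<Sum>qs\<leftarrow>?Cs (snd ps). g (fst q # fst ps) (snd q # fst qs) (snd p # snd qs))"
      by (rule Cons.IH[OF Cs cs(3) assms(3) trimlin_Cons_tail[OF g]])
        (use p q cs sub in blast)+
  qed
  \<comment> \<open>The ranges of the tail sums no longer mention head components, so the double sum
    over the tail is a single trilinear function of the three head arguments.\<close>
  also have "\<dots> = (\<Sum>p\<leftarrow>?C c. \<Sum>q\<leftarrow>?C (snd p). \<Sum>ps\<leftarrow>?Cs cs'. \<Sum>qs\<leftarrow>?Cs (snd ps).
          g (fst p # fst ps) (fst q # fst qs) (snd q # snd qs))"
  proof -
    have "trilin s t C X (\<lambda>x y z. \<Sum>ps\<leftarrow>?Cs cs'. \<Sum>qs\<leftarrow>?Cs (snd ps).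
          g (x # fst ps) (y # fst qs) (z # snd qs))"
      unfolding trilin_mlin[OF C]
    proof (intro mlin_sum_list[OF assms(3)])
      fix ps qs assume "ps \<in> set (?Cs cs')" "qs \<in> set (?Cs (snd ps))"
      then have "trilin s t C X (\<lambda>x y z. g (x # fst ps) (y # fst qs) (z # snd qs))"
        by (intro trimlin_Cons_head[OF g]) (use subs cs(3) in blast)+
      then show "mlin s t [C, C, C] X (\<lambda>xs. g (xs ! 0 # fst ps) (xs ! 1 # fst qs) (xs ! 2 # snd qs))"
        unfolding trilin_mlin[OF C] .
    qed
    from sw_coassoc[OF co assms(3) this cs(2)] show ?thesis .
  qed
  also have "\<dots> = (\<Sum>p\<leftarrow>?C c. \<Sum>ps\<leftarrow>?Cs cs'. \<Sum>q\<leftarrow>?C (snd p). \<Sum>qs\<leftarrow>?Cs (snd ps).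
          g (fst p # fst ps) (fst q # fst qs) (snd q # snd qs))"
    by (intro sum_list_cong sum_list_swap)
  finally show ?case unfolding T cs(1) by (simp only: sum_sws_Cons fst_conv snd_conv)
qed simp

text \<open>For the tail, the counit of a head component is merely a scalar. It is absorbed into the
  multilinear function to which the induction hypothesis is applied, and the counit law of the head
  then removes it.\<close>

lemma sws_counit:
  assumes "coalgebras s Cs" "cs \<in> listset (map fst Cs)" "vspace t X" "mlin s t (map fst Cs) X g"
  shows "(\<Sum>q\<leftarrow>sws s Cs cs. t (\<Prod>i<length Cs. snd (snd (Cs ! i)) (fst q ! i)) (g (snd q))) = g cs"
  using assms
proof (induction Cs arbitrary: cs g)
  case Nil
  then show ?case by (simp add: scale_one[OF assms(3)])
next
  case (Cons T Cs)
  obtain C \<Delta> \<epsilon> where T: "T = (C, \<Delta>, \<epsilon>)" by (cases T)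
  from Cons.prems T obtain c cs' where cs: "cs = c # cs'" "c \<in> C" "cs' \<in> listset (map fst Cs)"
    by (auto simp: listset_Cons)
  from Cons.prems T have Cs: "coalgebras s Cs" and co: "cocomm_coalgebra s C \<Delta> \<epsilon>" by auto
  from Cons.prems(4) T have g: "mlin s t (C # map fst Cs) X g" by simp
  note C = coalgebra_vspace[OF co] and \<Delta> = comult_lin_map[OF co]
  note \<Delta>c = lin_map_mem[OF \<Delta> cs(2)]
  let ?e = "\<lambda>xs. \<Prod>i<length Cs. snd (snd (Cs ! i)) (xs ! i)"
  have "(\<Sum>p\<leftarrow>sw s C C (\<Delta> c). \<Sum>q\<leftarrow>sws s Cs cs'. t (\<epsilon> (fst p) * ?e (fst q)) (g (snd p # snd q))) =
      (\<Sum>p\<leftarrow>sw s C C (\<Delta> c). t (\<epsilon> (fst p)) (g (snd p # cs')))"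
  proof (rule sum_list_cong)
    fix p assume p: "p \<in> set (sw s C C (\<Delta> c))"
    then have "snd p \<in> C" using sw_subset[OF C \<Delta>c] by auto
    with g have gp: "mlin s t (map fst Cs) X (\<lambda>xs. t (\<epsilon> (fst p)) (g (snd p # xs)))"
      by (intro mlin_scale[OF assms(3)]) (simp add: mlin_Cons)
    show "(\<Sum>q\<leftarrow>sws s Cs cs'. t (\<epsilon> (fst p) * ?e (fst q)) (g (snd p # snd q))) = t (\<epsilon> (fst p)) (g (snd p # cs'))"
      using Cons.IH[OF Cs cs(3) assms(3) gp] by (simp add: scale_scale[OF assms(3)] mult.commute)
  qed
  also have "\<dots> = g (c # cs')"
    by (rule sw_counit[OF co assms(3) _ cs(2)]) (use g cs(3) in \<open>simp add: mlin_Cons\<close>)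
  finally show ?case
    unfolding T cs(1) sum_sws_Cons by (simp add: prod.lessThan_Suc_shift del: prod.lessThan_Suc)
qed

text \<open>Tail and head are exchanged one after the other: the induction hypothesis is applied to
  tails placed behind head components that are already swapped.\<close>

lemma sws_commute:
  assumes "coalgebras s Cs" "cs \<in> listset (map fst Cs)" "vspace t X" "bimlin s t (map fst Cs) X g"
  shows "(\<Sum>q\<leftarrow>sws s Cs cs. g (snd q) (fst q)) = (\<Sum>q\<leftarrow>sws s Cs cs. g (fst q) (snd q))"
  using assms
proof (induction Cs arbitrary: cs g)
  case (Cons T Cs)
  obtain C \<Delta> \<epsilon> where T: "T = (C, \<Delta>, \<epsilon>)" by (cases T)
  from Cons.prems T obtain c cs' where cs: "cs = c # cs'" "c \<in> C" "cs' \<in> listset (map fst Cs)"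
    by (auto simp: listset_Cons)
  from Cons.prems T have Cs: "coalgebras s Cs" and co: "cocomm_coalgebra s C \<Delta> \<epsilon>" by auto
  from Cons.prems(4) T have g: "bimlin s t (C # map fst Cs) X g" by simp
  note C = coalgebra_vspace[OF co] and \<Delta> = comult_lin_map[OF co]
  note \<Delta>c = lin_map_mem[OF \<Delta> cs(2)]
  have "(\<Sum>p\<leftarrow>sw s C C (\<Delta> c). \<Sum>q\<leftarrow>sws s Cs cs'. g (snd p # snd q) (fst p # fst q)) =
      (\<Sum>p\<leftarrow>sw s C C (\<Delta> c). \<Sum>q\<leftarrow>sws s Cs cs'. g (snd p # fst q) (fst p # snd q))"
  proof (rule sum_list_cong)
    fix p assume p: "p \<in> set (sw s C C (\<Delta> c))"
    show "(\<Sum>q\<leftarrow>sws s Cs cs'. g (snd p # snd q) (fst p # fst q)) =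
        (\<Sum>q\<leftarrow>sws s Cs cs'. g (snd p # fst q) (fst p # snd q))"
      by (rule Cons.IH[OF Cs cs(3) assms(3) bimlin_Cons_tail[OF g]])
        (use p sw_subset[OF C \<Delta>c] in auto)
  qed
  also have "\<dots> = (\<Sum>p\<leftarrow>sw s C C (\<Delta> c). \<Sum>q\<leftarrow>sws s Cs cs'. g (fst p # fst q) (snd p # snd q))"
    by (rule sw_commute[OF co assms(3) bilin_sws[OF Cs cs(3) assms(3) g] cs(2)])
  finally show ?case unfolding T cs(1) by (simp only: sum_sws_Cons fst_conv snd_conv)
qed simp

text \<open>The chosen components of \<open>pure s [c, c]\<close> need not be the single pair
  \<open>(c, c)\<close>. A bilinear function summed over them nevertheless takes its value at
  \<open>(c, c)\<close>, since the lift depends only on the tensor.\<close>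

lemma sws_grouplike:
  assumes "coalgebras s Cs" "cs \<in> listset (map fst Cs)" "vspace t X" "bimlin s t (map fst Cs) X g"
    and "\<And>i. i < length Cs \<Longrightarrow> fst (snd (Cs ! i)) (cs ! i) = pure s [cs ! i, cs ! i]"
  shows "(\<Sum>q\<leftarrow>sws s Cs cs. g (fst q) (snd q)) = g cs cs"
  using assms
proof (induction Cs arbitrary: cs g)
  case (Cons T Cs)
  obtain C \<Delta> \<epsilon> where T: "T = (C, \<Delta>, \<epsilon>)" by (cases T)
  from Cons.prems T obtain c cs' where cs: "cs = c # cs'" "c \<in> C" "cs' \<in> listset (map fst Cs)"
    by (auto simp: listset_Cons)
  from Cons.prems T have Cs: "coalgebras s Cs" and co: "cocomm_coalgebra s C \<Delta> \<epsilon>" by auto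
  from Cons.prems(4) T have g: "bimlin s t (C # map fst Cs) X g" by simp
  note C = coalgebra_vspace[OF co] and \<Delta> = comult_lin_map[OF co]
  have \<Delta>c: "\<Delta> c = pure s [c, c]" using Cons.prems(5)[of 0] T cs by simp
  have gl: "fst (snd (Cs ! i)) (cs' ! i) = pure s [cs' ! i, cs' ! i]" if "i < length Cs" for i
    using Cons.prems(5)[of "Suc i"] that T cs by simp
  note b = bilin_sws[OF Cs cs(3) assms(3) g]
  have "(\<Sum>p\<leftarrow>sw s C C (\<Delta> c). \<Sum>q\<leftarrow>sws s Cs cs'. g (fst p # fst q) (snd p # snd q)) =
      (\<Sum>q\<leftarrow>sws s Cs cs'. g (c # fst q) (c # snd q))"
    using lift2_sw[OF C C assms(3) b lin_map_mem[OF \<Delta> cs(2)]]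
      lift2_pure[OF C C assms(3) b cs(2) cs(2)] by (simp only: \<Delta>c)
  also have "\<dots> = g (c # cs') (c # cs')"
    by (rule Cons.IH[OF Cs cs(3) assms(3) bimlin_Cons_tail[OF g cs(2) cs(2)] gl])
  finally show ?case unfolding T cs(1) by (simp only: sum_sws_Cons fst_conv snd_conv)
qed simp

lemma mlin_counits:
  assumes "coalgebras s Cs"
  shows "mlin s (*) (map fst Cs) UNIV (\<lambda>cs. \<Prod>i<length Cs. snd (snd (Cs ! i)) (cs ! i))"
  using assms
proof (induction Cs)
  case (Cons T Cs)
  obtain C \<Delta> \<epsilon> where T: "T = (C, \<Delta>, \<epsilon>)" by (cases T)
  from Cons.prems T have Cs: "coalgebras s Cs" and co: "cocomm_coalgebra s C \<Delta> \<epsilon>" by auto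
  note \<epsilon> = counit_lin_map[OF co]
  show ?case unfolding T list.map fst_conv mlin_Cons
  proof (intro conjI ballI)
    fix cs assume "cs \<in> listset (map fst Cs)"
    show "lin_map s (*) C UNIV
      (\<lambda>c. \<Prod>i<length ((C, \<Delta>, \<epsilon>) # Cs). snd (snd (((C, \<Delta>, \<epsilon>) # Cs) ! i)) ((c # cs) ! i))"
      by (rule lin_mapI)
        (simp_all add: prod.lessThan_Suc_shift lin_map_add[OF \<epsilon>] lin_map_scale[OF \<epsilon>] distrib_right
          del: prod.lessThan_Suc)
  next
    fix c assume "c \<in> C"
    show "mlin s (*) (map fst Cs) UNIV
      (\<lambda>cs. \<Prod>i<length ((C, \<Delta>, \<epsilon>) # Cs). snd (snd (((C, \<Delta>, \<epsilon>) # Cs) ! i)) ((c # cs) ! i))"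
      using mlin_scale[OF vspace_field Cons.IH[OF Cs], of "\<epsilon> c"] by (simp add: prod.lessThan_Suc_shift del: prod.lessThan_Suc)
  qed
qed simp

section \<open>The coalgebra structure on a tensor product of coalgebras\<close>

context
  fixes s :: "'k::field \<Rightarrow> 'v::ab_group_add \<Rightarrow> 'v"
    and Cs :: "('v set \<times> ('v \<Rightarrow> ('k, 'v) tens) \<times> ('v \<Rightarrow> 'k)) list"
  assumes s: "vector_space s" and Cs: "coalgebras s Cs"
begin

private abbreviation "Vs \<equiv> map fst Cs"
private abbreviation "T \<equiv> tensor s Vs"

lemma bimlin_pure_bilin:
  assumes "bilin tscale t T T X f"
  shows "bimlin s t Vs X (\<lambda>xs ys. f (pure s xs) (pure s ys))"
  using assms mlin_comp[OF mlin_pure[OF s]] pure_in_tensor[OF s]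
  unfolding bimlin_def bilin_def by fastforce

lemma trimlin_pure: "trimlin s tscale Vs (tensor tscale [T, T, T])
    (\<lambda>xs ys zs. pure tscale [pure s xs, pure s ys, pure s zs])"
  using trilin_pure[OF vspace_tensor, of s Vs]
  unfolding trimlin_def trilin_def by (auto intro!: bimlin_pure_bilin pure_in_tensor[OF s])

lemma
  shows tensor_comult_lin_map: "lin_map tscale tscale T (tensor tscale [T, T]) (tensor_comult s Cs)"
    and tensor_comult_pure: "cs \<in> listset Vs \<Longrightarrow>
      tensor_comult s Cs (pure s cs) = (\<Sum>p\<leftarrow>sws s Cs cs. pure tscale [pure s (fst p), pure s (snd p)])"
proof -
  have b: "bimlin s tscale Vs (tensor tscale [T, T]) (\<lambda>xs ys. pure tscale [pure s xs, pure s ys])"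
    by (rule bimlin_pure_bilin[OF bilin_pure[OF vspace_vector_space[OF vspace_tensor]]])
  note m = mlin_co_expand[OF Cs vspace_tensor b]
  note V = coalgebras_vspace[OF Cs]
  show "lin_map tscale tscale T (tensor tscale [T, T]) (tensor_comult s Cs)"
    unfolding tensor_comult_def by (rule Hom_lin_map[OF lift_Hom[OF V s vspace_tensor m]])
  show "tensor_comult s Cs (pure s cs) = (\<Sum>p\<leftarrow>sws s Cs cs. pure tscale [pure s (fst p), pure s (snd p)])"
    if "cs \<in> listset Vs"
    unfolding tensor_comult_def using lift_pure[OF V s vspace_tensor m that]
    by (simp add: co_expand_sws[OF Cs that vspace_tensor b])
qed

lemma
  shows tensor_counit_lin_map: "lin_map tscale (*) T UNIV (tensor_counit s Cs)"
    and tensor_counit_pure: "cs \<in> listset Vs \<Longrightarrow>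
      tensor_counit s Cs (pure s cs) = (\<Prod>i<length Cs. snd (snd (Cs ! i)) (cs ! i))"
  unfolding tensor_counit_def
  using lift_Hom[OF coalgebras_vspace[OF Cs] s vspace_field mlin_counits[OF Cs]]
    lift_pure[OF coalgebras_vspace[OF Cs] s vspace_field mlin_counits[OF Cs]]
  by (auto dest: Hom_lin_map)

lemma lift2_tensor_comult:
  assumes X: "vspace t X" and f: "bilin tscale t T T X f" and cs: "cs \<in> listset Vs"
  shows "lift2 tscale t T T f (tensor_comult s Cs (pure s cs)) =
    (\<Sum>p\<leftarrow>sws s Cs cs. f (pure s (fst p)) (pure s (snd p)))"
  unfolding tensor_comult_pure[OF cs]
  by (rule lift2_sum_list_pure[OF vspace_tensor vspace_tensor X f sws_subset[OF Cs cs]])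
    (auto intro: pure_in_tensor[OF s])

lemma tensor_comult_grouplike:
  assumes cs: "cs \<in> listset Vs"
    and gl: "\<And>i. i < length Cs \<Longrightarrow> fst (snd (Cs ! i)) (cs ! i) = pure s [cs ! i, cs ! i]"
  shows "tensor_comult s Cs (pure s cs) = pure tscale [pure s cs, pure s cs]"
  unfolding tensor_comult_pure[OF cs]
  by (rule sws_grouplike[OF Cs cs vspace_tensor _ gl])
    (rule bimlin_pure_bilin[OF bilin_pure[OF vspace_vector_space[OF vspace_tensor]]])

lemma tensor_coalgebra:
  "cocomm_coalgebra tscale T (tensor_comult s Cs) (tensor_counit s Cs)"
proof -
  note vT = vspace_tensor[of s Vs]
  note tT = vspace_vector_space[OF vT]
  let ?D = "tensor_comult s Cs" and ?E = "tensor_counit s Cs"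
  note D = tensor_comult_lin_map and E = tensor_counit_lin_map
  note sub = sws_subset[OF Cs]
  \<comment> \<open>Each side of an axiom that is a lift along the coproduct is linear in
    \<open>c\<close>; this licenses the reduction to pure tensors.\<close>
  have lin: "lin_map tscale t T X (\<lambda>c. lift2 tscale t T T f (?D c))"
    if "vspace t X" "bilin tscale t T T X f"
    for t :: "'k \<Rightarrow> 'w::ab_group_add \<Rightarrow> 'w" and X f
    by (rule lin_map_comp[OF D Hom_lin_map[OF lift2_Hom[OF vT vT that]]])
  note triT = trilin_pure[OF vT]
  have bT: "bilin tscale tscale T T (tensor tscale [T, T, T]) (\<lambda>x y. pure tscale [x, y, z])"
    "bilin tscale tscale T T (tensor tscale [T, T, T]) (\<lambda>x y. pure tscale [z, x, y])" if "z \<in> T" for z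
    using triT that by (auto simp: trilin_def)
  have coassoc: "lift2 tscale tscale T T
        (\<lambda>x z. lift2 tscale tscale T T (\<lambda>x1 x2. pure tscale [x1, x2, z]) (?D x)) (?D c) =
      lift2 tscale tscale T T
        (\<lambda>x z. lift2 tscale tscale T T (\<lambda>z1 z2. pure tscale [x, z1, z2]) (?D z)) (?D c)"
    if "c \<in> T" for c
  proof (rule lin_map_tensor_eq[OF s lin[OF vspace_tensor bilin_expand_left[OF vT D vspace_tensor triT]]
        lin[OF vspace_tensor bilin_expand_right[OF vT D vspace_tensor triT]] _ that])
    fix cs assume cs: "cs \<in> listset Vs"
    have "lift2 tscale tscale T T
        (\<lambda>x z. lift2 tscale tscale T T (\<lambda>x1 x2. pure tscale [x1, x2, z]) (?D x)) (?D (pure s cs)) =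
      (\<Sum>p\<leftarrow>sws s Cs cs. \<Sum>q\<leftarrow>sws s Cs (fst p).
        pure tscale [pure s (fst q), pure s (snd q), pure s (snd p)])"
      unfolding lift2_tensor_comult[OF vspace_tensor bilin_expand_left[OF vT D vspace_tensor triT] cs]
      by (intro sum_list_cong lift2_tensor_comult[OF vspace_tensor bT(1)])
        (use sub[OF cs] pure_in_tensor[OF s] in auto)
    also have "\<dots> = (\<Sum>p\<leftarrow>sws s Cs cs. \<Sum>q\<leftarrow>sws s Cs (snd p).
        pure tscale [pure s (fst p), pure s (fst q), pure s (snd q)])"
      by (rule sws_coassoc[OF Cs cs vspace_tensor trimlin_pure])
    also have "\<dots> = lift2 tscale tscale T T
        (\<lambda>x z. lift2 tscale tscale T T (\<lambda>z1 z2. pure tscale [x, z1, z2]) (?D z)) (?D (pure s cs))"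
      unfolding lift2_tensor_comult[OF vspace_tensor bilin_expand_right[OF vT D vspace_tensor triT] cs]
      by (intro sum_list_cong lift2_tensor_comult[OF vspace_tensor bT(2), symmetric])
        (use sub[OF cs] pure_in_tensor[OF s] in auto)
    finally show "lift2 tscale tscale T T
        (\<lambda>x z. lift2 tscale tscale T T (\<lambda>x1 x2. pure tscale [x1, x2, z]) (?D x)) (?D (pure s cs)) =
      lift2 tscale tscale T T
        (\<lambda>x z. lift2 tscale tscale T T (\<lambda>z1 z2. pure tscale [x, z1, z2]) (?D z)) (?D (pure s cs))" .
  qed
  have b1: "bilin tscale tscale T T T (\<lambda>x y. tscale (?E x) y)"
    unfolding bilin_def
    by (auto intro!: lin_mapI simp: vspace_scale[OF vT] scale_add[OF vT] scale_add_left[OF vT]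
        scale_scale[OF vT] lin_map_add[OF E] lin_map_scale[OF E] mult.commute)
  then have b2: "bilin tscale tscale T T T (\<lambda>x y. tscale (?E y) x)" by (auto simp: bilin_def)
  have e: "(\<Sum>q\<leftarrow>sws s Cs cs. tscale (?E (pure s (fst q))) (pure s (snd q))) = pure s cs"
    if cs: "cs \<in> listset Vs" for cs
  proof -
    have "(\<Sum>q\<leftarrow>sws s Cs cs. tscale (?E (pure s (fst q))) (pure s (snd q))) =
      (\<Sum>q\<leftarrow>sws s Cs cs. tscale (\<Prod>i<length Cs. snd (snd (Cs ! i)) (fst q ! i)) (pure s (snd q)))"
      using sub[OF cs] by (intro sum_list_cong) (auto simp: tensor_counit_pure)
    also have "\<dots> = pure s cs" by (rule sws_counit[OF Cs cs vT mlin_pure[OF s]])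
    finally show ?thesis .
  qed
  have counit1: "lift2 tscale tscale T T (\<lambda>x y. tscale (?E x) y) (?D c) = c" if "c \<in> T" for c
    by (rule lin_map_tensor_eq[OF s lin[OF vT b1] lin_map_id _ that])
      (simp only: lift2_tensor_comult[OF vT b1] e)
  \<comment> \<open>Commutativity of the componentwise sums turns the right counit law into the left
    one.\<close>
  have counit2: "lift2 tscale tscale T T (\<lambda>x y. tscale (?E y) x) (?D c) = c" if "c \<in> T" for c
  proof (rule lin_map_tensor_eq[OF s lin[OF vT b2] lin_map_id _ that])
    fix cs assume cs: "cs \<in> listset Vs"
    show "lift2 tscale tscale T T (\<lambda>x y. tscale (?E y) x) (?D (pure s cs)) = pure s cs"
      unfolding lift2_tensor_comult[OF vT b2 cs]
      using sws_commute[OF Cs cs vT bimlin_pure_bilin[OF b1]] e[OF cs] by simp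
  qed
  note b3 = bilin_pure[OF tT, of T T]
  then have b4: "bilin tscale tscale T T (tensor tscale [T, T]) (\<lambda>x y. pure tscale [y, x])"
    by (auto simp: bilin_def)
  have comm: "lift2 tscale tscale T T (\<lambda>x y. pure tscale [y, x]) (?D c) = ?D c" if "c \<in> T" for c
  proof (rule lin_map_tensor_eq[OF s lin[OF vspace_tensor b4] D _ that])
    fix cs assume cs: "cs \<in> listset Vs"
    show "lift2 tscale tscale T T (\<lambda>x y. pure tscale [y, x]) (?D (pure s cs)) = ?D (pure s cs)"
      unfolding lift2_tensor_comult[OF vspace_tensor b4 cs]
      unfolding tensor_comult_pure[OF cs]
      by (rule sws_commute[OF Cs cs vspace_tensor bimlin_pure_bilin[OF b3]])
  qed
  show ?thesis
    unfolding cocomm_coalgebra_def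
    using vT tT D E coassoc counit1 counit2 comm by (simp add: vspace_def)
qed

end

section \<open>Multilinearity of the operations of the sequent calculus\<close>

lemma mlin_append_fixed:
  assumes "mlin s t (Us @ V # Ws) W f" "v \<in> V"
  shows "ys \<in> listset Ws \<Longrightarrow> mlin s t Us W (\<lambda>xs. f (xs @ v # ys))"
    and "xs \<in> listset Us \<Longrightarrow> mlin s t Ws W (\<lambda>ys. f (xs @ v # ys))"
  using assms by (auto simp: mlin_append mlin_Cons)

text \<open>Denotations are written with \<open>take\<close>, \<open>drop\<close> and indexing. The
  function \<open>g\<close> restates \<open>f\<close> in terms of the blocks themselves, where the
  variable block is visible and linearity is immediate.\<close>

lemma mlin_blocks2:
  assumes vs: "\<And>V. V \<in> set (Us @ Vs) \<Longrightarrow> vspace s V"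
    and eq: "\<And>xs ys. xs \<in> listset Us \<Longrightarrow> ys \<in> listset Vs \<Longrightarrow> f (xs @ ys) = g xs ys"
    and "\<And>ys. ys \<in> listset Vs \<Longrightarrow> mlin s t Us W (\<lambda>xs. g xs ys)"
    and "\<And>xs. xs \<in> listset Us \<Longrightarrow> mlin s t Vs W (\<lambda>ys. g xs ys)"
  shows "mlin s t (Us @ Vs) W f"
  unfolding mlin_append
proof (intro conjI ballI)
  fix ys assume "ys \<in> listset Vs"
  with assms show "mlin s t Us W (\<lambda>xs. f (xs @ ys))"
    by (intro mlin_cong[of Us "\<lambda>xs. f (xs @ ys)" "\<lambda>xs. g xs ys"]) auto
next
  fix xs assume "xs \<in> listset Us"
  with assms show "mlin s t Vs W (\<lambda>ys. f (xs @ ys))"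
    by (intro mlin_cong[of Vs "\<lambda>ys. f (xs @ ys)" "\<lambda>ys. g xs ys"]) auto
qed

lemma mlin_blocks3:
  assumes vs: "\<And>V. V \<in> set (Us @ Vs @ Ws) \<Longrightarrow> vspace s V"
    and eq: "\<And>xs ys zs. xs \<in> listset Us \<Longrightarrow> ys \<in> listset Vs \<Longrightarrow> zs \<in> listset Ws \<Longrightarrow>
      f (xs @ ys @ zs) = g xs ys zs"
    and 1: "\<And>ys zs. ys \<in> listset Vs \<Longrightarrow> zs \<in> listset Ws \<Longrightarrow> mlin s t Us W (\<lambda>xs. g xs ys zs)"
    and 2: "\<And>xs zs. xs \<in> listset Us \<Longrightarrow> zs \<in> listset Ws \<Longrightarrow> mlin s t Vs W (\<lambda>ys. g xs ys zs)"
    and 3: "\<And>xs ys. xs \<in> listset Us \<Longrightarrow> ys \<in> listset Vs \<Longrightarrow> mlin s t Ws W (\<lambda>zs. g xs ys zs)"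
  shows "mlin s t (Us @ Vs @ Ws) W f"
proof (rule mlin_blocks2[of Us "Vs @ Ws" s f "\<lambda>xs zs. f (xs @ zs)"])
  fix zs assume "zs \<in> listset (Vs @ Ws)"
  then obtain ys zs' where "zs = ys @ zs'" "ys \<in> listset Vs" "zs' \<in> listset Ws"
    by (auto simp: listset_append)
  with assms show "mlin s t Us W (\<lambda>xs. f (xs @ zs))"
    by (intro mlin_cong[of Us "\<lambda>xs. f (xs @ zs)" "\<lambda>xs. g xs ys zs'"]) auto
next
  fix xs assume "xs \<in> listset Us"
  with assms show "mlin s t (Vs @ Ws) W (\<lambda>zs. f (xs @ zs))"
    by (intro mlin_blocks2[of Vs Ws s "\<lambda>zs. f (xs @ zs)" "g xs"]) auto
qed (use vs in auto)

context
  fixes s :: "'k::field \<Rightarrow> 'v::ab_group_add \<Rightarrow> 'v" and t :: "'k \<Rightarrow> 'w::ab_group_add \<Rightarrow> 'w"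
    and Us Ws :: "'v set list" and V :: "'v set" and W :: "'w set" and f :: "'v list \<Rightarrow> 'w"
  assumes vs: "\<And>V. V \<in> set (Us @ Ws) \<Longrightarrow> vspace s V" and V: "vspace s V" and W: "vspace t W"
begin

text \<open>Covers the rules that replace one hypothesis by a linear image: the left rules for
  \<open>With\<close> and dereliction.\<close>

lemma mlin_update:
  assumes f: "mlin s t (Us @ U # Ws) W f" and h: "lin_map s s V U h" and n: "n = length Us"
  shows "mlin s t (Us @ V # Ws) W (\<lambda>xs. f (xs[n := h (xs ! n)]))"
proof -
  have "mlin s t (Us @ [V] @ Ws) W (\<lambda>xs. f (xs[n := h (xs ! n)]))"
  proof (rule mlin_blocks3[where g = "\<lambda>xs ys zs. f (xs @ h (ys ! 0) # zs)"])
    fix xs ys zs assume "xs \<in> listset Us" "ys \<in> listset [V]" "zs \<in> listset Ws"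
    then show "f ((xs @ ys @ zs)[n := h ((xs @ ys @ zs) ! n)]) = f (xs @ h (ys ! 0) # zs)"
      using n by (auto simp: listset_Cons length_listset nth_append list_update_append)
  next
    fix ys zs assume "ys \<in> listset [V]" "zs \<in> listset Ws"
    then show "mlin s t Us W (\<lambda>xs. f (xs @ h (ys ! 0) # zs))"
      by (intro mlin_append_fixed[OF f]) (auto simp: listset_Cons lin_map_mem[OF h])
  next
    fix xs ys assume "xs \<in> listset Us" "ys \<in> listset [V]"
    then show "mlin s t Ws W (\<lambda>zs. f (xs @ h (ys ! 0) # zs))"
      by (intro mlin_append_fixed[OF f]) (auto simp: listset_Cons lin_map_mem[OF h])
  next
    fix xs zs assume "xs \<in> listset Us" "zs \<in> listset Ws"
    from lin_map_comp[OF h mlin_slot[OF f this]]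
    show "mlin s t [V] W (\<lambda>ys. f (xs @ h (ys ! 0) # zs))" by (simp add: mlin_single)
  qed (use vs V in auto)
  then show ?thesis by simp
qed

lemma bilin_two_slots:
  assumes f: "mlin s t (Us @ X # Y # Ws) W f" and xs: "xs \<in> listset Us" and zs: "zs \<in> listset Ws"
  shows "bilin s t X Y W (\<lambda>x y. f (xs @ x # y # zs))"
  unfolding bilin_def
proof (intro conjI ballI)
  fix y assume "y \<in> Y"
  then show "lin_map s t X W (\<lambda>x. f (xs @ x # y # zs))"
    using mlin_slot[OF f xs, of "y # zs"] zs by simp
next
  fix x assume "x \<in> X"
  then show "lin_map s t Y W (\<lambda>y. f (xs @ x # y # zs))"
    using mlin_slot[of s t "Us @ [X]" Y Ws W f "xs @ [x]" zs] f xs zs by (simp add: append_in_listset)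
qed

text \<open>Covers the rules that split one hypothesis in two: the left tensor rule and contraction.
  In the slot of \<open>h\<close> the map is a composite of linear maps; in the other slots the
  components of \<open>h (ys ! 0)\<close> are fixed and the lift becomes a finite sum.\<close>

lemma mlin_lift2:
  assumes f: "mlin s t (Us @ X # Y # Ws) W f" and X: "vspace s X" and Y: "vspace s Y"
    and h: "lin_map s tscale V (tensor s [X, Y]) h" and n: "n = length Us"
  shows "mlin s t (Us @ V # Ws) W
    (\<lambda>xs. lift2 s t X Y (\<lambda>x y. f (take n xs @ x # y # drop (Suc n) xs)) (h (xs ! n)))"
proof -
  note bil = bilin_two_slots[OF f]
  have "mlin s t (Us @ [V] @ Ws) W
    (\<lambda>xs. lift2 s t X Y (\<lambda>x y. f (take n xs @ x # y # drop (Suc n) xs)) (h (xs ! n)))"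
  proof (rule mlin_blocks3[where g = "\<lambda>xs ys zs. lift2 s t X Y (\<lambda>x y. f (xs @ x # y # zs)) (h (ys ! 0))"])
    fix xs ys zs assume "xs \<in> listset Us" "ys \<in> listset [V]" "zs \<in> listset Ws"
    then show "lift2 s t X Y (\<lambda>x y. f (take n (xs @ ys @ zs) @ x # y # drop (Suc n) (xs @ ys @ zs)))
        (h ((xs @ ys @ zs) ! n)) = lift2 s t X Y (\<lambda>x y. f (xs @ x # y # zs)) (h (ys ! 0))"
      using n by (auto simp: listset_Cons length_listset nth_append list_update_append)
  next
    fix xs zs assume "xs \<in> listset Us" "zs \<in> listset Ws"
    from lin_map_comp[OF h Hom_lin_map[OF lift2_Hom[OF X Y W bil[OF this]]]]
    show "mlin s t [V] W (\<lambda>ys. lift2 s t X Y (\<lambda>x y. f (xs @ x # y # zs)) (h (ys ! 0)))"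
      by (simp add: mlin_single)
  next
    fix ys zs assume "ys \<in> listset [V]" and zs: "zs \<in> listset Ws"
    then have u: "h (ys ! 0) \<in> tensor s [X, Y]" by (auto simp: listset_Cons lin_map_mem[OF h])
    have "mlin s t Us W (\<lambda>xs. \<Sum>p\<leftarrow>sw s X Y (h (ys ! 0)). f (xs @ fst p # snd p # zs))"
      by (rule mlin_sum_list[OF W], rule mlin_append_fixed[OF f]) (use sw_subset[OF X u] zs in auto)
    then show "mlin s t Us W (\<lambda>xs. lift2 s t X Y (\<lambda>x y. f (xs @ x # y # zs)) (h (ys ! 0)))"
      by (rule mlin_cong[rotated 2]) (use lift2_sw[OF X Y W bil[OF _ zs] u] vs in auto)
  next
    fix xs ys assume "ys \<in> listset [V]" and xs: "xs \<in> listset Us"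
    then have u: "h (ys ! 0) \<in> tensor s [X, Y]" by (auto simp: listset_Cons lin_map_mem[OF h])
    have "mlin s t Ws W (\<lambda>zs. f (xs @ fst p # snd p # zs))" if "p \<in> set (sw s X Y (h (ys ! 0)))" for p
      using mlin_append_fixed(2)[of s t "Us @ [X]" Y Ws W f "snd p" "xs @ [fst p]"]
        sw_subset[OF X u] that xs f by (auto simp: append_in_listset)
    then have "mlin s t Ws W (\<lambda>zs. \<Sum>p\<leftarrow>sw s X Y (h (ys ! 0)). f (xs @ fst p # snd p # zs))"
      by (rule mlin_sum_list[OF W])
    then show "mlin s t Ws W (\<lambda>zs. lift2 s t X Y (\<lambda>x y. f (xs @ x # y # zs)) (h (ys ! 0)))"
      by (rule mlin_cong[rotated 2]) (use lift2_sw[OF X Y W bil[OF xs] u] vs in auto)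
  qed (use vs V in auto)
  then show ?thesis by simp
qed

text \<open>Covers the rules that feed the value of one proof into a hypothesis of another: cut and
  the left rule for \<open>Lolli\<close>.\<close>

lemma mlin_substitute:
  assumes f: "mlin s t (Us @ V # Ws) W f" and g: "mlin s s Xs V g"
    and Xs: "\<And>V. V \<in> set Xs \<Longrightarrow> vspace s V" and n: "n = length Us" and r: "r = length Xs"
  shows "mlin s t (Us @ Xs @ Ws) W (\<lambda>xs. f (take n xs @ g (take r (drop n xs)) # drop (n + r) xs))"
proof (rule mlin_blocks3[where g = "\<lambda>xs ys zs. f (xs @ g ys # zs)"])
  fix xs ys zs assume "xs \<in> listset Us" "ys \<in> listset Xs" "zs \<in> listset Ws"
  then show "f (take n (xs @ ys @ zs) @ g (take r (drop n (xs @ ys @ zs))) # drop (n + r) (xs @ ys @ zs)) =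
      f (xs @ g ys # zs)"
    using n r by (auto simp: length_listset)
next
  fix ys zs assume "ys \<in> listset Xs" "zs \<in> listset Ws"
  then show "mlin s t Us W (\<lambda>xs. f (xs @ g ys # zs))"
    by (intro mlin_append_fixed[OF f] mlin_mem[OF g])
next
  fix xs ys assume "xs \<in> listset Us" "ys \<in> listset Xs"
  then show "mlin s t Ws W (\<lambda>zs. f (xs @ g ys # zs))"
    by (intro mlin_append_fixed[OF f] mlin_mem[OF g])
next
  fix xs zs assume "xs \<in> listset Us" "zs \<in> listset Ws"
  from mlin_comp[OF g mlin_slot[OF f this]] show "mlin s t Xs W (\<lambda>ys. f (xs @ g ys # zs))" .
qed (use vs Xs in auto)

end

text \<open>Since \<open>js\<close> is a bijection of indices, each slot of \<open>Vs\<close> occurs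
  at exactly one place \<open>k\<close> of the permuted tuple, and the remaining entries do not see
  the varied vector.\<close>

lemma mlin_permute:
  assumes f: "mlin s t (map ((!) Vs) js) W f" and js: "distinct js" "set js = {..<length Vs}"
  shows "mlin s t Vs W (\<lambda>xs. f (map ((!) xs) js))"
proof -
  have mem: "map ((!) xs) ks \<in> listset (map ((!) Vs) ks)"
    if "xs \<in> listset Vs" "set ks \<subseteq> {..<length Vs}" for xs ks
    using that by (auto simp: in_listset_iff list_all2_conv_all_nth) (meson lessThan_iff nth_mem subsetD)
  show ?thesis unfolding mlin_iff
  proof (intro conjI ballI allI impI)
    show "f (map ((!) xs) js) \<in> W" if "xs \<in> listset Vs" for xs
      using that js by (intro mlin_mem[OF f] mem) auto
  next
    fix Us V Ws xs ys assume Vs: "Vs = Us @ V # Ws" and xs: "xs \<in> listset Us" and ys: "ys \<in> listset Ws"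
    let ?i = "length xs"
    have len: "length xs = length Us" using length_listset[OF xs] .
    then have "?i \<in> set js" using js Vs by simp
    then obtain k where k: "k < length js" "js ! k = ?i" by (auto simp: in_set_conv_nth)
    define ks ls where "ks = take k js" "ls = drop (Suc k) js"
    have js_eq: "js = ks @ ?i # ls" using k by (metis id_take_nth_drop ks_ls_def)
    have notin: "?i \<notin> set ks" "?i \<notin> set ls" using js(1) js_eq by auto
    show "lin_map s t V W (\<lambda>v. f (map ((!) (xs @ v # ys)) js))"
    \<comment> \<open>An element \<open>v0\<close> of \<open>V\<close> completes \<open>xs\<close>
      and \<open>ys\<close> to a full tuple, from which the fixed entries are read off. Over an
      empty \<open>V\<close> linearity holds vacuously.\<close>
    proof (cases "V = {}")
      case False
      then obtain v0 where v0: "v0 \<in> V" by auto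
      have indep: "map ((!) (xs @ v # ys)) is = map ((!) (xs @ v0 # ys)) is" if "?i \<notin> set is" for v "is"
        using that by (auto simp: nth_append nth_Cons')
      have eq: "map ((!) (xs @ v # ys)) js =
          map ((!) (xs @ v0 # ys)) ks @ v # map ((!) (xs @ v0 # ys)) ls" for v
        unfolding js_eq map_append list.map indep[OF notin(1), of v] indep[OF notin(2), of v] by simp
      have "xs @ v0 # ys \<in> listset Vs" using xs ys v0 Vs by (simp add: append_in_listset)
      moreover have "map ((!) Vs) js = map ((!) Vs) ks @ V # map ((!) Vs) ls"
        by (simp add: js_eq len Vs)
      ultimately show ?thesis unfolding eq using f js js_eq
        by (intro mlin_slot[of s t "map ((!) Vs) ks" V "map ((!) Vs) ls" W f] mem) auto
    qed (simp add: lin_map_def)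
  qed
qed

lemma mlin_prod:
  "mlin s t Vs U f \<Longrightarrow> mlin s t Vs W g \<Longrightarrow> mlin s (prod_scale t) Vs (U \<times> W) (\<lambda>xs. (f xs, g xs))"
  unfolding mlin_iff by (auto intro!: lin_map_prod)

text \<open>Extension by zero places the curried map in \<open>Hom\<close>, where equality is tested
  on the whole type. Linearity is thus checked pointwise, and outside \<open>V\<close> it amounts to
  scalar multiples of zero being zero.\<close>

lemma mlin_curry:
  assumes f: "mlin s t (Vs @ [V]) W f" and V: "vspace s V" and W: "vspace t W"
  shows "mlin s (fun_scale t) Vs (Hom s t V W) (\<lambda>xs v. if v \<in> V then f (xs @ [v]) else 0)"
proof -
  have H: "(\<lambda>v. if v \<in> V then f (xs @ [v]) else 0) \<in> Hom s t V W" if "xs \<in> listset Vs" for xs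
    using mlin_slot[OF f that, of "[]"] by (intro Hom_restrict[OF V]) simp
  show ?thesis unfolding mlin_iff
  proof (intro conjI ballI allI impI H)
    fix Us U Ws xs ys assume eq: "Vs = Us @ U # Ws" and xs: "xs \<in> listset Us" and ys: "ys \<in> listset Ws"
    have L: "lin_map s t U W (\<lambda>u. f (xs @ u # ys @ [v]))" if "v \<in> V" for v
      using mlin_slot[of s t Us U "Ws @ [V]" W f xs "ys @ [v]"] f xs ys that
      by (simp add: eq append_in_listset)
    show "lin_map s (fun_scale t) U (Hom s t V W) (\<lambda>u v. if v \<in> V then f ((xs @ u # ys) @ [v]) else 0)"
    proof (rule lin_mapI)
      fix u assume "u \<in> U"
      then show "(\<lambda>v. if v \<in> V then f ((xs @ u # ys) @ [v]) else 0) \<in> Hom s t V W"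
        using xs ys eq by (intro H) (simp add: append_in_listset)
    qed (auto simp: fun_eq_iff fun_scale_def scale_zero[OF W] dest: lin_map_add[OF L] lin_map_scale[OF L])
  qed
qed

section \<open>Evaluation of derivations\<close>

locale sweedler =
  fixes F :: "'a form set" and M :: "('a, 'k::field, 'v::ab_group_add) interp"
  assumes semantics: "sweedler_semantics F M"
begin

abbreviation "sm \<equiv> smul M"

lemma vector_space_smul: "vector_space sm"
  using semantics by (simp add: sweedler_semantics_def)

lemma sem_vspace: "X \<in> F \<Longrightarrow> vspace sm (sem M X)"
  using semantics by (simp add: sweedler_semantics_def vspace_def)

lemma vspace_sems: "set \<Gamma> \<subseteq> F \<Longrightarrow> V \<in> set (map (sem M) \<Gamma>) \<Longrightarrow> vspace sm V"
  by (auto intro: sem_vspace)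

lemma
  shows Tensor_F: "Tensor A B \<in> F \<Longrightarrow> A \<in> F \<and> B \<in> F"
    and With_F: "With A B \<in> F \<Longrightarrow> A \<in> F \<and> B \<in> F"
    and Lolli_F: "Lolli A B \<in> F \<Longrightarrow> A \<in> F \<and> B \<in> F"
    and Bang_F: "Bang A \<in> F \<Longrightarrow> A \<in> F"
    and tensor_iso: "Tensor A B \<in> F \<Longrightarrow>
      lin_iso tscale sm (tensor sm [sem M A, sem M B]) (sem M (Tensor A B)) (tensor_iso M A B)"
    and with_iso: "With A B \<in> F \<Longrightarrow>
      lin_iso (prod_scale sm) sm (sem M A \<times> sem M B) (sem M (With A B)) (with_iso M A B)"
    and lolli_iso: "Lolli A B \<in> F \<Longrightarrow>
      lin_iso (fun_scale sm) sm (Hom sm sm (sem M A) (sem M B)) (sem M (Lolli A B)) (lolli_iso M A B)"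
    and cofree: "Bang A \<in> F \<Longrightarrow>
      cofree sm (sem M A) (sem M (Bang A)) (comult M A) (counit M A) (univ_map M A)"
  using semantics by (force simp: sweedler_semantics_def)+

lemma vspace_prod: "A \<in> F \<Longrightarrow> B \<in> F \<Longrightarrow> vspace (prod_scale sm) (sem M A \<times> sem M B)"
proof -
  assume AB: "A \<in> F" "B \<in> F"
  note A = sem_vspace[OF AB(1)] and B = sem_vspace[OF AB(2)]
  have v: "vector_space (prod_scale sm)"
    by unfold_locales
      (simp_all add: prod_scale_def scale_add[OF A] scale_add_left[OF A] scale_scale[OF A] scale_one[OF A]
        prod_eq_iff)
  then have "module (prod_scale sm)" by (simp add: module_iff_vector_space)
  then have "module.subspace (prod_scale sm) (sem M A \<times> sem M B)"
    by (simp add: module.subspace_def)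
      (auto simp: prod_scale_def zero_prod_def vspace_zero[OF A] vspace_zero[OF B]
        vspace_add[OF A] vspace_add[OF B] vspace_scale[OF A] vspace_scale[OF B])
  with v show ?thesis by (simp add: vspace_def)
qed

lemma vspace_Hom: "A \<in> F \<Longrightarrow> B \<in> F \<Longrightarrow> vspace (fun_scale sm) (Hom sm sm (sem M A) (sem M B))"
proof -
  assume AB: "A \<in> F" "B \<in> F"
  note B = sem_vspace[OF AB(2)]
  have v: "vector_space (fun_scale sm :: 'k \<Rightarrow> ('v \<Rightarrow> 'v) \<Rightarrow> 'v \<Rightarrow> 'v)"
    by (rule vector_space_fun_scale[OF vector_space_smul])
  then have "module (fun_scale sm :: 'k \<Rightarrow> ('v \<Rightarrow> 'v) \<Rightarrow> 'v \<Rightarrow> 'v)" by (simp add: module_iff_vector_space)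
  then have "module.subspace (fun_scale sm) (Hom sm sm (sem M A) (sem M B))"
    by (simp add: module.subspace_def)
      (auto simp: Hom_def lin_map_def Pi_iff fun_scale_def vspace_zero[OF B]
        vspace_add[OF B] vspace_scale[OF B] scale_zero[OF B] scale_add[OF B] scale_scale[OF B] mult.commute)
  with v show ?thesis by (simp add: vspace_def)
qed

lemma split_tensor_lin_map:
  "Tensor A B \<in> F \<Longrightarrow> lin_map sm tscale (sem M (Tensor A B)) (tensor sm [sem M A, sem M B]) (split_tensor M A B)"
  unfolding split_tensor_def by (rule lin_iso_inv_into[OF tensor_iso vspace_tensor])

lemma split_with_lin_map:
  "With A B \<in> F \<Longrightarrow> lin_map sm (prod_scale sm) (sem M (With A B)) (sem M A \<times> sem M B) (split_with M A B)"
  unfolding split_with_def using lin_iso_inv_into[OF with_iso vspace_prod] With_F by blast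

lemma apply_lolli_lin_map:
  "Lolli A B \<in> F \<Longrightarrow> lin_map sm (fun_scale sm) (sem M (Lolli A B)) (Hom sm sm (sem M A) (sem M B)) (apply_lolli M A B)"
  unfolding apply_lolli_def using lin_iso_inv_into[OF lolli_iso vspace_Hom] Lolli_F by blast

lemma split_tensor_iso:
  "Tensor A B \<in> F \<Longrightarrow> u \<in> tensor sm [sem M A, sem M B] \<Longrightarrow> split_tensor M A B (tensor_iso M A B u) = u"
  unfolding split_tensor_def using tensor_iso[of A B] by (simp add: lin_iso_def bij_betw_def)

lemma split_with_iso:
  "With A B \<in> F \<Longrightarrow> x \<in> sem M A \<Longrightarrow> y \<in> sem M B \<Longrightarrow> split_with M A B (with_iso M A B (x, y)) = (x, y)"
  unfolding split_with_def using with_iso[of A B] by (simp add: lin_iso_def bij_betw_def)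

lemma apply_lolli_iso:
  "Lolli A B \<in> F \<Longrightarrow> f \<in> Hom sm sm (sem M A) (sem M B) \<Longrightarrow> apply_lolli M A B (lolli_iso M A B f) = f"
  unfolding apply_lolli_def using lolli_iso[of A B] by (simp add: lin_iso_def bij_betw_def)

lemma lolli_iso_apply:
  "Lolli A B \<in> F \<Longrightarrow> l \<in> sem M (Lolli A B) \<Longrightarrow> lolli_iso M A B (apply_lolli M A B l) = l"
  unfolding apply_lolli_def using lolli_iso[of A B] by (simp add: lin_iso_def bij_betw_def f_inv_into_f)

lemma apply_lolli_arg:
  "Lolli A B \<in> F \<Longrightarrow> l \<in> sem M (Lolli A B) \<Longrightarrow> lin_map sm sm (sem M A) (sem M B) (apply_lolli M A B l)"
  using lin_map_mem[OF apply_lolli_lin_map] by (blast intro: Hom_lin_map)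

lemma apply_lolli_fun:
  assumes "Lolli A B \<in> F" "a \<in> sem M A"
  shows "lin_map sm sm (sem M (Lolli A B)) (sem M B) (\<lambda>l. apply_lolli M A B l a)"
  using lin_map_add[OF apply_lolli_lin_map[OF assms(1)]] lin_map_scale[OF apply_lolli_lin_map[OF assms(1)]]
  by (auto intro!: lin_mapI simp: fun_scale_def lin_map_mem[OF apply_lolli_arg[OF assms(1)] assms(2)])

text \<open>Semantic counterpart of \<open>proves\<close>: all formulas of the sequent are
  interpreted and the denotation is linear into the right space. The rules below transmit this
  property from premises to conclusion.\<close>

definition ty :: "'a deriv \<Rightarrow> 'a form list \<Rightarrow> 'a form \<Rightarrow> bool" where
  "ty \<pi> \<Gamma> C \<longleftrightarrow> hyps \<pi> = \<Gamma> \<and> set \<Gamma> \<subseteq> F \<and> C \<in> F \<and>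
     lin_map tscale sm (tensor sm (map (sem M) \<Gamma>)) (sem M C) (den M \<pi>)"

definition denotes :: "'a deriv \<Rightarrow> 'a form list \<Rightarrow> 'a form \<Rightarrow> ('v list \<Rightarrow> 'v) \<Rightarrow> bool" where
  "denotes \<pi> \<Gamma> C f \<longleftrightarrow> ty \<pi> \<Gamma> C \<and> (\<forall>xs\<in>listset (map (sem M) \<Gamma>). den M \<pi> (pure_of M xs) = f xs)"

lemma ty_mlin: "ty \<pi> \<Gamma> C \<Longrightarrow> mlin sm sm (map (sem M) \<Gamma>) (sem M C) (\<lambda>xs. den M \<pi> (pure_of M xs))"
  unfolding ty_def by (blast intro: mlin_lin_map_pure[OF vector_space_smul])

text \<open>Common to all rules but promotion: each denotation is a lift, and multilinearity of the
  lifted function yields at once its typing and its values on pure tensors.\<close>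

lemma denotes_on_hyps:
  assumes "hyps \<pi> = \<Gamma>" "set \<Gamma> \<subseteq> F" "C \<in> F" "den M \<pi> = on_hyps M \<pi> f"
    and f: "mlin sm sm (map (sem M) \<Gamma>) (sem M C) f"
  shows "denotes \<pi> \<Gamma> C f"
  using assms lift_Hom[OF vspace_sems[OF assms(2)] vector_space_smul sem_vspace[OF assms(3)] f]
    lift_pure[OF vspace_sems[OF assms(2)] vector_space_smul sem_vspace[OF assms(3)] f]
  by (simp add: denotes_def ty_def on_hyps_def Hom_lin_map)

lemma tyD: "ty \<pi> \<Gamma> C \<Longrightarrow> hyps \<pi> = \<Gamma> \<and> set \<Gamma> \<subseteq> F \<and> C \<in> F"
  by (simp add: ty_def)

section \<open>Typing and values of the individual rules\<close>

lemma denotes_ax: "A \<in> F \<Longrightarrow> denotes (Ax A) [A] A (\<lambda>xs. xs ! 0)"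
  by (rule denotes_on_hyps) (simp_all add: mlin_single lin_map_id)

lemma denotes_exch:
  assumes \<pi>: "ty \<pi> (map ((!) \<Gamma>) js) C" and js: "distinct js" "set js = {..<length \<Gamma>}"
  shows "denotes (Exch \<Gamma> js \<pi>) \<Gamma> C (\<lambda>xs. den M \<pi> (pure_of M (map ((!) xs) js)))"
proof (rule denotes_on_hyps)
  \<comment> \<open>The premise speaks of the permuted context only; as \<open>js\<close> reaches
    every index, no formula of \<open>\<Gamma>\<close> is missed.\<close>
  have "set \<Gamma> = (!) \<Gamma> ` set js" unfolding js(2) by (force simp: in_set_conv_nth)
  then have "set \<Gamma> = set (map ((!) \<Gamma>) js)" by (simp only: set_map)
  also have "\<dots> \<subseteq> F" using tyD[OF \<pi>] by blast
  finally show "set \<Gamma> \<subseteq> F" .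
  have "map (sem M) (map ((!) \<Gamma>) js) = map ((!) (map (sem M) \<Gamma>)) js" using js by simp
  with ty_mlin[OF \<pi>] have "mlin sm sm (map ((!) (map (sem M) \<Gamma>)) js) (sem M C) (\<lambda>xs. den M \<pi> (pure_of M xs))"
    by (simp only:)
  then show "mlin sm sm (map (sem M) \<Gamma>) (sem M C) (\<lambda>xs. den M \<pi> (pure_of M (map ((!) xs) js)))"
    using js by (intro mlin_permute[where f = "\<lambda>xs. den M \<pi> (pure_of M xs)"]) simp_all
qed (use tyD[OF \<pi>] in simp_all)

lemma denotes_cut:
  assumes \<pi>: "ty \<pi> \<Gamma> A" and \<rho>: "ty \<rho> (\<Delta>' @ A # \<Delta>) C"
  shows "denotes (Cut (length \<Delta>') A \<pi> \<rho>) (\<Delta>' @ \<Gamma> @ \<Delta>) C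
    (\<lambda>xs. den M \<rho> (pure_of M (take (length \<Delta>') xs @
      den M \<pi> (pure_of M (take (length \<Gamma>) (drop (length \<Delta>') xs))) # drop (length \<Delta>' + length \<Gamma>) xs)))"
proof (rule denotes_on_hyps)
  show "mlin sm sm (map (sem M) (\<Delta>' @ \<Gamma> @ \<Delta>)) (sem M C)
    (\<lambda>xs. den M \<rho> (pure_of M (take (length \<Delta>') xs @
      den M \<pi> (pure_of M (take (length \<Gamma>) (drop (length \<Delta>') xs))) # drop (length \<Delta>' + length \<Gamma>) xs)))"
    using tyD[OF \<pi>] tyD[OF \<rho>] ty_mlin[OF \<pi>] ty_mlin[OF \<rho>] unfolding map_append
    by (intro mlin_substitute[where V = "sem M A"]) (auto intro: sem_vspace)
qed (use tyD[OF \<pi>] tyD[OF \<rho>] in \<open>simp_all add: Let_def\<close>)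

lemma denotes_tensorL:
  assumes \<pi>: "ty \<pi> (\<Gamma> @ A # B # \<Delta>) C" and F: "Tensor A B \<in> F"
  shows "denotes (TensorL (length \<Gamma>) A B \<pi>) (\<Gamma> @ Tensor A B # \<Delta>) C
    (\<lambda>xs. lift2 sm sm (sem M A) (sem M B)
       (\<lambda>a b. den M \<pi> (pure_of M (take (length \<Gamma>) xs @ a # b # drop (Suc (length \<Gamma>)) xs)))
       (split_tensor M A B (xs ! length \<Gamma>)))"
proof (rule denotes_on_hyps)
  show "mlin sm sm (map (sem M) (\<Gamma> @ Tensor A B # \<Delta>)) (sem M C) (\<lambda>xs. lift2 sm sm (sem M A) (sem M B)
       (\<lambda>a b. den M \<pi> (pure_of M (take (length \<Gamma>) xs @ a # b # drop (Suc (length \<Gamma>)) xs)))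
       (split_tensor M A B (xs ! length \<Gamma>)))"
    using tyD[OF \<pi>] ty_mlin[OF \<pi>] F unfolding map_append list.map
    by (intro mlin_lift2[where f = "\<lambda>xs. den M \<pi> (pure_of M xs)"] split_tensor_lin_map)
      (auto intro: sem_vspace)
qed (use tyD[OF \<pi>] F in simp_all)

lemma denotes_contract:
  assumes \<pi>: "ty \<pi> (\<Gamma> @ Bang A # Bang A # \<Delta>) C"
  shows "denotes (Contract (length \<Gamma>) A \<pi>) (\<Gamma> @ Bang A # \<Delta>) C
    (\<lambda>xs. lift2 sm sm (sem M (Bang A)) (sem M (Bang A))
       (\<lambda>a b. den M \<pi> (pure_of M (take (length \<Gamma>) xs @ a # b # drop (Suc (length \<Gamma>)) xs)))
       (comult M A (xs ! length \<Gamma>)))"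
proof (rule denotes_on_hyps)
  have "Bang A \<in> F" using tyD[OF \<pi>] by simp
  from cofree[OF this] have "lin_map sm tscale (sem M (Bang A)) (tensor sm [sem M (Bang A), sem M (Bang A)]) (comult M A)"
    by (auto simp: cofree_def intro: comult_lin_map)
  then show "mlin sm sm (map (sem M) (\<Gamma> @ Bang A # \<Delta>)) (sem M C) (\<lambda>xs. lift2 sm sm (sem M (Bang A)) (sem M (Bang A))
       (\<lambda>a b. den M \<pi> (pure_of M (take (length \<Gamma>) xs @ a # b # drop (Suc (length \<Gamma>)) xs)))
       (comult M A (xs ! length \<Gamma>)))"
    using tyD[OF \<pi>] ty_mlin[OF \<pi>] unfolding map_append list.map
    by (intro mlin_lift2[where f = "\<lambda>xs. den M \<pi> (pure_of M xs)"]) (auto intro: sem_vspace)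
qed (use tyD[OF \<pi>] in simp_all)

lemma denotes_tensorR:
  assumes \<pi>: "ty \<pi> \<Gamma> A" and \<rho>: "ty \<rho> \<Delta> B" and F: "Tensor A B \<in> F"
  shows "denotes (TensorR A B \<pi> \<rho>) (\<Gamma> @ \<Delta>) (Tensor A B)
    (\<lambda>xs. tensor_iso M A B (pure_of M [den M \<pi> (pure_of M (take (length \<Gamma>) xs)),
      den M \<rho> (pure_of M (drop (length \<Gamma>) xs))]))"
proof (rule denotes_on_hyps)
  note m\<pi> = ty_mlin[OF \<pi>] and m\<rho> = ty_mlin[OF \<rho>]
  have iso: "lin_map tscale sm (tensor sm [sem M A, sem M B]) (sem M (Tensor A B)) (tensor_iso M A B)"
    using tensor_iso[OF F] by (simp add: lin_iso_def)
  have b: "bilin sm sm (sem M A) (sem M B) (sem M (Tensor A B)) (\<lambda>x y. tensor_iso M A B (pure_of M [x, y]))"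
    by (rule bilin_comp[OF bilin_pure[OF vector_space_smul] iso])
  show "mlin sm sm (map (sem M) (\<Gamma> @ \<Delta>)) (sem M (Tensor A B))
    (\<lambda>xs. tensor_iso M A B (pure_of M [den M \<pi> (pure_of M (take (length \<Gamma>) xs)),
      den M \<rho> (pure_of M (drop (length \<Gamma>) xs))]))"
    unfolding map_append
  proof (rule mlin_blocks2)
    fix xs ys assume "xs \<in> listset (map (sem M) \<Gamma>)" "ys \<in> listset (map (sem M) \<Delta>)"
    then show "tensor_iso M A B (pure_of M [den M \<pi> (pure_of M (take (length \<Gamma>) (xs @ ys))),
      den M \<rho> (pure_of M (drop (length \<Gamma>) (xs @ ys)))]) =
      tensor_iso M A B (pure_of M [den M \<pi> (pure_of M xs), den M \<rho> (pure_of M ys)])"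
      by (simp add: length_listset)
  next
    fix ys assume "ys \<in> listset (map (sem M) \<Delta>)"
    then show "mlin sm sm (map (sem M) \<Gamma>) (sem M (Tensor A B))
      (\<lambda>xs. tensor_iso M A B (pure_of M [den M \<pi> (pure_of M xs), den M \<rho> (pure_of M ys)]))"
      using b mlin_mem[OF m\<rho>] by (intro mlin_comp[OF m\<pi>]) (auto simp: bilin_def)
  next
    fix xs assume "xs \<in> listset (map (sem M) \<Gamma>)"
    then show "mlin sm sm (map (sem M) \<Delta>) (sem M (Tensor A B))
      (\<lambda>ys. tensor_iso M A B (pure_of M [den M \<pi> (pure_of M xs), den M \<rho> (pure_of M ys)]))"
      using b mlin_mem[OF m\<pi>] by (intro mlin_comp[OF m\<rho>]) (auto simp: bilin_def)
  qed (use tyD[OF \<pi>] tyD[OF \<rho>] in \<open>auto intro: sem_vspace\<close>)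
qed (use tyD[OF \<pi>] tyD[OF \<rho>] F in \<open>simp_all add: Let_def\<close>)

text \<open>Left \<open>With\<close> rules and dereliction differ only in the linear map
  \<open>h\<close> applied to the principal hypothesis.\<close>

lemma denotes_update:
  assumes \<pi>: "ty \<pi> (\<Gamma> @ A # \<Delta>) C" and F: "B \<in> F" and h: "lin_map sm sm (sem M B) (sem M A) h"
    and hy: "hyps \<rho> = \<Gamma> @ B # \<Delta>"
    and den: "den M \<rho> = on_hyps M \<rho> (\<lambda>xs. den M \<pi> (pure_of M (xs[length \<Gamma> := h (xs ! length \<Gamma>)])))"
  shows "denotes \<rho> (\<Gamma> @ B # \<Delta>) C (\<lambda>xs. den M \<pi> (pure_of M (xs[length \<Gamma> := h (xs ! length \<Gamma>)])))"
proof (rule denotes_on_hyps[OF hy _ _ den])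
  show "mlin sm sm (map (sem M) (\<Gamma> @ B # \<Delta>)) (sem M C)
      (\<lambda>xs. den M \<pi> (pure_of M (xs[length \<Gamma> := h (xs ! length \<Gamma>)])))"
    using tyD[OF \<pi>] ty_mlin[OF \<pi>] F h unfolding map_append list.map
    by (intro mlin_update[where f = "\<lambda>xs. den M \<pi> (pure_of M xs)" and U = "sem M A"]) (auto intro: sem_vspace)
qed (use tyD[OF \<pi>] F in auto)

lemma denotes_withL1:
  assumes \<pi>: "ty \<pi> (\<Gamma> @ A # \<Delta>) C" and F: "With A B \<in> F"
  shows "denotes (WithL1 (length \<Gamma>) A B \<pi>) (\<Gamma> @ With A B # \<Delta>) C
    (\<lambda>xs. den M \<pi> (pure_of M (xs[length \<Gamma> := fst (split_with M A B (xs ! length \<Gamma>))])))"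
  by (rule denotes_update[OF \<pi> F])
    (use split_with_lin_map[OF F] tyD[OF \<pi>] in \<open>auto simp: lin_map_def prod_scale_def Pi_iff mem_Times_iff\<close>)

lemma denotes_withL2:
  assumes \<pi>: "ty \<pi> (\<Gamma> @ B # \<Delta>) C" and F: "With A B \<in> F"
  shows "denotes (WithL2 (length \<Gamma>) A B \<pi>) (\<Gamma> @ With A B # \<Delta>) C
    (\<lambda>xs. den M \<pi> (pure_of M (xs[length \<Gamma> := snd (split_with M A B (xs ! length \<Gamma>))])))"
  by (rule denotes_update[OF \<pi> F])
    (use split_with_lin_map[OF F] tyD[OF \<pi>] in \<open>auto simp: lin_map_def prod_scale_def Pi_iff mem_Times_iff\<close>)

lemma denotes_derelict:
  assumes \<pi>: "ty \<pi> (\<Gamma> @ A # \<Delta>) C" and F: "Bang A \<in> F"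
  shows "denotes (Derelict (length \<Gamma>) A \<pi>) (\<Gamma> @ Bang A # \<Delta>) C
    (\<lambda>xs. den M \<pi> (pure_of M (xs[length \<Gamma> := univ_map M A (xs ! length \<Gamma>)])))"
  by (rule denotes_update[OF \<pi> F]) (use cofree[OF F] tyD[OF \<pi>] in \<open>auto simp: cofree_def\<close>)

lemma denotes_withR:
  assumes \<pi>: "ty \<pi> \<Gamma> A" and \<rho>: "ty \<rho> \<Gamma> B" and F: "With A B \<in> F"
  shows "denotes (WithR A B \<pi> \<rho>) \<Gamma> (With A B)
    (\<lambda>xs. with_iso M A B (den M \<pi> (pure_of M xs), den M \<rho> (pure_of M xs)))"
proof (rule denotes_on_hyps)
  show "mlin sm sm (map (sem M) \<Gamma>) (sem M (With A B))
    (\<lambda>xs. with_iso M A B (den M \<pi> (pure_of M xs), den M \<rho> (pure_of M xs)))"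
    by (rule mlin_comp[OF mlin_prod[OF ty_mlin[OF \<pi>] ty_mlin[OF \<rho>]]])
      (use with_iso[OF F] in \<open>simp add: lin_iso_def\<close>)
qed (use tyD[OF \<pi>] tyD[OF \<rho>] F in simp_all)

lemma denotes_lolliR:
  assumes \<pi>: "ty \<pi> (\<Gamma> @ [A]) B" and F: "Lolli A B \<in> F"
  shows "denotes (LolliR A B \<pi>) \<Gamma> (Lolli A B)
    (\<lambda>xs. lolli_iso M A B (\<lambda>a. if a \<in> sem M A then den M \<pi> (pure_of M (xs @ [a])) else 0))"
proof (rule denotes_on_hyps)
  have "mlin sm (fun_scale sm) (map (sem M) \<Gamma>) (Hom sm sm (sem M A) (sem M B))
    (\<lambda>xs a. if a \<in> sem M A then den M \<pi> (pure_of M (xs @ [a])) else 0)"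
    using ty_mlin[OF \<pi>] Lolli_F[OF F] by (intro mlin_curry) (auto intro: sem_vspace)
  moreover have "lin_map (fun_scale sm) sm (Hom sm sm (sem M A) (sem M B)) (sem M (Lolli A B)) (lolli_iso M A B)"
    using lolli_iso[OF F] by (simp add: lin_iso_def)
  ultimately show "mlin sm sm (map (sem M) \<Gamma>) (sem M (Lolli A B))
    (\<lambda>xs. lolli_iso M A B (\<lambda>a. if a \<in> sem M A then den M \<pi> (pure_of M (xs @ [a])) else 0))"
    by (rule mlin_comp)
qed (use tyD[OF \<pi>] F in simp_all)

text \<open>The functional and the hypotheses of \<open>\<pi>\<close> form one block whose value
  \<open>?g\<close> is substituted into \<open>\<rho>\<close>, which reduces the rule to the pattern
  of a cut. The functions \<open>?f\<close> and \<open>?h\<close> differ only in how the block is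
  cut out of the argument list.\<close>

lemma denotes_lolliL:
  assumes \<pi>: "ty \<pi> \<Gamma> A" and \<rho>: "ty \<rho> (\<Delta>' @ B # \<Delta>) C" and F: "Lolli A B \<in> F"
  shows "denotes (LolliL (length \<Delta>') A B \<pi> \<rho>) (\<Delta>' @ Lolli A B # \<Gamma> @ \<Delta>) C
    (\<lambda>xs. den M \<rho> (pure_of M (take (length \<Delta>') xs @
      apply_lolli M A B (xs ! length \<Delta>') (den M \<pi> (pure_of M (take (length \<Gamma>) (drop (Suc (length \<Delta>')) xs)))) #
      drop (Suc (length \<Delta>') + length \<Gamma>) xs)))"
proof (rule denotes_on_hyps)
  note m = ty_mlin[OF \<pi>]
  let ?g = "\<lambda>ys. apply_lolli M A B (ys ! 0) (den M \<pi> (pure_of M (tl ys)))"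
  have V: "vspace sm (sem M (Lolli A B))" using F by (rule sem_vspace)
  have g: "mlin sm sm (map (sem M) (Lolli A B # \<Gamma>)) (sem M B) ?g"
    unfolding list.map mlin_Cons
  proof (intro conjI ballI)
    fix xs assume "xs \<in> listset (map (sem M) \<Gamma>)"
    then show "lin_map sm sm (sem M (Lolli A B)) (sem M B) (\<lambda>l. ?g (l # xs))"
      using apply_lolli_fun[OF F mlin_mem[OF m]] by simp
  next
    fix l assume "l \<in> sem M (Lolli A B)"
    from mlin_comp[OF m apply_lolli_arg[OF F this]]
    show "mlin sm sm (map (sem M) \<Gamma>) (sem M B) (\<lambda>xs. ?g (l # xs))" by simp
  qed
  let ?f = "\<lambda>xs. den M \<rho> (pure_of M (take (length \<Delta>') xs @ ?g (take (Suc (length \<Gamma>)) (drop (length \<Delta>') xs)) #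
      drop (length \<Delta>' + Suc (length \<Gamma>)) xs))"
  let ?h = "\<lambda>xs. den M \<rho> (pure_of M (take (length \<Delta>') xs @
      apply_lolli M A B (xs ! length \<Delta>') (den M \<pi> (pure_of M (take (length \<Gamma>) (drop (Suc (length \<Delta>')) xs)))) #
      drop (Suc (length \<Delta>') + length \<Gamma>) xs))"
  have "mlin sm sm (map (sem M) \<Delta>' @ map (sem M) (Lolli A B # \<Gamma>) @ map (sem M) \<Delta>) (sem M C) ?f"
    using tyD[OF \<pi>] tyD[OF \<rho>] g ty_mlin[OF \<rho>] F
    by (intro mlin_substitute[where V = "sem M B" and f = "\<lambda>xs. den M \<rho> (pure_of M xs)" and g = ?g])
      (auto intro: sem_vspace)
  then have "mlin sm sm (map (sem M) \<Delta>' @ map (sem M) (Lolli A B # \<Gamma>) @ map (sem M) \<Delta>) (sem M C) ?h"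
  proof (rule mlin_cong[rotated 2])
    fix xs assume "xs \<in> listset (map (sem M) \<Delta>' @ map (sem M) (Lolli A B # \<Gamma>) @ map (sem M) \<Delta>)"
    then have "length xs = length (map (sem M) \<Delta>' @ map (sem M) (Lolli A B # \<Gamma>) @ map (sem M) \<Delta>)"
      by (rule length_listset)
    then have "length \<Delta>' < length xs" by simp
    from Cons_nth_drop_Suc[OF this]
    have "take (Suc (length \<Gamma>)) (drop (length \<Delta>') xs) = xs ! length \<Delta>' # take (length \<Gamma>) (drop (Suc (length \<Delta>')) xs)"
      by (metis take_Suc_Cons)
    then show "?h xs = ?f xs" by simp
  qed (use tyD[OF \<pi>] tyD[OF \<rho>] F in \<open>auto intro: sem_vspace\<close>)
  then show "mlin sm sm (map (sem M) (\<Delta>' @ Lolli A B # \<Gamma> @ \<Delta>)) (sem M C) ?h" by simp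
qed (use tyD[OF \<pi>] tyD[OF \<rho>] F in \<open>simp_all add: Let_def\<close>)

end

section \<open>Group-like elements\<close>

lemma bilin_pure_comp:
  assumes \<Phi>: "lin_map s t C D \<Phi>" and t: "vector_space t"
  shows "bilin s tscale C C (tensor t [D, D]) (\<lambda>x y. pure t [\<Phi> x, \<Phi> y])"
  using bilin_pure[OF t, of D D] lin_map_comp[OF \<Phi>] lin_map_mem[OF \<Phi>] unfolding bilin_def
  by fastforce

lemma coalgebra_hom_grouplike:
  assumes \<Phi>: "coalgebra_hom s C \<Delta>C \<epsilon>C t D \<Delta>D \<epsilon>D \<Phi>" and C: "vspace s C" and D: "vspace t D"
    and u: "u \<in> C" "\<Delta>C u = pure s [u, u]" "\<epsilon>C u = 1"
  shows "\<Phi> u \<in> D" "\<Delta>D (\<Phi> u) = pure t [\<Phi> u, \<Phi> u]" "\<epsilon>D (\<Phi> u) = 1"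
proof -
  have lin: "lin_map s t C D \<Phi>" using \<Phi> by (auto simp: coalgebra_hom_def Hom_def)
  have "lift2 s tscale C C (\<lambda>x y. pure t [\<Phi> x, \<Phi> y]) (\<Delta>C u) = pure t [\<Phi> u, \<Phi> u]"
    unfolding u(2)
    by (rule lift2_pure[OF C C vspace_tensor bilin_pure_comp[OF lin vspace_vector_space[OF D]] u(1) u(1)])
  then show "\<Phi> u \<in> D" "\<Delta>D (\<Phi> u) = pure t [\<Phi> u, \<Phi> u]" "\<epsilon>D (\<Phi> u) = 1"
    using \<Phi> u lin_map_mem[OF lin] by (auto simp: coalgebra_hom_def)
qed

context sweedler
begin

definition grouplike :: "'a form \<Rightarrow> 'v \<Rightarrow> 'v \<Rightarrow> bool" where
  "grouplike A g P \<longleftrightarrow> g \<in> sem M (Bang A) \<and> comult M A g = pure_of M [g, g] \<and> counit M A g = 1 \<and>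
     univ_map M A g = P"

lemma bang_coalgebra: "Bang A \<in> F \<Longrightarrow> cocomm_coalgebra sm (sem M (Bang A)) (comult M A) (counit M A)"
  using cofree by (simp add: cofree_def)

lemma univ_map_lin_map: "Bang A \<in> F \<Longrightarrow> lin_map sm sm (sem M (Bang A)) (sem M A) (univ_map M A)"
  using cofree by (simp add: cofree_def)

lemma cofree_ex1:
  fixes D :: "('k, 'v) tens set"
  assumes "Bang A \<in> F" "cocomm_coalgebra tscale D \<Delta>D \<epsilon>D" "lin_map tscale sm D (sem M A) f"
  shows "\<exists>!\<Phi>. coalgebra_hom tscale D \<Delta>D \<epsilon>D sm (sem M (Bang A)) (comult M A) (counit M A) \<Phi> \<and>
    (\<forall>x\<in>D. univ_map M A (\<Phi> x) = f x)"
  using cofree[OF assms(1)] assms(2,3) by (simp add: cofree_def)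

text \<open>Group-like elements are the images of \<open>1\<close> under coalgebra morphisms from the ground field,
  which is the empty tensor product of coalgebras.\<close>

lemma grouplike_ex1:
  assumes A: "Bang A \<in> F" and P: "P \<in> sem M A"
  shows "\<exists>!g. grouplike A g P"
proof -
  let ?K = "tensor sm []" and ?\<Delta> = "tensor_comult sm []" and ?\<epsilon> = "tensor_counit sm []"
  let ?B = "sem M (Bang A)"
  note s = vector_space_smul
  note K = tensor_coalgebra[OF s coalgebras_Nil, unfolded list.map]
  note B = sem_vspace[OF A] and vA = sem_vspace[OF Bang_F[OF A]]
  \<comment> \<open>\<open>f x\<close> is the linear map that sends the unit
    \<open>pure_of M []\<close> of the ground field to \<open>x\<close>.\<close>
  define f where "f x = lift sm sm [] (\<lambda>_. x)" for x
  have f: "f x \<in> Hom tscale sm ?K X" "f x (pure_of M []) = x" if "x \<in> X" "vspace sm X" for x X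
    unfolding f_def using lift_Hom[of "[]" sm sm X "\<lambda>_. x"] lift_pure[of "[]" sm sm X "\<lambda>_. x" "[]"] s that
    by auto
  have one: "?\<Delta> (pure_of M []) = pure tscale [pure_of M [], pure_of M []]" "?\<epsilon> (pure_of M []) = 1"
    "pure_of M [] \<in> ?K"
    using tensor_comult_pure[OF s coalgebras_Nil, of "[]"] tensor_counit_pure[OF s coalgebras_Nil, of "[]"]
      pure_in_tensor[OF s, of "[]" "[]"] by simp_all
  from cofree_ex1[OF A K Hom_lin_map[OF f(1)[OF P vA]]] obtain \<Phi> where
    \<Phi>: "coalgebra_hom tscale ?K ?\<Delta> ?\<epsilon> sm ?B (comult M A) (counit M A) \<Phi>"
      "\<forall>x\<in>?K. univ_map M A (\<Phi> x) = f P x"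
    and uniq: "\<And>\<Psi>. coalgebra_hom tscale ?K ?\<Delta> ?\<epsilon> sm ?B (comult M A) (counit M A) \<Psi> \<Longrightarrow>
      \<forall>x\<in>?K. univ_map M A (\<Psi> x) = f P x \<Longrightarrow> \<Psi> = \<Phi>"
    by (metis (no_types, lifting))
  have "grouplike A (\<Phi> (pure_of M [])) P"
    unfolding grouplike_def
    using coalgebra_hom_grouplike[OF \<Phi>(1), OF vspace_tensor B one(3,1,2)] \<Phi>(2) one(3) f(2)[OF P vA] by simp
  \<comment> \<open>Any group-like \<open>g\<close> over \<open>P\<close> makes \<open>f g\<close> a
    coalgebra morphism with the same composite as \<open>\<Phi>\<close>, so cofreeness forces the
    two to coincide.\<close>
  moreover have "g = \<Phi> (pure_of M [])" if g: "grouplike A g P" for g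
  proof -
    have gB: "g \<in> ?B" and g': "comult M A g = pure_of M [g, g]" "counit M A g = 1" "univ_map M A g = P"
      using g by (auto simp: grouplike_def)
    note fg = f(1)[OF gB B]
    note L = Hom_lin_map[OF fg] and d = univ_map_lin_map[OF A]
    note D = comult_lin_map[OF bang_coalgebra[OF A]] and E = counit_lin_map[OF bang_coalgebra[OF A]]
    note D' = comult_lin_map[OF K] and E' = counit_lin_map[OF K]
    note bil = bilin_pure_comp[OF L s]
    \<comment> \<open>This and the next two facts compare linear maps on a line, so each is verified
      at the unit, where it is one of the conditions on \<open>g\<close>.\<close>
    have "lift2 tscale tscale ?K ?K (\<lambda>x y. pure_of M [f g x, f g y]) (?\<Delta> c) = comult M A (f g c)"
      if "c \<in> ?K" for c
      by (rule lin_map_tensor_eq[OF s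
            lin_map_comp[OF D' Hom_lin_map[OF lift2_Hom[OF vspace_tensor vspace_tensor vspace_tensor bil]]]
            lin_map_comp[OF L D] _ that])
        (use lift2_pure[OF vspace_tensor vspace_tensor vspace_tensor bil one(3) one(3)] in
          \<open>simp add: one f(2)[OF gB B] g'\<close>)
    moreover have "counit M A (f g c) = ?\<epsilon> c" if "c \<in> ?K" for c
      by (rule lin_map_tensor_eq[OF s lin_map_comp[OF L E] E' _ that])
        (simp add: one f(2)[OF gB B] g')
    moreover have "univ_map M A (f g c) = f P c" if "c \<in> ?K" for c
      by (rule lin_map_tensor_eq[OF s lin_map_comp[OF L d] Hom_lin_map[OF f(1)[OF P vA]] _ that])
        (simp add: f(2)[OF gB B] f(2)[OF P vA] g')
    ultimately have "f g = \<Phi>" using fg by (intro uniq) (auto simp: coalgebra_hom_def)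
    then show ?thesis using f(2)[OF gB B] by simp
  qed
  ultimately show ?thesis by blast
qed

lemma vacuum_grouplike: "Bang A \<in> F \<Longrightarrow> P \<in> sem M A \<Longrightarrow> grouplike A (vacuum M A P) P"
  unfolding vacuum_def using theI'[OF grouplike_ex1] by (simp add: grouplike_def)

lemma grouplike_eq_vacuum: "Bang A \<in> F \<Longrightarrow> grouplike A g P \<Longrightarrow> g = vacuum M A P"
  using grouplike_ex1[of A P] vacuum_grouplike[of A P] lin_map_mem[OF univ_map_lin_map[of A], of g]
  by (auto simp: grouplike_def)

lemma
  assumes \<pi>: "ty \<pi> (map Bang \<Gamma>) A" and F: "Bang A \<in> F"
  shows ty_promote: "ty (Promote \<Gamma> A \<pi>) (map Bang \<Gamma>) (Bang A)"
    and den_promote: "list_all2 (\<lambda>A g. \<exists>P. grouplike A g P) \<Gamma> gs \<Longrightarrow>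
      den M (Promote \<Gamma> A \<pi>) (pure_of M gs) = vacuum M A (den M \<pi> (pure_of M gs))"
proof -
  let ?Cs = "map (bang_coalgebra M) \<Gamma>"
  let ?T = "tensor sm (map (sem M) (map Bang \<Gamma>))"
  let ?\<Delta> = "tensor_comult sm ?Cs" and ?\<epsilon> = "tensor_counit sm ?Cs"
  note s = vector_space_smul
  have Cs: "coalgebras sm ?Cs"
    using tyD[OF \<pi>] bang_coalgebra by (auto simp: coalgebras_def)
  have fst_Cs: "map fst ?Cs = map (sem M) (map Bang \<Gamma>)" by simp
  note T = tensor_coalgebra[OF s Cs, unfolded fst_Cs]
  have lin: "lin_map tscale sm ?T (sem M A) (den M \<pi>)" using \<pi> by (simp add: ty_def)
  \<comment> \<open>Cofreeness resolves the description in the denotation of promotion, because the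
    tensor product of the coalgebras of the hypotheses is a test coalgebra.\<close>
  define \<Phi> where "\<Phi> = den M (Promote \<Gamma> A \<pi>)"
  have "coalgebra_hom tscale ?T ?\<Delta> ?\<epsilon> sm (sem M (Bang A)) (comult M A) (counit M A) \<Phi> \<and>
    (\<forall>x\<in>?T. univ_map M A (\<Phi> x) = den M \<pi> x)"
    unfolding \<Phi>_def den.simps by (rule theI'[OF cofree_ex1[OF F T lin]])
  then have \<Phi>: "coalgebra_hom tscale ?T ?\<Delta> ?\<epsilon> sm (sem M (Bang A)) (comult M A) (counit M A) \<Phi>"
    "\<And>x. x \<in> ?T \<Longrightarrow> univ_map M A (\<Phi> x) = den M \<pi> x" by auto
  show "ty (Promote \<Gamma> A \<pi>) (map Bang \<Gamma>) (Bang A)"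
    using \<Phi>(1) tyD[OF \<pi>] F by (auto simp: ty_def \<Phi>_def[symmetric] coalgebra_hom_def Hom_def simp del: den.simps)
  show "den M (Promote \<Gamma> A \<pi>) (pure_of M gs) = vacuum M A (den M \<pi> (pure_of M gs))"
    if gs: "list_all2 (\<lambda>A g. \<exists>P. grouplike A g P) \<Gamma> gs"
  proof -
    have mem: "gs \<in> listset (map (sem M) (map Bang \<Gamma>))"
      using gs by (auto simp: in_listset_iff list_all2_conv_all_nth grouplike_def)
    have "length gs = length \<Gamma>" and gl: "\<And>i. i < length \<Gamma> \<Longrightarrow> \<exists>P. grouplike (\<Gamma> ! i) (gs ! i) P"
      using gs by (auto simp: list_all2_conv_all_nth)
    have "?\<Delta> (pure_of M gs) = pure tscale [pure_of M gs, pure_of M gs]"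
      by (rule tensor_comult_grouplike[OF s Cs, unfolded fst_Cs, OF mem])
        (use gl in \<open>auto simp: grouplike_def\<close>)
    moreover have "?\<epsilon> (pure_of M gs) = 1"
      using tensor_counit_pure[OF s Cs, unfolded fst_Cs, OF mem] gl
      by (auto simp: grouplike_def intro!: prod.neutral)
    moreover note mT = pure_in_tensor[OF s mem]
    ultimately have "grouplike A (\<Phi> (pure_of M gs)) (den M \<pi> (pure_of M gs))"
      unfolding grouplike_def
      using coalgebra_hom_grouplike[OF \<Phi>(1), OF vspace_tensor sem_vspace[OF F], of "pure_of M gs"] \<Phi>(2)
      by simp
    from grouplike_eq_vacuum[OF F this] show ?thesis by (simp only: \<Phi>_def)
  qed
qed

section \<open>Evaluation at pure tensors\<close>

text \<open>In \<open>ev \<pi> G C v\<close> the list \<open>G\<close> pairs each hypothesis of \<open>\<pi>\<close> with the vector at which it is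
  evaluated, so contexts and arguments undergo the same exchanges.\<close>

definition ev :: "'a deriv \<Rightarrow> ('a form \<times> 'v) list \<Rightarrow> 'a form \<Rightarrow> 'v \<Rightarrow> bool" where
  "ev \<pi> G C v \<longleftrightarrow> ty \<pi> (map fst G) C \<and> (\<forall>(A, x)\<in>set G. x \<in> sem M A) \<and>
     den M \<pi> (pure_of M (map snd G)) = v"

lemma context_listset:
  "(\<And>A x. (A, x) \<in> set G \<Longrightarrow> x \<in> sem M A) \<Longrightarrow> map snd G \<in> listset (map (sem M) (map fst G))"
  by (induction G) auto

lemma ev_ty: "ev \<pi> G C v \<Longrightarrow> ty \<pi> (map fst G) C"
  by (simp add: ev_def)

lemma evD:
  assumes "ev \<pi> G C v"
  shows "hyps \<pi> = map fst G" "C \<in> F" "v \<in> sem M C" "den M \<pi> (pure_of M (map snd G)) = v"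
    and "(A, x) \<in> set G \<Longrightarrow> A \<in> F" "(A, x) \<in> set G \<Longrightarrow> x \<in> sem M A"
proof -
  have "map snd G \<in> listset (map (sem M) (map fst G))"
    using assms by (auto simp: ev_def intro!: context_listset simp del: map_map)
  from mlin_mem[OF ty_mlin[OF ev_ty[OF assms]] this] show "v \<in> sem M C"
    using assms by (simp add: ev_def)
qed (use assms in \<open>auto simp: ev_def ty_def\<close>)

lemma ev_denotes:
  assumes "denotes \<pi> (map fst G) C f" "\<And>A x. (A, x) \<in> set G \<Longrightarrow> x \<in> sem M A"
  shows "ev \<pi> G C (f (map snd G))"
proof -
  have "map snd G \<in> listset (map (sem M) (map fst G))"
    using assms(2) by (rule context_listset)
  then show ?thesis using assms by (auto simp: denotes_def ev_def)
qed

lemma ev_ax: "A \<in> F \<Longrightarrow> x \<in> sem M A \<Longrightarrow> ev (Ax A) [(A, x)] A x"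
  using ev_denotes[of "Ax A" "[(A, x)]" A "\<lambda>xs. xs ! 0"] denotes_ax by simp

lemma ev_exch:
  assumes \<pi>: "ev \<pi> (map ((!) G) js) C v" and js: "distinct js" "set js = {..<length G}"
  shows "ev (Exch (map fst G) js \<pi>) G C v"
proof -
  have 1: "map fst (map ((!) G) js) = map ((!) (map fst G)) js" "map snd (map ((!) G) js) = map ((!) (map snd G)) js"
    using js by simp_all
  have "set G = (!) G ` set js" unfolding js(2) by (force simp: in_set_conv_nth)
  then have "set G = set (map ((!) G) js)" by (simp only: set_map)
  then have "x \<in> sem M A" if "(A, x) \<in> set G" for A x using evD(6)[OF \<pi>] that by blast
  from ev_denotes[OF denotes_exch[OF ev_ty[OF \<pi>, unfolded 1] js(1)] this] js(2) evD(4)[OF \<pi>]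
  show ?thesis by (simp add: 1[symmetric])
qed

lemma ev_cut:
  assumes \<pi>: "ev \<pi> G A w" and \<rho>: "ev \<rho> (D' @ (A, w) # D) C v"
  shows "ev (Cut (length D') A \<pi> \<rho>) (D' @ G @ D) C v"
proof -
  have "denotes (Cut (length D') A \<pi> \<rho>) (map fst (D' @ G @ D)) C
    (\<lambda>xs. den M \<rho> (pure_of M (take (length D') xs @
      den M \<pi> (pure_of M (take (length G) (drop (length D') xs))) # drop (length D' + length G) xs)))"
    using denotes_cut[OF ev_ty[OF \<pi>], of \<rho> "map fst D'" "map fst D" C] ev_ty[OF \<rho>] by simp
  from ev_denotes[OF this] evD(6)[OF \<pi>] evD(6)[OF \<rho>] evD(4)[OF \<pi>] evD(4)[OF \<rho>]
  show ?thesis by auto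
qed

text \<open>Splitting undoes \<open>tensor_iso\<close>, and the resulting lift is evaluated at the
  pure tensor of \<open>a\<close> and \<open>b\<close>; this needs bilinearity of the premise in the
  two adjacent slots.\<close>

lemma ev_tensorL:
  assumes \<pi>: "ev \<pi> (G @ (A, a) # (B, b) # D) C v" and F: "Tensor A B \<in> F"
  shows "ev (TensorL (length G) A B \<pi>) (G @ (Tensor A B, tensor_iso M A B (pure_of M [a, b])) # D) C v"
proof -
  let ?t = "tensor_iso M A B (pure_of M [a, b])"
  have F': "A \<in> F" "B \<in> F" using Tensor_F[OF F] by auto
  note s = vector_space_smul and vA = sem_vspace[OF F'(1)] and vB = sem_vspace[OF F'(2)]
  have ab: "a \<in> sem M A" "b \<in> sem M B" using evD(6)[OF \<pi>] by auto
  note p = pure2_in_tensor[OF s ab]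
  have t: "?t \<in> sem M (Tensor A B)" using tensor_iso[OF F] p by (auto simp: lin_iso_def lin_map_def)
  have mem: "map snd G \<in> listset (map (sem M) (map fst G))" "map snd D \<in> listset (map (sem M) (map fst D))"
    using evD(6)[OF \<pi>] by (auto intro!: context_listset simp del: map_map)
  have m: "mlin sm sm (map (sem M) (map fst G) @ sem M A # sem M B # map (sem M) (map fst D)) (sem M C)
      (\<lambda>xs. den M \<pi> (pure_of M xs))"
    using ty_mlin[OF ev_ty[OF \<pi>]] by simp
  have bil: "bilin sm sm (sem M A) (sem M B) (sem M C)
      (\<lambda>x y. den M \<pi> (pure_of M (map snd G @ x # y # map snd D)))"
    by (rule bilin_two_slots[OF _ vA sem_vspace[OF evD(2)[OF \<pi>]] m mem])
      (use evD(5)[OF \<pi>] in \<open>fastforce intro!: sem_vspace\<close>)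
  have "denotes (TensorL (length G) A B \<pi>) (map fst (G @ (Tensor A B, ?t) # D)) C
    (\<lambda>xs. lift2 sm sm (sem M A) (sem M B)
       (\<lambda>a b. den M \<pi> (pure_of M (take (length G) xs @ a # b # drop (Suc (length G)) xs)))
       (split_tensor M A B (xs ! length G)))"
    using denotes_tensorL[of \<pi> "map fst G" A B "map fst D" C] ev_ty[OF \<pi>] F by simp
  from ev_denotes[OF this] evD(6)[OF \<pi>] t
  have "ev (TensorL (length G) A B \<pi>) (G @ (Tensor A B, ?t) # D) C
    (lift2 sm sm (sem M A) (sem M B) (\<lambda>a b. den M \<pi> (pure_of M (map snd G @ a # b # map snd D)))
       (split_tensor M A B ?t))"
    by (auto simp: nth_append)
  then show ?thesis
    unfolding split_tensor_iso[OF F p] lift2_pure[OF vA vB sem_vspace[OF evD(2)[OF \<pi>]] bil ab]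
    using evD(4)[OF \<pi>] by simp
qed

lemma ev_contract:
  assumes \<pi>: "ev \<pi> (G @ (Bang A, g) # (Bang A, g) # D) C v" and g: "grouplike A g P"
  shows "ev (Contract (length G) A \<pi>) (G @ (Bang A, g) # D) C v"
proof -
  have F: "Bang A \<in> F" using evD(5)[OF \<pi>] by auto
  note vA = sem_vspace[OF F] and vC = sem_vspace[OF evD(2)[OF \<pi>]]
  have gA: "g \<in> sem M (Bang A)" using evD(6)[OF \<pi>] by auto
  have mem: "map snd G \<in> listset (map (sem M) (map fst G))" "map snd D \<in> listset (map (sem M) (map fst D))"
    using evD(6)[OF \<pi>] by (auto intro!: context_listset simp del: map_map)
  have m: "mlin sm sm (map (sem M) (map fst G) @ sem M (Bang A) # sem M (Bang A) # map (sem M) (map fst D)) (sem M C)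
      (\<lambda>xs. den M \<pi> (pure_of M xs))"
    using ty_mlin[OF ev_ty[OF \<pi>]] by simp
  have bil: "bilin sm sm (sem M (Bang A)) (sem M (Bang A)) (sem M C)
      (\<lambda>x y. den M \<pi> (pure_of M (map snd G @ x # y # map snd D)))"
    by (rule bilin_two_slots[OF _ vA vC m mem]) (use evD(5)[OF \<pi>] in \<open>fastforce intro!: sem_vspace\<close>)
  have "denotes (Contract (length G) A \<pi>) (map fst (G @ (Bang A, g) # D)) C
    (\<lambda>xs. lift2 sm sm (sem M (Bang A)) (sem M (Bang A))
       (\<lambda>a b. den M \<pi> (pure_of M (take (length G) xs @ a # b # drop (Suc (length G)) xs)))
       (comult M A (xs ! length G)))"
    using denotes_contract[of \<pi> "map fst G" A "map fst D" C] ev_ty[OF \<pi>] by simp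
  from ev_denotes[OF this] evD(6)[OF \<pi>]
  have "ev (Contract (length G) A \<pi>) (G @ (Bang A, g) # D) C
    (lift2 sm sm (sem M (Bang A)) (sem M (Bang A)) (\<lambda>a b. den M \<pi> (pure_of M (map snd G @ a # b # map snd D)))
       (comult M A g))"
    by (auto simp: nth_append)
  moreover have "comult M A g = pure_of M [g, g]" using g by (simp add: grouplike_def)
  ultimately show ?thesis using lift2_pure[OF vA vA vC bil gA gA] evD(4)[OF \<pi>] by simp
qed

lemma ev_tensorR:
  assumes \<pi>: "ev \<pi> G A v" and \<rho>: "ev \<rho> D B w" and F: "Tensor A B \<in> F"
  shows "ev (TensorR A B \<pi> \<rho>) (G @ D) (Tensor A B) (tensor_iso M A B (pure_of M [v, w]))"
proof -
  have "denotes (TensorR A B \<pi> \<rho>) (map fst (G @ D)) (Tensor A B)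
    (\<lambda>xs. tensor_iso M A B (pure_of M [den M \<pi> (pure_of M (take (length G) xs)),
      den M \<rho> (pure_of M (drop (length G) xs))]))"
    using denotes_tensorR[OF ev_ty[OF \<pi>] ev_ty[OF \<rho>] F] by simp
  from ev_denotes[OF this] evD(6)[OF \<pi>] evD(6)[OF \<rho>] evD(4)[OF \<pi>] evD(4)[OF \<rho>]
  show ?thesis by auto
qed

lemma split_with_mem:
  "With A B \<in> F \<Longrightarrow> x \<in> sem M (With A B) \<Longrightarrow>
    fst (split_with M A B x) \<in> sem M A \<and> snd (split_with M A B x) \<in> sem M B"
  using lin_map_mem[OF split_with_lin_map] by (auto simp: mem_Times_iff)

lemma ev_withL1:
  assumes \<pi>: "ev \<pi> (G @ (A, fst (split_with M A B x)) # D) C v"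
    and F: "With A B \<in> F" and x: "x \<in> sem M (With A B)"
  shows "ev (WithL1 (length G) A B \<pi>) (G @ (With A B, x) # D) C v"
proof -
  have "denotes (WithL1 (length G) A B \<pi>) (map fst (G @ (With A B, x) # D)) C
    (\<lambda>xs. den M \<pi> (pure_of M (xs[length G := fst (split_with M A B (xs ! length G))])))"
    using denotes_withL1[of \<pi> "map fst G" A "map fst D" C B] ev_ty[OF \<pi>] F by simp
  from ev_denotes[OF this] x evD(6)[OF \<pi>] evD(4)[OF \<pi>] show ?thesis
    by (auto simp: nth_append list_update_append)
qed

lemma ev_withL2:
  assumes \<pi>: "ev \<pi> (G @ (B, snd (split_with M A B x)) # D) C v"
    and F: "With A B \<in> F" and x: "x \<in> sem M (With A B)"
  shows "ev (WithL2 (length G) A B \<pi>) (G @ (With A B, x) # D) C v"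
proof -
  have "denotes (WithL2 (length G) A B \<pi>) (map fst (G @ (With A B, x) # D)) C
    (\<lambda>xs. den M \<pi> (pure_of M (xs[length G := snd (split_with M A B (xs ! length G))])))"
    using denotes_withL2[of \<pi> "map fst G" B "map fst D" C A] ev_ty[OF \<pi>] F by simp
  from ev_denotes[OF this] x evD(6)[OF \<pi>] evD(4)[OF \<pi>] show ?thesis
    by (auto simp: nth_append list_update_append)
qed

lemma ev_derelict:
  assumes \<pi>: "ev \<pi> (G @ (A, P) # D) C v" and F: "Bang A \<in> F" and g: "grouplike A g P"
  shows "ev (Derelict (length G) A \<pi>) (G @ (Bang A, g) # D) C v"
proof -
  have g': "g \<in> sem M (Bang A)" "univ_map M A g = P" using g by (auto simp: grouplike_def)
  have "denotes (Derelict (length G) A \<pi>) (map fst (G @ (Bang A, g) # D)) C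
    (\<lambda>xs. den M \<pi> (pure_of M (xs[length G := univ_map M A (xs ! length G)])))"
    using denotes_derelict[of \<pi> "map fst G" A "map fst D" C] ev_ty[OF \<pi>] F by simp
  from ev_denotes[OF this] g' evD(6)[OF \<pi>] evD(4)[OF \<pi>] show ?thesis
    by (auto simp: nth_append list_update_append)
qed

lemma ev_withR:
  assumes \<pi>: "ev \<pi> G A v" and \<rho>: "ev \<rho> G B w" and F: "With A B \<in> F"
  shows "ev (WithR A B \<pi> \<rho>) G (With A B) (with_iso M A B (v, w))"
  using ev_denotes[OF denotes_withR[OF ev_ty[OF \<pi>] ev_ty[OF \<rho>] F] evD(6)[OF \<pi>]]
    evD(4)[OF \<pi>] evD(4)[OF \<rho>] by simp

lemma ev_lolliL:
  assumes \<pi>: "ev \<pi> G A w" and \<rho>: "ev \<rho> (D' @ (B, apply_lolli M A B l w) # D) C v"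
    and F: "Lolli A B \<in> F" and l: "l \<in> sem M (Lolli A B)"
  shows "ev (LolliL (length D') A B \<pi> \<rho>) (D' @ (Lolli A B, l) # G @ D) C v"
proof -
  have "denotes (LolliL (length D') A B \<pi> \<rho>) (map fst (D' @ (Lolli A B, l) # G @ D)) C
    (\<lambda>xs. den M \<rho> (pure_of M (take (length D') xs @
      apply_lolli M A B (xs ! length D') (den M \<pi> (pure_of M (take (length G) (drop (Suc (length D')) xs)))) #
      drop (Suc (length D') + length G) xs)))"
    using denotes_lolliL[OF ev_ty[OF \<pi>], of \<rho> "map fst D'" B "map fst D" C] ev_ty[OF \<rho>] F by simp
  from ev_denotes[OF this] evD(6)[OF \<pi>] evD(6)[OF \<rho>] evD(4)[OF \<pi>] evD(4)[OF \<rho>] l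
  show ?thesis by (auto simp: nth_append)
qed

text \<open>The value \<open>l\<close> is proposed in advance and only its action on each
  \<open>a\<close> is verified. Both functions vanish outside \<open>sem M A\<close>, so they agree
  everywhere and \<open>lolli_iso_apply\<close> returns \<open>l\<close>.\<close>

lemma ev_lolliR:
  assumes \<pi>: "\<And>a. a \<in> sem M A \<Longrightarrow> ev \<pi> (G @ [(A, a)]) B (apply_lolli M A B l a)"
    and F: "Lolli A B \<in> F" and l: "l \<in> sem M (Lolli A B)"
  shows "ev (LolliR A B \<pi>) G (Lolli A B) l"
proof -
  \<comment> \<open>Some argument is needed to extract the typing of \<open>\<pi>\<close> from its
    evaluations; zero always exists.\<close>
  have z: "0 \<in> sem M A" using Lolli_F[OF F] sem_vspace vspace_zero by blast
  have "denotes (LolliR A B \<pi>) (map fst G) (Lolli A B)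
    (\<lambda>xs. lolli_iso M A B (\<lambda>a. if a \<in> sem M A then den M \<pi> (pure_of M (xs @ [a])) else 0))"
    using denotes_lolliR[of \<pi> "map fst G" A B] ev_ty[OF \<pi>[OF z]] F by simp
  moreover have "(\<lambda>a. if a \<in> sem M A then den M \<pi> (pure_of M (map snd G @ [a])) else 0) = apply_lolli M A B l"
    using evD(4)[OF \<pi>] Hom_off[OF lin_map_mem[OF apply_lolli_lin_map[OF F] l]] by auto
  ultimately show ?thesis
    using ev_denotes[of "LolliR A B \<pi>" G "Lolli A B"] evD(6)[OF \<pi>[OF z]] lolli_iso_apply[OF F l] by fastforce
qed

lemma ev_promote:
  assumes \<pi>: "ev \<pi> (map (\<lambda>(A, g). (Bang A, g)) G) A v" and F: "Bang A \<in> F"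
    and G: "\<And>A g. (A, g) \<in> set G \<Longrightarrow> \<exists>P. grouplike A g P"
  shows "ev (Promote (map fst G) A \<pi>) (map (\<lambda>(A, g). (Bang A, g)) G) (Bang A) (vacuum M A v)"
proof -
  have 1: "map fst (map (\<lambda>(A, g). (Bang A, g)) G) = map Bang (map fst G)"
    "map snd (map (\<lambda>(A, g). (Bang A, g)) G) = map snd G" by auto
  note t = ev_ty[OF \<pi>, unfolded 1]
  have "list_all2 (\<lambda>A g. \<exists>P. grouplike A g P) (map fst G) (map snd G)"
    using G by (force simp: list_all2_conv_all_nth set_conv_nth)
  from den_promote[OF t F this] evD(4)[OF \<pi>]
  have "den M (Promote (map fst G) A \<pi>) (pure_of M (map snd G)) = vacuum M A v" unfolding 1 by simp
  then show ?thesis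
    unfolding ev_def 1 using ty_promote[OF t F] evD(6)[OF \<pi>] by blast
qed

end

context sweedler
begin

section \<open>Booleans\<close>

lemmas vspace_ambient = vspace_UNIV[OF vector_space_smul]
lemmas smul_simps = scale_add[OF vspace_ambient] scale_scale[OF vspace_ambient]
  scale_sum[OF vspace_ambient] scale_zero_left[OF vspace_ambient] scale_zero[OF vspace_ambient]
  scale_one[OF vspace_ambient]

text \<open>Semantic value of the variable \<open>x_i\<close>. Powers are nested to the right, so
  the last coordinate is what remains after all first components are stripped.\<close>

fun coord :: "'a form \<Rightarrow> nat \<Rightarrow> nat \<Rightarrow> 'v \<Rightarrow> 'v" where
  "coord A (Suc 0) i x = x"
| "coord A (Suc (Suc m)) 0 x = fst (split_with M A (pow_form A (Suc m)) x)"
| "coord A (Suc (Suc m)) (Suc i) x = coord A (Suc m) i (snd (split_with M A (pow_form A (Suc m)) x))"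

fun tup :: "'a form \<Rightarrow> 'v list \<Rightarrow> 'v" where
  "tup A [v] = v"
| "tup A (v # w # vs) = with_iso M A (pow_form A (Suc (length vs))) (v, tup A (w # vs))"

lemma ev_proj:
  "i < m \<Longrightarrow> pow_form A m \<in> F \<Longrightarrow> x \<in> sem M (pow_form A m) \<Longrightarrow>
    ev (proj A m i) [(pow_form A m, x)] A (coord A m i x)"
proof (induction A m i arbitrary: x rule: proj.induct)
  case (1 A i)
  then show ?case by (simp add: ev_ax)
next
  case (2 A m)
  then have "ev (Ax A) ([] @ (A, fst (split_with M A (pow_form A (Suc m)) x)) # []) A
      (fst (split_with M A (pow_form A (Suc m)) x))"
    using split_with_mem[of A "pow_form A (Suc m)" x] With_F[of A "pow_form A (Suc m)"] by (auto intro: ev_ax)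
  from ev_withL1[OF this] 2 show ?case by simp
next
  case (3 A m i)
  then have "ev (proj A (Suc m) i) ([] @ (pow_form A (Suc m), snd (split_with M A (pow_form A (Suc m)) x)) # []) A
      (coord A (Suc m) i (snd (split_with M A (pow_form A (Suc m)) x)))"
    using split_with_mem[of A "pow_form A (Suc m)" x] With_F[of A "pow_form A (Suc m)"] by auto
  from ev_withL2[OF this] 3 show ?case by simp
qed simp

text \<open>Linearity is inherited from the denotation of \<open>proj A m i\<close>, which agrees
  with \<open>coord A m i\<close> on the space.\<close>

lemma coord_lin_map:
  assumes "i < m" "pow_form A m \<in> F"
  shows "lin_map sm sm (sem M (pow_form A m)) (sem M A) (coord A m i)"
proof -
  have "lin_map sm sm (sem M (pow_form A m)) (sem M A) (\<lambda>x. den M (proj A m i) (pure_of M [x]))"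
    using ty_mlin[OF ev_ty[OF ev_proj[OF assms vspace_zero[OF sem_vspace[OF assms(2)]]]]]
    by (simp add: mlin_single)
  then show ?thesis
    by (rule lin_map_cong[rotated 2])
      (use evD(4)[OF ev_proj[OF assms]] sem_vspace[OF assms(2)] in simp_all)
qed

lemma tup_mem:
  "vs \<noteq> [] \<Longrightarrow> set vs \<subseteq> sem M A \<Longrightarrow> pow_form A (length vs) \<in> F \<Longrightarrow>
    tup A vs \<in> sem M (pow_form A (length vs))"
proof (induction A vs rule: tup.induct)
  case (2 A v w vs)
  from With_F[of A "pow_form A (Suc (length vs))"] 2 with_iso[of A "pow_form A (Suc (length vs))"]
  show ?case by (auto simp: lin_iso_def lin_map_def Pi_iff)
qed auto

lemma coord_tup:
  "i < length vs \<Longrightarrow> set vs \<subseteq> sem M A \<Longrightarrow> pow_form A (length vs) \<in> F \<Longrightarrow>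
    coord A (length vs) i (tup A vs) = vs ! i"
proof (induction A vs arbitrary: i rule: tup.induct)
  case (2 A v w vs)
  have "split_with M A (pow_form A (Suc (length vs))) (tup A (v # w # vs)) = (v, tup A (w # vs))"
    using 2 With_F[of A "pow_form A (Suc (length vs))"] tup_mem[of "w # vs" A]
    by (simp add: split_with_iso)
  with 2 With_F[of A "pow_form A (Suc (length vs))"] show ?case
    by (cases i) (simp_all del: tup.simps)
qed auto

lemma ev_tuple:
  "ts \<noteq> [] \<Longrightarrow> list_all2 (\<lambda>t v. ev t G A v) ts vs \<Longrightarrow> pow_form A (length ts) \<in> F \<Longrightarrow>
    ev (tuple A ts) G (pow_form A (length ts)) (tup A vs)"
proof (induction A ts arbitrary: vs rule: tuple.induct)
  case (2 A t u ts)
  then obtain v w vs' where vs: "vs = v # w # vs'" "ev t G A v" "list_all2 (\<lambda>t v. ev t G A v) (u # ts) (w # vs')"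
    by (auto simp: list_all2_Cons1)
  have "length vs' = length ts" using vs(3) by (auto dest: list_all2_lengthD)
  moreover have "ev (tuple A (u # ts)) G (pow_form A (Suc (length ts))) (tup A (w # vs'))"
    using "2.IH"[OF _ vs(3)] "2.prems"(3) With_F[of A "pow_form A (Suc (length ts))"] by simp
  ultimately show ?case using ev_withR[OF vs(2)] "2.prems"(3) vs(1) by simp
qed (auto simp: list_all2_Cons1)

lemma bool_form_F:
  assumes "bool_form m A \<in> F" shows "pow_form A m \<in> F" "A \<in> F"
  using Lolli_F[of "pow_form A m" A] assms by (simp_all add: bool_form_def)

abbreviation app :: "'a form \<Rightarrow> nat \<Rightarrow> 'v \<Rightarrow> 'v \<Rightarrow> 'v" where
  "app A m \<equiv> apply_lolli M (pow_form A m) A"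

lemma app_lin_map:
  "bool_form m A \<in> F \<Longrightarrow> x \<in> sem M (pow_form A m) \<Longrightarrow>
    lin_map sm sm (sem M (bool_form m A)) (sem M A) (\<lambda>\<sigma>. app A m \<sigma> x)"
  unfolding bool_form_def by (rule apply_lolli_fun)

lemma ev_boolR:
  assumes "\<And>x. x \<in> sem M (pow_form A m) \<Longrightarrow> ev t (G @ [(pow_form A m, x)]) A (app A m \<sigma> x)"
    and "bool_form m A \<in> F" "\<sigma> \<in> sem M (bool_form m A)"
  shows "ev (LolliR (pow_form A m) A t) G (bool_form m A) \<sigma>"
  using assms unfolding bool_form_def by (rule ev_lolliR)

text \<open>The candidate is the image under \<open>lolli_iso\<close> of the coordinate map extended
  by zero; evaluating \<open>bool_proof\<close> identifies it with \<open>bool_vec\<close>.\<close>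

lemma
  assumes F: "bool_form m A \<in> F" and i: "i < m"
  shows bool_vec_mem: "bool_vec M A m i \<in> sem M (bool_form m A)"
    and app_bool_vec: "x \<in> sem M (pow_form A m) \<Longrightarrow> app A m (bool_vec M A m i) x = coord A m i x"
proof -
  note F' = bool_form_F[OF F]
  let ?f = "\<lambda>x. if x \<in> sem M (pow_form A m) then coord A m i x else 0"
  let ?l = "lolli_iso M (pow_form A m) A ?f"
  have f: "?f \<in> Hom sm sm (sem M (pow_form A m)) (sem M A)"
    by (rule Hom_restrict[OF sem_vspace[OF F'(1)] coord_lin_map[OF i F'(1)]])
  have l: "?l \<in> sem M (bool_form m A)"
    using lolli_iso[of "pow_form A m" A] F f by (auto simp: bool_form_def lin_iso_def dest: lin_map_mem)
  have a: "app A m ?l = ?f" using apply_lolli_iso[OF _ f] F by (simp add: bool_form_def)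
  have "ev (bool_proof A m i) [] (bool_form m A) ?l"
    unfolding bool_proof_def by (rule ev_boolR[OF _ F l]) (use a ev_proj[OF i F'(1)] in simp)
  from evD(4)[OF this] have "bool_vec M A m i = ?l" by (simp add: bool_vec_def)
  with l a show "bool_vec M A m i \<in> sem M (bool_form m A)"
    "x \<in> sem M (pow_form A m) \<Longrightarrow> app A m (bool_vec M A m i) x = coord A m i x" by simp_all
qed

text \<open>The inputs \<open>\<alpha> m\<close>, \<open>\<beta>\<close> and \<open>\<gamma>\<close>
  of the theorem all have this form.\<close>

definition comb :: "'a form \<Rightarrow> nat \<Rightarrow> (nat \<Rightarrow> 'k) \<Rightarrow> 'v" where
  "comb A m p = (\<Sum>i<m. sm (p i) (bool_vec M A m i))"

context
  fixes A :: "'a form" and m :: nat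
  assumes F: "bool_form m A \<in> F"
begin

lemmas bool_vspace = sem_vspace[OF F]
lemmas bool_mem = vspace_add[OF bool_vspace] vspace_scale[OF bool_vspace] vspace_sum[OF bool_vspace]
  bool_vec_mem[OF F]
lemmas app_simps = lin_map_add[OF app_lin_map[OF F]] lin_map_scale[OF app_lin_map[OF F]]
  lin_map_sum[OF bool_vspace app_lin_map[OF F]] app_bool_vec[OF F]

lemma comb_mem: "comb A m p \<in> sem M (bool_form m A)"
  unfolding comb_def by (simp add: bool_mem)

lemma app_comb: "x \<in> sem M (pow_form A m) \<Longrightarrow> app A m (comb A m p) x = (\<Sum>i<m. sm (p i) (coord A m i x))"
  unfolding comb_def by (simp add: app_simps bool_mem)

end

lemma ev_branch:
  assumes "ts \<noteq> []" "list_all2 (\<lambda>t v. ev t G A v) ts vs" "bool_form (length ts) A \<in> F"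
    "\<sigma> \<in> sem M (bool_form (length ts) A)"
  shows "ev (branch A ts) ((bool_form (length ts) A, \<sigma>) # G) A (app A (length ts) \<sigma> (tup A vs))"
proof -
  note F = bool_form_F[OF assms(3)]
  note 1 = ev_tuple[OF assms(1,2) F(1)]
  have "app A (length ts) \<sigma> (tup A vs) \<in> sem M A"
    using assms(3,4) evD(3)[OF 1] by (intro lin_map_mem[OF app_lin_map])
  from ev_lolliL[of "tuple A ts" G "pow_form A (length ts)" "tup A vs" "Ax A" "[]" A \<sigma> "[]"] ev_ax[OF F(2) this] 1 assms
  show ?thesis by (simp add: branch_def bool_form_def)
qed

lemma ev_branch_map:
  assumes "m \<ge> 1" "\<And>j. j < m \<Longrightarrow> ev (t j) G A (v j)" "bool_form m A \<in> F"
  shows "ev (branch A (map t [0..<m])) ((bool_form m A, comb A m p) # G) A (\<Sum>j<m. sm (p j) (v j))"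
proof -
  let ?ts = "map t [0..<m]" and ?vs = "map v [0..<m]"
  note F = bool_form_F[OF assms(3)]
  have v: "set ?vs \<subseteq> sem M A" using evD(3)[OF assms(2)] by auto
  have "ev (branch A ?ts) ((bool_form (length ?ts) A, comb A m p) # G) A (app A (length ?ts) (comb A m p) (tup A ?vs))"
    by (rule ev_branch) (use assms comb_mem in \<open>auto simp: list_all2_conv_all_nth\<close>)
  moreover have "app A m (comb A m p) (tup A ?vs) = (\<Sum>j<m. sm (p j) (v j))"
    using app_comb[OF assms(3), of "tup A ?vs"] tup_mem[OF _ v] coord_tup[OF _ v] F assms(1) by simp
  ultimately show ?thesis by simp
qed

text \<open>All \<open>m\<close> branches carry the same value \<open>v\<close>, so the coefficients
  add up.\<close>

lemma ev_discard:
  assumes "m \<ge> 1" "ev t G A v" "bool_form m A \<in> F"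
  shows "ev (discard A m t) ((bool_form m A, comb A m p) # G) A (sm (\<Sum>i<m. p i) v)"
  using ev_branch_map[OF assms(1) assms(2) assms(3)]
  by (simp add: discard_def map_replicate_const scale_sum_left[OF vspace_ambient])

lemma ev_discards:
  assumes "m \<ge> 1" "ev t G A v" "bool_form m A \<in> F"
  shows "ev ((discard A m ^^ length ls) t) (map (\<lambda>l. (bool_form m A, comb A m (p l))) ls @ G) A
    (sm (\<Prod>l\<leftarrow>ls. \<Sum>i<m. p l i) v)"
proof (induction ls)
  case (Cons l ls)
  from ev_discard[OF assms(1) this assms(3), of "p l"] show ?case by (simp add: smul_simps)
qed (use assms(2) in \<open>simp add: smul_simps\<close>)

lemma ev_apply_var:
  assumes "bool_form m A \<in> F" "\<sigma> \<in> sem M (bool_form m A)" "x \<in> sem M (pow_form A m)"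
  shows "ev (apply_var A m) [(bool_form m A, \<sigma>), (pow_form A m, x)] A (app A m \<sigma> x)"
proof -
  note F = bool_form_F[OF assms(1)]
  have "app A m \<sigma> x \<in> sem M A" using assms by (intro lin_map_mem[OF app_lin_map])
  from ev_lolliL[of "Ax (pow_form A m)" "[(pow_form A m, x)]" "pow_form A m" x "Ax A" "[]" A \<sigma> "[]"]
    ev_ax[OF F(2) this] ev_ax[OF F(1) assms(3)] assms
  show ?thesis by (simp add: apply_var_def bool_form_def)
qed

lemma ev_apply_to_var:
  assumes t: "ev t G (bool_form m A) \<sigma>" and x: "x \<in> sem M (pow_form A m)"
  shows "ev (apply_to_var A m t) (G @ [(pow_form A m, x)]) A (app A m \<sigma> x)"
  using ev_cut[OF t, of "apply_var A m" "[]" "[(pow_form A m, x)]"] ev_apply_var[OF evD(2,3)[OF t] x]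
  by (simp add: apply_to_var_def)

section \<open>The components of the step\<close>

text \<open>The value of \<open>trans_proof\<close> at \<open>comb A s a\<close> and
  \<open>comb A n b\<close>: each pair of symbol and state is sent to its image under the component
  \<open>p\<close>, weighted by the product of the two coefficients.\<close>

definition trans_vec :: "'a form \<Rightarrow> nat \<Rightarrow> nat \<Rightarrow> (nat \<times> nat \<Rightarrow> nat) \<Rightarrow> nat \<Rightarrow> (nat \<Rightarrow> 'k) \<Rightarrow> (nat \<Rightarrow> 'k) \<Rightarrow> 'v" where
  "trans_vec A s n p m a b = (\<Sum>i<s. \<Sum>q<n. sm (a i * b q) (bool_vec M A m (p (i, q))))"

context
  fixes A :: "'a form" and s n h :: nat and \<delta> :: "nat \<times> nat \<Rightarrow> nat \<times> nat \<times> nat"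
    and a :: "nat \<Rightarrow> nat \<Rightarrow> 'k" and b c :: "nat \<Rightarrow> 'k"
begin

text \<open>Like \<open>state_vec\<close> and \<open>tapehead_vec\<close> below, this is the closed
  form claimed in the theorem; the context fixes the coefficients of the inputs.\<close>

definition symbol_vec :: "nat \<Rightarrow> 'v" where
  "symbol_vec m = (\<Sum>i<s. \<Sum>q<n. sm (a m i * b q)
     (sm (c m) (bool_vec M A s (fst (\<delta> (i, q)))) + (\<Sum>l\<in>{..<h} - {m}. sm (c l) (bool_vec M A s i))))"

definition state_vec :: 'v where
  "state_vec = (\<Sum>l<h. sm (c l) (sm (\<Prod>m\<in>{..<h} - {l}. \<Sum>i<s. a m i)
     (\<Sum>i<s. \<Sum>q<n. sm (a l i * b q) (bool_vec M A n (fst (snd (\<delta> (i, q))))))))"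

definition tapehead_vec :: 'v where
  "tapehead_vec = (\<Sum>l<h. sm (c l) (sm (\<Prod>m\<in>{..<h} - {l}. \<Sum>i<s. a m i)
     (\<Sum>i<s. \<Sum>q<n. \<Sum>r<h. sm (a l i * b q * c r)
       (sm (of_bool (snd (snd (\<delta> (i, q))) = 0)) (bool_vec M A h ((r + h - 1) mod h)) +
        sm (of_bool (snd (snd (\<delta> (i, q))) = 1)) (bool_vec M A h ((r + 1) mod h))))))"

context
  assumes pos: "s \<ge> 1" "n \<ge> 1" "h \<ge> 1"
    and SF: "bool_form s A \<in> F" and NF: "bool_form n A \<in> F" and HF: "bool_form h A \<in> F"
    and F2: "bool_form 2 A \<in> F"
    and \<delta>: "\<delta> \<in> {..<s} \<times> {..<n} \<rightarrow> {..<s} \<times> {..<n} \<times> {0, 1}"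
begin

lemma \<delta>_bounds:
  assumes "i < s" "q < n"
  shows "fst (\<delta> (i, q)) < s" "fst (snd (\<delta> (i, q))) < n" "snd (snd (\<delta> (i, q))) < 2"
    "snd (snd (\<delta> (i, q))) = 0 \<or> snd (snd (\<delta> (i, q))) = 1"
  using funcset_mem[OF \<delta>, of "(i, q)"] assms by (auto simp: mem_Times_iff)

lemma trans_vec_mem:
  assumes "\<And>i q. i < s \<Longrightarrow> q < n \<Longrightarrow> p (i, q) < m" "bool_form m A \<in> F"
  shows "trans_vec A s n p m a' b \<in> sem M (bool_form m A)"
  unfolding trans_vec_def using assms by (simp add: bool_mem)

lemma app_trans_vec:
  assumes "\<And>i q. i < s \<Longrightarrow> q < n \<Longrightarrow> p (i, q) < m" "bool_form m A \<in> F" "x \<in> sem M (pow_form A m)"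
  shows "app A m (trans_vec A s n p m a' b) x = (\<Sum>i<s. \<Sum>q<n. sm (a' i * b q) (coord A m (p (i, q)) x))"
  unfolding trans_vec_def using assms by (simp add: app_simps bool_mem)

lemma ev_trans:
  assumes p: "\<And>i q. i < s \<Longrightarrow> q < n \<Longrightarrow> p (i, q) < m" and mF: "bool_form m A \<in> F"
  shows "ev (trans_proof A s n p m) [(bool_form s A, comb A s a'), (bool_form n A, comb A n b)] (bool_form m A)
    (trans_vec A s n p m a' b)"
  unfolding trans_proof_def
proof (rule ev_boolR[OF _ mF trans_vec_mem[of p m, OF p mF]])
  fix x assume x: "x \<in> sem M (pow_form A m)"
  have "ev (branch A (map (\<lambda>j. branch A (map (\<lambda>r. proj A m (p (j, r))) [0..<n])) [0..<s]))
    [(bool_form s A, comb A s a'), (bool_form n A, comb A n b), (pow_form A m, x)] A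
    (\<Sum>j<s. sm (a' j) (\<Sum>r<n. sm (b r) (coord A m (p (j, r)) x)))"
    by (intro ev_branch_map pos SF NF ev_proj p x bool_form_F[OF mF])
  then show "ev (branch A (map (\<lambda>j. branch A (map (\<lambda>r. proj A m (p (j, r))) [0..<n])) [0..<s]))
    ([(bool_form s A, comb A s a'), (bool_form n A, comb A n b)] @ [(pow_form A m, x)]) A
    (app A m (trans_vec A s n p m a' b) x)"
    by (simp add: app_trans_vec[of p m, OF p mF x] smul_simps)
qed

text \<open>The exchange brings all tape symbols other than the \<open>j\<close>-th to the front,
  where the iterated \<open>discard\<close> consumes them, each leaving its sum of coefficients as a
  scalar.\<close>

lemma ev_trans_at:
  assumes p: "\<And>i q. i < s \<Longrightarrow> q < n \<Longrightarrow> p (i, q) < m" and mF: "bool_form m A \<in> F" and j: "j < h"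
    and x: "x \<in> sem M (pow_form A m)"
  shows "ev (trans_at A s n h p m j)
    (map (\<lambda>l. (bool_form s A, comb A s (a l))) [0..<h] @ [(bool_form n A, comb A n b), (pow_form A m, x)]) A
    (sm (\<Prod>l\<in>{..<h} - {j}. \<Sum>i<s. a l i) (app A m (trans_vec A s n p m (a j) b) x))"
proof -
  let ?S = "\<lambda>l. (bool_form s A, comb A s (a l))"
  let ?G = "map ?S [0..<h] @ [(bool_form n A, comb A n b), (pow_form A m, x)]"
  define ls where "ls = filter (\<lambda>l. l \<noteq> j) [0..<h]"
  have ls: "distinct ls" "set ls = {..<h} - {j}" by (auto simp: ls_def)
  have L: "length ls = h - 1" using distinct_card[OF ls(1)] ls(2) j by simp
  \<comment> \<open>The left side is what the conditional list comprehension in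
    \<open>trans_at\<close> stands for.\<close>
  have E: "concat (map (\<lambda>l. if l \<noteq> j then [l] else []) [0..<h]) = ls"
    unfolding ls_def by (induction h) auto
  have P: "(\<Prod>l\<leftarrow>ls. \<Sum>i<s. a l i) = (\<Prod>l\<in>{..<h} - {j}. \<Sum>i<s. a l i)"
    using prod.distinct_set_conv_list[OF ls(1), of "\<lambda>l. \<Sum>i<s. a l i"] ls(2) by simp
  have M: "map ((!) ?G) (ls @ [j, h, h + 1]) =
    map ?S ls @ [?S j, (bool_form n A, comb A n b), (pow_form A m, x)]"
    using j ls(2) by (auto simp: nth_append)
  have fstG: "map fst ?G = replicate h (bool_form s A) @ [bool_form n A, pow_form A m]"
    by (simp add: o_def map_replicate_const)
  have "ev (Exch (map fst ?G) (ls @ [j, h, h + 1])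
    ((discard A s ^^ length ls) (apply_to_var A m (trans_proof A s n p m)))) ?G A
    (sm (\<Prod>l\<leftarrow>ls. \<Sum>i<s. a l i) (app A m (trans_vec A s n p m (a j) b) x))"
  proof (rule ev_exch)
    show "ev ((discard A s ^^ length ls) (apply_to_var A m (trans_proof A s n p m))) (map ((!) ?G) (ls @ [j, h, h + 1])) A
      (sm (\<Prod>l\<leftarrow>ls. \<Sum>i<s. a l i) (app A m (trans_vec A s n p m (a j) b) x))"
      unfolding M
      using ev_discards[OF pos(1) ev_apply_to_var[OF ev_trans[of p m, OF p mF] x] SF, where ls = ls and p = a] by simp
    show "distinct (ls @ [j, h, h + 1])" using ls j by auto
    have "set (ls @ [j, h, h + 1]) = {..<h + 2}" using j by (auto simp: ls(2))
    then show "set (ls @ [j, h, h + 1]) = {..<length ?G}" by simp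
  qed
  then show ?thesis unfolding trans_at_def E P L fstG .
qed

lemma ev_symbol:
  assumes m: "m < h"
  shows "ev (symbol A s n h \<delta> m)
    [(bool_form s A, comb A s (a m)), (bool_form n A, comb A n b), (bool_form h A, comb A h c)]
    (bool_form s A) (symbol_vec m)"
  unfolding symbol_def
proof (rule ev_boolR[OF _ SF])
  show "symbol_vec m \<in> sem M (bool_form s A)"
    unfolding symbol_vec_def using \<delta>_bounds by (simp add: bool_mem[OF SF])
  fix x assume x: "x \<in> sem M (pow_form A s)"
  let ?p = "\<lambda>x. fst (\<delta> x)"
  let ?S = "(bool_form s A, comb A s (a m))" and ?N = "(bool_form n A, comb A n b)"
    and ?H = "(bool_form h A, comb A h c)" and ?x = "(pow_form A s, x)"
  define v where "v = (\<Sum>i<s. \<Sum>q<n. sm (a m i * b q) (coord A s (?p (i, q)) x))"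
  define w where "w = (\<Sum>i<s. \<Sum>q<n. sm (a m i * b q) (coord A s i x))"
  have "ev (apply_to_var A s (trans_proof A s n ?p s)) ([?S, ?N] @ [?x]) A (app A s (trans_vec A s n ?p s (a m) b) x)"
    using \<delta>_bounds by (intro ev_apply_to_var ev_trans SF x) auto
  then have 1: "ev (apply_to_var A s (trans_proof A s n ?p s)) [?S, ?N, ?x] A v"
    using \<delta>_bounds SF x by (simp add: app_trans_vec v_def)
  \<comment> \<open>The scalar left by the discarded state is distributed over the sum of symbols,
    so that \<open>v\<close> and \<open>w\<close> become sums over the same pairs
    \<open>(i, q)\<close>.\<close>
  have "sm (\<Sum>q<n. b q) (app A s (comb A s (a m)) x) = w"
    by (simp add: app_comb[OF SF x] w_def smul_simps scale_sum_left[OF vspace_ambient] sum_distrib_left mult.commute)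
  with ev_discard[OF pos(2) ev_apply_var[OF SF comb_mem[OF SF, of "a m"] x] NF, of b]
  have "ev (discard A n (apply_var A s)) (map ((!) [?S, ?N, ?x]) [1, 0, 2]) A w" by simp
  from ev_exch[OF this] have 2: "ev (Exch [bool_form s A, bool_form n A, pow_form A s] [1, 0, 2]
      (discard A n (apply_var A s))) [?S, ?N, ?x] A w"
    by (auto simp: eval_nat_numeral lessThan_Suc insert_commute)
  have "ev (branch A (map (\<lambda>j. if j = m then apply_to_var A s (trans_proof A s n ?p s)
            else Exch [bool_form s A, bool_form n A, pow_form A s] [1, 0, 2] (discard A n (apply_var A s))) [0..<h]))
      [?H, ?S, ?N, ?x] A (\<Sum>j<h. sm (c j) (if j = m then v else w))"
    by (rule ev_branch_map[OF pos(3) _ HF]) (use 1 2 in simp)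
  moreover have "(\<Sum>j<h. sm (c j) (if j = m then v else w)) = app A s (symbol_vec m) x"
  proof -
    \<comment> \<open>Only the head position \<open>m\<close> rewrites the \<open>m\<close>-th
      symbol; the other positions share the branch \<open>w\<close>, and their coefficients are
      collected.\<close>
    have "(\<Sum>j<h. sm (c j) (if j = m then v else w)) = sm (c m) v + sm (\<Sum>l\<in>{..<h} - {m}. c l) w"
      using m by (simp add: sum.remove[of "{..<h}" m] scale_sum_left[OF vspace_ambient])
    also have "\<dots> = (\<Sum>i<s. \<Sum>q<n. sm (a m i * b q) (sm (c m) (coord A s (?p (i, q)) x) +
        sm (\<Sum>l\<in>{..<h} - {m}. c l) (coord A s i x)))"
      unfolding v_def w_def by (simp add: smul_simps sum.distrib mult.commute)
    also have "\<dots> = app A s (symbol_vec m) x"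
      unfolding symbol_vec_def using \<delta>_bounds x
      by (simp add: app_simps[OF SF] bool_mem[OF SF] scale_sum_left[OF vspace_ambient])
    finally show ?thesis .
  qed
  ultimately have "ev (branch A (map (\<lambda>j. if j = m then apply_to_var A s (trans_proof A s n ?p s)
            else Exch [bool_form s A, bool_form n A, pow_form A s] [1, 0, 2] (discard A n (apply_var A s))) [0..<h]))
      (map ((!) [?S, ?N, ?H, ?x]) [2, 0, 1, 3]) A (app A s (symbol_vec m) x)" by (simp add: numeral_3_eq_3)
  from ev_exch[OF this] show "ev (Exch [bool_form s A, bool_form n A, bool_form h A, pow_form A s] [2, 0, 1, 3]
         (branch A (map (\<lambda>j. if j = m then apply_to_var A s (trans_proof A s n ?p s)
            else Exch [bool_form s A, bool_form n A, pow_form A s] [1, 0, 2] (discard A n (apply_var A s))) [0..<h])))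
      ([?S, ?N, ?H] @ [?x]) A (app A s (symbol_vec m) x)"
    by (auto simp: eval_nat_numeral lessThan_Suc insert_commute)
qed

abbreviation "tapes \<equiv> map (\<lambda>l. (bool_form s A, comb A s (a l))) [0..<h]"

lemma ev_state:
  "ev (state A s n h \<delta>) (tapes @ [(bool_form n A, comb A n b), (bool_form h A, comb A h c)])
    (bool_form n A) state_vec"
  unfolding state_def
proof (rule ev_boolR[OF _ NF])
  show "state_vec \<in> sem M (bool_form n A)"
    unfolding state_vec_def using \<delta>_bounds by (simp add: bool_mem[OF NF])
  fix x assume x: "x \<in> sem M (pow_form A n)"
  let ?p = "\<lambda>x. fst (snd (\<delta> x))"
  let ?N = "(bool_form n A, comb A n b)" and ?H = "(bool_form h A, comb A h c)" and ?x = "(pow_form A n, x)"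
  let ?G = "tapes @ [?N, ?H, ?x]" and ?js = "(h + 1) # [0..<h + 1] @ [h + 2]"
  have fstG: "map fst ?G = replicate h (bool_form s A) @ [bool_form n A, bool_form h A, pow_form A n]"
    by (simp add: o_def map_replicate_const)
  have E: "map ((!) ?G) ?js = ?H # tapes @ [?N, ?x]"
    by (rule nth_equalityI) (auto simp: nth_append nth_Cons' simp del: upt_Suc)
  have p: "?p (i, q) < n" if "i < s" "q < n" for i q using \<delta>_bounds that by simp
  have "ev (branch A (map (trans_at A s n h ?p n) [0..<h])) (?H # tapes @ [?N, ?x]) A
    (\<Sum>j<h. sm (c j) (sm (\<Prod>l\<in>{..<h} - {j}. \<Sum>i<s. a l i) (app A n (trans_vec A s n ?p n (a j) b) x)))"
    by (intro ev_branch_map pos HF ev_trans_at p NF x)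
  also have "(\<Sum>j<h. sm (c j) (sm (\<Prod>l\<in>{..<h} - {j}. \<Sum>i<s. a l i) (app A n (trans_vec A s n ?p n (a j) b) x))) =
      app A n state_vec x"
    unfolding state_vec_def using p x trans_vec_mem[of ?p n]
    by (simp add: app_trans_vec[of ?p n, OF p NF x] app_simps[OF NF] bool_mem[OF NF])
  finally have "ev (branch A (map (trans_at A s n h ?p n) [0..<h])) (map ((!) ?G) ?js) A (app A n state_vec x)"
    unfolding E .
  moreover have "set ?js = {..<length ?G}" by auto
  ultimately
  have "ev (Exch (map fst ?G) ?js (branch A (map (trans_at A s n h ?p n) [0..<h]))) ?G A (app A n state_vec x)"
    by (intro ev_exch) (simp_all del: upt_Suc)
  then show "ev (Exch (replicate h (bool_form s A) @ [bool_form n A, bool_form h A, pow_form A n]) ?js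
      (branch A (map (trans_at A s n h ?p n) [0..<h]))) ((tapes @ [?N, ?H]) @ [?x]) A (app A n state_vec x)"
    unfolding fstG by simp
qed

lemma ev_tapehead:
  "ev (tapehead A s n h \<delta>)
    (tapes @ [(bool_form n A, comb A n b), (bool_form h A, comb A h c), (bool_form h A, comb A h c)])
    (bool_form h A) tapehead_vec"
  unfolding tapehead_def
proof (rule ev_boolR[OF _ HF])
  have mod: "k mod h < h" for k using pos by simp
  show "tapehead_vec \<in> sem M (bool_form h A)"
    unfolding tapehead_vec_def using mod by (simp add: bool_mem[OF HF])
  fix x assume x: "x \<in> sem M (pow_form A h)"
  let ?p = "\<lambda>x. snd (snd (\<delta> x))"
  let ?N = "(bool_form n A, comb A n b)" and ?H = "(bool_form h A, comb A h c)" and ?x = "(pow_form A h, x)"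
  let ?G = "tapes @ [?N, ?H, ?H, ?x]" and ?js = "(h + 2) # [0..<h + 2] @ [h + 3]"
  let ?left = "branch A (map (\<lambda>k. proj A h ((k + h - 1) mod h)) [0..<h])"
    and ?right = "branch A (map (\<lambda>k. proj A h ((k + 1) mod h)) [0..<h])"
  let ?t = "\<lambda>l. Cut 0 (bool_form 2 A) (LolliR (pow_form A 2) A (trans_at A s n h ?p 2 l))
      (branch A [?left, ?right])"
  \<comment> \<open>\<open>L\<close> and \<open>R\<close> are the values at \<open>x\<close> of the
    head position shifted cyclically. Adding \<open>h\<close> before subtracting avoids truncation
    at \<open>k = 0\<close>.\<close>
  define L where "L = (\<Sum>k<h. sm (c k) (coord A h ((k + h - 1) mod h) x))"
  define R where "R = (\<Sum>k<h. sm (c k) (coord A h ((k + 1) mod h) x))"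
  \<comment> \<open>The scalar of the discarded symbols is put into the vector, so that the cut
    passes a single element of \<open>bool_form 2 A\<close>.\<close>
  define w where "w l = sm (\<Prod>m\<in>{..<h} - {l}. \<Sum>i<s. a m i) (trans_vec A s n ?p 2 (a l) b)" for l
  have fstG: "map fst ?G = replicate h (bool_form s A) @ [bool_form n A, bool_form h A, bool_form h A, pow_form A h]"
    by (simp add: o_def map_replicate_const)
  \<comment> \<open>Index \<open>h + 2\<close> is the second copy of the head position: it selects
    the tape cell, while the first copy stays behind to be shifted.\<close>
  have E: "map ((!) ?G) ?js = ?H # tapes @ [?N, ?H, ?x]"
    by (rule nth_equalityI) (auto simp: nth_append nth_Cons' numeral_3_eq_3 simp del: upt_Suc)
  have p: "?p (i, q) < 2" if "i < s" "q < n" for i q using \<delta>_bounds that by simp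
  note tv = trans_vec_mem[of ?p 2, OF p F2]
  have w: "w l \<in> sem M (bool_form 2 A)" for l
    unfolding w_def by (rule vspace_scale[OF sem_vspace[OF F2] tv])
  have app_w: "app A 2 (w l) y = sm (\<Prod>m\<in>{..<h} - {l}. \<Sum>i<s. a m i) (app A 2 (trans_vec A s n ?p 2 (a l) b) y)"
    if "y \<in> sem M (pow_form A 2)" for l y
    unfolding w_def by (rule lin_map_scale[OF app_lin_map[OF F2 that] tv])
  have 1: "ev (LolliR (pow_form A 2) A (trans_at A s n h ?p 2 l)) (tapes @ [?N]) (bool_form 2 A) (w l)"
    if l: "l < h" for l
  proof (rule ev_boolR[OF _ F2 w])
    fix y assume y: "y \<in> sem M (pow_form A 2)"
    from ev_trans_at[of ?p 2, OF p F2 l y] app_w[OF y]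
    show "ev (trans_at A s n h ?p 2 l) ((tapes @ [?N]) @ [(pow_form A 2, y)]) A (app A 2 (w l) y)" by simp
  qed
  have l: "ev ?left [?H, ?x] A L" and r: "ev ?right [?H, ?x] A R"
    unfolding L_def R_def by (intro ev_branch_map pos HF ev_proj mod bool_form_F[OF HF] x)+
  note LR = evD(3)[OF l] evD(3)[OF r]
  have b: "ev (branch A [?left, ?right]) [(bool_form 2 A, w l), ?H, ?x] A (app A 2 (w l) (tup A [L, R]))" for l
    using ev_branch[of "[?left, ?right]" "[?H, ?x]" A "[L, R]" "w l"] l r F2 w by (simp add: numeral_2_eq_2)
  have t: "ev (?t l) (tapes @ [?N, ?H, ?x]) A (app A 2 (w l) (tup A [L, R]))" if "l < h" for l
    using ev_cut[OF 1[OF that], of "branch A [?left, ?right]" "[]" "[?H, ?x]" A] b by simp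
  have LR_mem: "tup A [L, R] \<in> sem M (pow_form A 2)"
    using tup_mem[of "[L, R]" A] LR bool_form_F[OF F2] by (simp add: numeral_2_eq_2)
  have LR_coord: "coord A 2 i (tup A [L, R]) = [L, R] ! i" if "i < 2" for i
    using coord_tup[of i "[L, R]" A] LR bool_form_F[OF F2] that by (simp add: numeral_2_eq_2)
  have app_w_LR: "app A 2 (w l) (tup A [L, R]) =
      sm (\<Prod>m\<in>{..<h} - {l}. \<Sum>i<s. a m i) (\<Sum>i<s. \<Sum>q<n. \<Sum>r<h. sm (a l i * b q * c r)
       (sm (of_bool (?p (i, q) = 0)) (coord A h ((r + h - 1) mod h) x) +
        sm (of_bool (?p (i, q) = 1)) (coord A h ((r + 1) mod h) x)))" for l
  proof -
    \<comment> \<open>Direction \<open>0\<close> picks the coordinate \<open>L\<close> and direction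
      \<open>1\<close> picks \<open>R\<close>. As no other value occurs, exactly one of the two
      indicators is \<open>1\<close>.\<close>
    have "sm (a l i * b q) (coord A 2 (?p (i, q)) (tup A [L, R])) = (\<Sum>r<h. sm (a l i * b q * c r)
       (sm (of_bool (?p (i, q) = 0)) (coord A h ((r + h - 1) mod h) x) +
        sm (of_bool (?p (i, q) = 1)) (coord A h ((r + 1) mod h) x)))" if "i < s" "q < n" for i q
      using \<delta>_bounds(4)[OF that] LR_coord[OF p[OF that]] by (auto simp: L_def R_def smul_simps)
    moreover have "app A 2 (trans_vec A s n ?p 2 (a l) b) (tup A [L, R]) =
        (\<Sum>i<s. \<Sum>q<n. sm (a l i * b q) (coord A 2 (?p (i, q)) (tup A [L, R])))"
      by (rule app_trans_vec) (simp_all only: p F2 LR_mem)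
    ultimately show ?thesis unfolding app_w[OF LR_mem] by simp
  qed
  have "ev (branch A (map ?t [0..<h])) (?H # tapes @ [?N, ?H, ?x]) A
      (\<Sum>l<h. sm (c l) (app A 2 (w l) (tup A [L, R])))"
    by (rule ev_branch_map[OF pos(3) t HF])
  also have "(\<Sum>l<h. sm (c l) (app A 2 (w l) (tup A [L, R]))) = app A h tapehead_vec x"
    unfolding app_w_LR tapehead_vec_def using x mod by (simp add: app_simps[OF HF] bool_mem[OF HF])
  finally have "ev (branch A (map ?t [0..<h])) (map ((!) ?G) ?js) A (app A h tapehead_vec x)"
    unfolding E .
  moreover have "set ?js = {..<length ?G}" by auto
  ultimately
  have "ev (Exch (map fst ?G) ?js (branch A (map ?t [0..<h]))) ?G A (app A h tapehead_vec x)"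
    by (intro ev_exch) (simp_all del: upt_Suc)
  then show "ev (Exch (replicate h (bool_form s A) @ [bool_form n A, bool_form h A, bool_form h A, pow_form A h]) ?js
      (branch A (map ?t [0..<h]))) ((tapes @ [?N, ?H, ?H]) @ [?x]) A (app A h tapehead_vec x)"
    unfolding fstG by simp
qed

end

end

end

section \<open>Assembling the step\<close>

context sweedler
begin

section \<open>Tensoring, contracting and promoting whole contexts\<close>

lemma tensor_form_Cons: "\<Gamma> \<noteq> [] \<Longrightarrow> tensor_form (A # \<Gamma>) = Tensor A (tensor_form \<Gamma>)"
  by (cases \<Gamma>) auto

lemma tensor_elt_Cons:
  "\<Gamma> \<noteq> [] \<Longrightarrow> xs \<noteq> [] \<Longrightarrow>
    tensor_elt M (A # \<Gamma>) (x # xs) = tensor_iso M A (tensor_form \<Gamma>) (pure_of M [x, tensor_elt M \<Gamma> xs])"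
  by (cases \<Gamma>; cases xs) auto

lemma tensor_form_F: "tensor_form \<Gamma> \<in> F \<Longrightarrow> \<Gamma> \<noteq> [] \<Longrightarrow> set \<Gamma> \<subseteq> F"
  by (induction \<Gamma> rule: tensor_form.induct) (auto dest: Tensor_F)

lemma tensor_form_drop_F: "tensor_form \<Gamma> \<in> F \<Longrightarrow> k < length \<Gamma> \<Longrightarrow> tensor_form (drop k \<Gamma>) \<in> F"
proof (induction \<Gamma> arbitrary: k)
  case (Cons A \<Gamma>)
  then show ?case
    by (cases k; cases "\<Gamma> = []") (auto simp: tensor_form_Cons dest: Tensor_F)
qed simp

text \<open>A list of hypotheses with their vectors, packed into the one hypothesis that replaces
  them after all left tensor rules.\<close>

definition tensor_entry :: "('a form \<times> 'v) list \<Rightarrow> 'a form \<times> 'v" where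
  "tensor_entry G = (tensor_form (map fst G), tensor_elt M (map fst G) (map snd G))"

text \<open>The rules are applied from the right, so in the induction the first \<open>k\<close>
  hypotheses are still separate and all later ones are already packed into one entry.\<close>

lemma ev_tensorL_all:
  assumes "k < length G" "ev \<pi> (take k G @ [tensor_entry (drop k G)]) C v" "tensor_form (map fst G) \<in> F"
  shows "ev (fold (\<lambda>k. TensorL k (map fst G ! k) (tensor_form (drop (Suc k) (map fst G)))) (rev [0..<k]) \<pi>)
    [tensor_entry G] C v"
  using assms
proof (induction k arbitrary: \<pi>)
  case (Suc k)
  let ?A = "fst (G ! k)" and ?B = "tensor_form (drop (Suc k) (map fst G))"
  have G: "drop k G = G ! k # drop (Suc k) G" "drop (Suc k) G \<noteq> []"
    using Suc.prems(1) by (auto simp: Cons_nth_drop_Suc)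
  have t: "tensor_entry (drop k G) =
      (Tensor ?A ?B, tensor_iso M ?A ?B (pure_of M [snd (G ! k), snd (tensor_entry (drop (Suc k) G))]))"
    unfolding tensor_entry_def G(1) using G(2) by (simp add: tensor_form_Cons tensor_elt_Cons drop_map)
  have "tensor_form (drop k (map fst G)) \<in> F" using Suc.prems by (intro tensor_form_drop_F) auto
  then have F: "Tensor ?A ?B \<in> F" using t by (simp add: tensor_entry_def drop_map)
  have "take (Suc k) G = take k G @ [(?A, snd (G ! k))]"
    using Suc.prems(1) by (simp add: take_Suc_conv_app_nth prod_eq_iff)
  then have "ev \<pi> (take k G @ (?A, snd (G ! k)) # (?B, snd (tensor_entry (drop (Suc k) G))) # []) C v"
    using Suc.prems(2) by (simp add: tensor_entry_def drop_map)
  from ev_tensorL[OF this F]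
  have "ev (TensorL k ?A ?B \<pi>) (take k G @ [tensor_entry (drop k G)]) C v"
    using Suc.prems(1) by (simp add: t min_absorb2)
  from Suc.IH[OF _ this] Suc.prems show ?case by simp
qed simp

lemma ev_tensor_proofs:
  assumes "ps \<noteq> []" "list_all2 (\<lambda>(A, \<pi>) (G, v). ev \<pi> G A v) ps Gs" "tensor_form (map fst ps) \<in> F"
  shows "ev (tensor_proofs ps) (concat (map fst Gs)) (tensor_form (map fst ps))
    (tensor_elt M (map fst ps) (map snd Gs))"
  using assms
proof (induction ps arbitrary: Gs rule: tensor_proofs.induct)
  case (1 A \<pi>)
  then show ?case by (auto simp: list_all2_Cons1)
next
  case (2 A \<pi> B \<rho> ps)
  then obtain G v Gs' where G: "Gs = (G, v) # Gs'" "ev \<pi> G A v"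
    "list_all2 (\<lambda>(A, \<pi>) (G, v). ev \<pi> G A v) ((B, \<rho>) # ps) Gs'"
    by (auto simp: list_all2_Cons1)
  from G(3) have ne: "map snd Gs' \<noteq> []" by (auto simp: list_all2_Cons1)
  from "2.prems"(3) have F: "Tensor A (tensor_form (B # map fst ps)) \<in> F" by simp
  from Tensor_F[OF F] have "tensor_form (map fst ((B, \<rho>) # ps)) \<in> F" by simp
  from ev_tensorR[OF G(2) "2.IH"[OF _ G(3) this]] F ne show ?case
    by (simp add: G(1) tensor_elt_Cons)
qed simp

lemma ev_contracts:
  "ev \<pi> (G @ replicate (Suc k) (Bang A, g) @ D) C v \<Longrightarrow> grouplike A g P \<Longrightarrow>
    ev ((Contract (length G) A ^^ k) \<pi>) (G @ (Bang A, g) # D) C v"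
proof (induction k arbitrary: \<pi>)
  case (Suc k)
  from Suc.prems(1) have "ev \<pi> (G @ (Bang A, g) # (Bang A, g) # replicate k (Bang A, g) @ D) C v" by simp
  from ev_contract[OF this Suc.prems(2)]
  have "ev (Contract (length G) A \<pi>) (G @ replicate (Suc k) (Bang A, g) @ D) C v" by simp
  from Suc.IH[OF this Suc.prems(2)] show ?case by (simp add: funpow_swap1)
qed simp

text \<open>Each tape symbol is used three times: by its own \<open>symbol\<close> proof, by
  \<open>state\<close> and by \<open>tapehead\<close>. Once the first \<open>k\<close> triples are
  single entries, the next triple starts at position \<open>k\<close>, which is where the next
  contractions act.\<close>

lemma ev_contract_triples:
  assumes \<pi>: "ev \<pi> (concat (map (\<lambda>m. replicate 3 (Bang A, g m)) [0..<h]) @ D) C v"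
    and g: "\<And>m. m < h \<Longrightarrow> grouplike A (g m) (P m)"
  shows "ev (fold (\<lambda>m. Contract m A ^^ 2) [0..<h] \<pi>) (map (\<lambda>m. (Bang A, g m)) [0..<h] @ D) C v"
proof -
  have "k \<le> h \<Longrightarrow> ev (fold (\<lambda>m. Contract m A ^^ 2) [0..<k] \<pi>)
      (map (\<lambda>m. (Bang A, g m)) [0..<k] @ concat (map (\<lambda>m. replicate 3 (Bang A, g m)) [k..<h]) @ D) C v" for k
  proof (induction k)
    case (Suc k)
    then have "[k..<h] = k # [Suc k..<h]" by (simp add: upt_conv_Cons)
    moreover have "replicate 3 (Bang A, g k) = replicate (Suc 2) (Bang A, g k)"
      by (simp add: numeral_3_eq_3 numeral_2_eq_2)
    ultimately have "ev (fold (\<lambda>m. Contract m A ^^ 2) [0..<k] \<pi>) (map (\<lambda>m. (Bang A, g m)) [0..<k] @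
      replicate (Suc 2) (Bang A, g k) @ concat (map (\<lambda>m. replicate 3 (Bang A, g m)) [Suc k..<h]) @ D) C v"
      using Suc by simp
    from ev_contracts[OF this g] Suc.prems show ?case by simp
  qed (use \<pi> in simp)
  from this[of h] show ?thesis by simp
qed

lemma ev_derelict_promote:
  assumes \<pi>: "ev \<pi> G A v" and F: "Bang A \<in> F" and G: "\<And>B P. (B, P) \<in> set G \<Longrightarrow> Bang B \<in> F"
  shows "ev (derelict_promote (map fst G) A \<pi>) (map (\<lambda>(B, P). (Bang B, vacuum M B P)) G)
    (Bang A) (vacuum M A v)"
proof -
  let ?vac = "\<lambda>(B, P). (Bang B, vacuum M B P)"
  have gl: "grouplike B (vacuum M B P) P" if "(B, P) \<in> set G" for B P
    by (rule vacuum_grouplike[OF G[OF that] evD(6)[OF \<pi> that]])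
  have "j \<le> length G \<Longrightarrow> ev (fold (\<lambda>k. Derelict k (map fst G ! k)) [0..<j] \<pi>) (map ?vac (take j G) @ drop j G) A v" for j
  proof (induction j)
    case (Suc j)
    obtain B P where BP: "G ! j = (B, P)" by force
    then have mem: "(B, P) \<in> set G" using Suc.prems nth_mem[of j G] by simp
    have "ev (fold (\<lambda>k. Derelict k (map fst G ! k)) [0..<j] \<pi>) (map ?vac (take j G) @ (B, P) # drop (Suc j) G) A v"
      using Suc BP by (simp add: Cons_nth_drop_Suc[symmetric])
    from ev_derelict[OF this G[OF mem] gl[OF mem]] Suc.prems BP show ?case
      by (simp add: take_Suc_conv_app_nth min_absorb2)
  qed (use \<pi> in simp)
  from this[of "length G"]
  have 1: "ev (fold (\<lambda>k. Derelict k (map fst G ! k)) [0..<length G] \<pi>) (map ?vac G) A v" by simp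
  \<comment> \<open>The same context without the modality on its formulas; \<open>ev_promote\<close>
    adds \<open>Bang\<close> itself.\<close>
  let ?G = "map (\<lambda>(B, P). (B, vacuum M B P)) G"
  have eq: "map ?vac G = map (\<lambda>(B, g). (Bang B, g)) ?G" "map fst ?G = map fst G" by auto
  have "ev (Promote (map fst ?G) A (fold (\<lambda>k. Derelict k (map fst G ! k)) [0..<length G] \<pi>))
    (map (\<lambda>(B, g). (Bang B, g)) ?G) (Bang A) (vacuum M A v)"
    by (rule ev_promote[OF 1[unfolded eq(1)] F]) (use gl in auto)
  then show ?thesis by (simp only: eq derelict_promote_def length_map)
qed

section \<open>The exchange that collects hypotheses by input, and the assembled step\<close>

lemma Suc_mult_3_div: "Suc (3 * m) div 3 = m" "Suc (Suc (3 * m)) div 3 = m"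
  by simp_all

text \<open>Entries of the block of triples can now be computed from their index: positions
  \<open>3 * m\<close>, \<open>3 * m + 1\<close> and \<open>3 * m + 2\<close> all hold
  \<open>f m\<close>.\<close>

lemma concat_replicate_3:
  "concat (map (\<lambda>m. replicate 3 (f m)) [0..<h]) = map (\<lambda>i. f (i div 3)) [0..<3 * h]"
proof (induction h)
  case (Suc h)
  have "[0..<3 * Suc h] = [0..<3 * h] @ [3 * h, 3 * h + 1, 3 * h + 2]"
    by (simp add: numeral_3_eq_3)
  then have "map (\<lambda>i. f (i div 3)) [0..<3 * Suc h] = map (\<lambda>i. f (i div 3)) [0..<3 * h] @ [f h, f h, f h]"
    by (simp add: Suc_mult_3_div)
  moreover have "replicate 3 (f h) = [f h, f h, f h]" by (simp add: numeral_3_eq_3)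
  ultimately show ?case using Suc by simp
qed simp

text \<open>There are \<open>3 * h\<close> uses of tape symbols, \<open>h + 2\<close> of the state
  and \<open>h + 3\<close> of the head position. A list of \<open>5 * h + 5\<close> indices that
  reaches all of them has no repetition, so only surjectivity needs a case analysis.\<close>

lemma collect_permutation:
  fixes h :: nat
  defines "js \<equiv> concat [[3 * m, 3 * h + m, 4 * h + 2 + m]. m \<leftarrow> [0..<h]] @
             [3 * m + 1. m \<leftarrow> [0..<h]] @ [4 * h, 5 * h + 2] @
             [3 * m + 2. m \<leftarrow> [0..<h]] @ [4 * h + 1, 5 * h + 3, 5 * h + 4]"
  shows "set js = {..<5 * h + 5}" "distinct js"
proof -
  have "length (concat (map (\<lambda>m. [3 * m, 3 * h + m, 4 * h + 2 + m]) [0..<k])) = 3 * k" for k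
    by (induction k) auto
  then have len: "length js = 5 * h + 5" unfolding js_def by simp
  show set_js: "set js = {..<5 * h + 5}"
  proof
    show "set js \<subseteq> {..<5 * h + 5}" by (auto simp: js_def)
    have mem: "\<And>m. m < h \<Longrightarrow> 3 * m \<in> set js" "\<And>m. m < h \<Longrightarrow> 3 * m + 1 \<in> set js"
      "\<And>m. m < h \<Longrightarrow> 3 * m + 2 \<in> set js" "\<And>m. m < h \<Longrightarrow> 3 * h + m \<in> set js"
      "\<And>m. m < h \<Longrightarrow> 4 * h + 2 + m \<in> set js"
      "{4 * h, 5 * h + 2, 4 * h + 1, 5 * h + 3, 5 * h + 4} \<subseteq> set js"
      unfolding js_def by (simp; blast)+
    show "{..<5 * h + 5} \<subseteq> set js"
    proof
      fix x assume x: "x \<in> {..<5 * h + 5}"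
      consider "x < 3 * h" | "3 * h \<le> x" "x < 4 * h" | "4 * h + 2 \<le> x" "x < 5 * h + 2"
        | "x \<in> {4 * h, 5 * h + 2, 4 * h + 1, 5 * h + 3, 5 * h + 4}"
        using x by force
      then show "x \<in> set js"
      proof cases
        case 1
        then have "x div 3 < h" by (simp add: div_less_iff_less_mult mult.commute)
        moreover have "x = 3 * (x div 3) \<or> x = 3 * (x div 3) + 1 \<or> x = 3 * (x div 3) + 2" by presburger
        ultimately show ?thesis using mem(1-3)[of "x div 3"] by metis
      next
        case 2
        then show ?thesis using mem(4)[of "x - 3 * h"] by simp
      next
        case 3
        then have "x = 4 * h + 2 + (x - (4 * h + 2))" "x - (4 * h + 2) < h" by simp_all
        then show ?thesis using mem(5) by metis
      qed (use mem(6) in blast)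
    qed
  qed
  show "distinct js" using set_js len by (intro card_distinct) simp
qed

text \<open>Stated for arbitrary values of the components: the structural rules around them
  transport vacua whatever the vectors are, so the closed forms can be inserted afterwards.\<close>

lemma ev_absstep:
  fixes A :: "'a form" and s n h :: nat
  defines "S \<equiv> bool_form s A" and "N \<equiv> bool_form n A" and "H \<equiv> bool_form h A"
  assumes h: "h \<ge> 1" and F: "tensor_form (step_forms A s n h) \<in> F"
    and symbol: "\<And>m. m < h \<Longrightarrow> ev (symbol A s n h \<delta> m) [(S, \<alpha> m), (N, \<beta>), (H, \<gamma>)] S (\<theta> m)"
    and state: "ev (state A s n h \<delta>) (map (\<lambda>m. (S, \<alpha> m)) [0..<h] @ [(N, \<beta>), (H, \<gamma>)]) N \<mu>"
    and tapehead: "ev (tapehead A s n h \<delta>) (map (\<lambda>m. (S, \<alpha> m)) [0..<h] @ [(N, \<beta>), (H, \<gamma>), (H, \<gamma>)]) H \<nu>"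
  shows "ev (absstep A s n h \<delta>)
    [(tensor_form (step_forms A s n h), tensor_elt M (step_forms A s n h)
      (map (\<lambda>m. vacuum M S (\<alpha> m)) [0..<h] @ [vacuum M N \<beta>, vacuum M H \<gamma>]))]
    (tensor_form (step_forms A s n h))
    (tensor_elt M (step_forms A s n h)
      (map (\<lambda>m. vacuum M S (\<theta> m)) [0..<h] @ [vacuum M N \<mu>, vacuum M H \<nu>]))"
proof -
  let ?\<Gamma> = "step_forms A s n h"
  have \<Gamma>: "?\<Gamma> = replicate h (Bang S) @ [Bang N, Bang H]" by (simp add: step_forms_def S_def N_def H_def)
  have BF: "Bang S \<in> F" "Bang N \<in> F" "Bang H \<in> F"
    using tensor_form_F[OF F] h by (auto simp: \<Gamma>)
  define g where "g m = (Bang S, vacuum M S (\<alpha> m))" for m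
  define q where "q = (Bang N, vacuum M N \<beta>)"
  define l where "l = (Bang H, vacuum M H \<gamma>)"
  let ?ps = "[(Bang S, derelict_promote [S, N, H] S (symbol A s n h \<delta> m)). m \<leftarrow> [0..<h]] @
         [(Bang N, derelict_promote (replicate h S @ [N, H]) N (state A s n h \<delta>)),
          (Bang H, derelict_promote (replicate h S @ [N, H, H]) H (tapehead A s n h \<delta>))]"
  let ?Gs = "map (\<lambda>m. ([g m, q, l], vacuum M S (\<theta> m))) [0..<h] @
     [(map g [0..<h] @ [q, l], vacuum M N \<mu>), (map g [0..<h] @ [q, l, l], vacuum M H \<nu>)]"
  define ctx where "ctx = concat (map (\<lambda>m. [g m, q, l]) [0..<h]) @ (map g [0..<h] @ [q, l]) @ (map g [0..<h] @ [q, l, l])"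
  let ?out = "tensor_elt M ?\<Gamma> (map (\<lambda>m. vacuum M S (\<theta> m)) [0..<h] @ [vacuum M N \<mu>, vacuum M H \<nu>])"
  have ps: "list_all2 (\<lambda>(A, \<pi>) (G, v). ev \<pi> G A v) ?ps ?Gs"
  proof (rule list_all2_appendI)
    show "list_all2 (\<lambda>(A, \<pi>) (G, v). ev \<pi> G A v)
      (map (\<lambda>m. (Bang S, derelict_promote [S, N, H] S (symbol A s n h \<delta> m))) [0..<h])
      (map (\<lambda>m. ([g m, q, l], vacuum M S (\<theta> m))) [0..<h])"
      using ev_derelict_promote[OF symbol BF(1)] BF by (auto simp: list_all2_conv_all_nth g_def q_def l_def)
    have 1: "map fst (map (\<lambda>m. (S, \<alpha> m)) [0..<h] @ xs) = replicate h S @ map fst xs"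
      "map (\<lambda>(B, P). (Bang B, vacuum M B P)) (map (\<lambda>m. (S, \<alpha> m)) [0..<h] @ xs) =
        map g [0..<h] @ map (\<lambda>(B, P). (Bang B, vacuum M B P)) xs" for xs
      by (simp_all add: o_def map_replicate_const g_def)
    have "ev (derelict_promote (replicate h S @ [N, H]) N (state A s n h \<delta>)) (map g [0..<h] @ [q, l]) (Bang N) (vacuum M N \<mu>)"
      using ev_derelict_promote[OF state BF(2)] BF unfolding 1 by (auto simp: q_def l_def)
    moreover have "ev (derelict_promote (replicate h S @ [N, H, H]) H (tapehead A s n h \<delta>)) (map g [0..<h] @ [q, l, l]) (Bang H) (vacuum M H \<nu>)"
      using ev_derelict_promote[OF tapehead BF(3)] BF unfolding 1 by (auto simp: q_def l_def)
    ultimately show "list_all2 (\<lambda>(A, \<pi>) (G, v). ev \<pi> G A v)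
         [(Bang N, derelict_promote (replicate h S @ [N, H]) N (state A s n h \<delta>)),
          (Bang H, derelict_promote (replicate h S @ [N, H, H]) H (tapehead A s n h \<delta>))]
         [(map g [0..<h] @ [q, l], vacuum M N \<mu>), (map g [0..<h] @ [q, l, l], vacuum M H \<nu>)]"
      by simp
  qed
  have forms: "map fst ?ps = ?\<Gamma>" by (simp add: \<Gamma> o_def map_replicate_const)
  have comp: "ev (step_components A s n h \<delta>) ctx (tensor_form ?\<Gamma>) ?out"
    using ev_tensor_proofs[OF _ ps] F unfolding forms
    by (simp add: step_components_def Let_def ctx_def S_def N_def H_def comp_def)
  define js where "js = concat [[3 * m, 3 * h + m, 4 * h + 2 + m]. m \<leftarrow> [0..<h]] @
             [3 * m + 1. m \<leftarrow> [0..<h]] @ [4 * h, 5 * h + 2] @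
             [3 * m + 2. m \<leftarrow> [0..<h]] @ [4 * h + 1, 5 * h + 3, 5 * h + 4]"
  note js = collect_permutation[of h, folded js_def]
  \<comment> \<open>The context grouped by input; the exchange reads \<open>ctx\<close>, which is
    grouped by component, off this list.\<close>
  define G where "G = concat (map (\<lambda>m. replicate 3 (g m)) [0..<h]) @ replicate (h + 2) q @ replicate (h + 3) l"
  have G: "G = map (\<lambda>i. g (i div 3)) [0..<3 * h] @ replicate (h + 2) q @ replicate (h + 3) l"
    unfolding G_def concat_replicate_3 ..
  have mapjs: "map ((!) G) js = ctx"
  proof -
    have "map ((!) G) (concat (map (\<lambda>m. [3 * m, 3 * h + m, 4 * h + 2 + m]) [0..<h])) =
        concat (map (\<lambda>m. [g m, q, l]) [0..<h])"
      unfolding map_concat map_map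
      by (rule arg_cong[of _ _ concat]) (auto simp: G nth_append nth_Cons' Suc_mult_3_div)
    moreover have "map ((!) G) (map (\<lambda>m. 3 * m + 1) [0..<h]) = map g [0..<h]"
      by (rule nth_equalityI) (auto simp: G nth_append nth_Cons' Suc_mult_3_div)
    moreover have "map ((!) G) (map (\<lambda>m. 3 * m + 2) [0..<h]) = map g [0..<h]"
      by (rule nth_equalityI) (auto simp: G nth_append nth_Cons' Suc_mult_3_div)
    moreover have "map ((!) G) [4 * h, 5 * h + 2] = [q, l]"
      using h by (auto simp: G nth_append nth_Cons' Suc_mult_3_div)
    moreover have "map ((!) G) [4 * h + 1, 5 * h + 3, 5 * h + 4] = [q, l, l]"
      using h by (auto simp: G nth_append nth_Cons' Suc_mult_3_div)
    ultimately show ?thesis unfolding js_def ctx_def by (simp only: map_append append_assoc)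
  qed
  have lenG: "length G = 5 * h + 5" by (simp add: G)
  have fstG: "map fst G = replicate (3 * h) (Bang S) @ replicate (h + 2) (Bang N) @ replicate (h + 3) (Bang H)"
    unfolding G by (simp add: o_def g_def q_def l_def map_replicate_const)
  have "ev (Exch (map fst G) js (step_components A s n h \<delta>)) G (tensor_form ?\<Gamma>) ?out"
    by (rule ev_exch) (use comp mapjs js lenG in simp_all)
  then have 0: "ev (Exch (map fst G) js (step_components A s n h \<delta>))
      (concat (map (\<lambda>m. replicate 3 (Bang S, vacuum M S (\<alpha> m))) [0..<h]) @ replicate (h + 2) q @ replicate (h + 3) l)
      (tensor_form ?\<Gamma>) ?out"
    by (simp only: G_def g_def)
  have gl: "grouplike S (vacuum M S (\<alpha> m)) (\<alpha> m)" if "m < h" for m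
    by (rule vacuum_grouplike[OF BF(1) evD(6)[OF symbol[OF that]]]) simp
  have glN: "grouplike N (vacuum M N \<beta>) \<beta>" and glH: "grouplike H (vacuum M H \<gamma>) \<gamma>"
    by (rule vacuum_grouplike[OF BF(2) evD(6)[OF state]] vacuum_grouplike[OF BF(3) evD(6)[OF state]]; simp)+
  let ?\<pi>1 = "fold (\<lambda>m. Contract m S ^^ 2) [0..<h] (Exch (map fst G) js (step_components A s n h \<delta>))"
  let ?\<pi>2 = "(Contract h N ^^ (h + 1)) ?\<pi>1"
  let ?\<pi>3 = "(Contract (h + 1) H ^^ (h + 2)) ?\<pi>2"
  \<comment> \<open>The state is used once by each of the \<open>h + 2\<close> components, hence
    \<open>h + 1\<close> contractions. The head position has one use more, since
    \<open>tapehead\<close> takes it twice.\<close>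
  have "ev ?\<pi>1 (map g [0..<h] @ replicate (Suc (h + 1)) (Bang N, vacuum M N \<beta>) @ replicate (h + 3) l) (tensor_form ?\<Gamma>) ?out"
    using ev_contract_triples[OF 0 gl] by (simp add: g_def[abs_def] q_def)
  from ev_contracts[OF this glN]
  have "ev ?\<pi>2 ((map g [0..<h] @ [q]) @ replicate (Suc (h + 2)) (Bang H, vacuum M H \<gamma>) @ []) (tensor_form ?\<Gamma>) ?out"
    by (simp add: q_def l_def numeral_3_eq_3)
  from ev_contracts[OF this glH]
  have 3: "ev ?\<pi>3 (map g [0..<h] @ [q, l]) (tensor_form ?\<Gamma>) ?out" by (simp add: l_def)
  let ?G = "map g [0..<h] @ [q, l]"
  have fst_G: "map fst ?G = ?\<Gamma>" and snd_G: "map snd ?G = map (\<lambda>m. vacuum M S (\<alpha> m)) [0..<h] @ [vacuum M N \<beta>, vacuum M H \<gamma>]"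
    by (simp_all add: \<Gamma> o_def g_def q_def l_def map_replicate_const)
  \<comment> \<open>The tensor of a single hypothesis is that hypothesis, so the contracted context
    is already in the starting form for tensoring from the right.\<close>
  have "take (h + 1) ?G @ [tensor_entry (drop (h + 1) ?G)] = ?G"
    by (simp add: tensor_entry_def l_def)
  with 3 have "ev ?\<pi>3 (take (h + 1) ?G @ [tensor_entry (drop (h + 1) ?G)]) (tensor_form ?\<Gamma>) ?out" by simp
  from ev_tensorL_all[OF _ this, unfolded fst_G] F
  show ?thesis
    unfolding absstep_def Let_def S_def[symmetric] N_def[symmetric] H_def[symmetric]
      fstG[symmetric] js_def[symmetric] tensor_entry_def fst_G snd_G
    by (simp del: upt_Suc)
qed

end

theorem mainTheorem8:
  fixes M :: "('a, 'k::alg_closed_field, 'v::ab_group_add) interp"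
    and F :: "'a form set" and A :: "'a form"
    and s n h :: nat and \<delta> :: "nat \<times> nat \<Rightarrow> nat \<times> nat \<times> nat"
    and a :: "nat \<Rightarrow> nat \<Rightarrow> 'k" and b c :: "nat \<Rightarrow> 'k"
    and \<alpha> \<theta> :: "nat \<Rightarrow> 'v" and \<beta> \<gamma> \<mu> \<nu> :: 'v
  assumes "sweedler_semantics F M"
    and "tensor_form (step_forms A s n h) \<in> F" and "bool_form 2 A \<in> F"
    and "s \<ge> 1" and "n \<ge> 1" and "h \<ge> 1"
    and "\<delta> \<in> {..<s} \<times> {..<n} \<rightarrow> {..<s} \<times> {..<n} \<times> {0, 1}"
    and "\<And>m. m < h \<Longrightarrow> \<alpha> m = (\<Sum>i<s. smul M (a m i) (bool_vec M A s i))"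
    and "\<beta> = (\<Sum>q<n. smul M (b q) (bool_vec M A n q))"
    and "\<gamma> = (\<Sum>l<h. smul M (c l) (bool_vec M A h l))"
    and "\<And>m. m < h \<Longrightarrow> \<theta> m = den M (symbol A s n h \<delta> m) (pure_of M [\<alpha> m, \<beta>, \<gamma>])"
    and "\<mu> = den M (state A s n h \<delta>) (pure_of M (map \<alpha> [0..<h] @ [\<beta>, \<gamma>]))"
    and "\<nu> = den M (tapehead A s n h \<delta>) (pure_of M (map \<alpha> [0..<h] @ [\<beta>, \<gamma>, \<gamma>]))"
  shows "den M (absstep A s n h \<delta>)
           (pure_of M
             [tensor_elt M (step_forms A s n h)
               (map (\<lambda>m. vacuum M (bool_form s A) (\<alpha> m)) [0..<h] @
                [vacuum M (bool_form n A) \<beta>, vacuum M (bool_form h A) \<gamma>])]) =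
         tensor_elt M (step_forms A s n h)
           (map (\<lambda>m. vacuum M (bool_form s A) (\<theta> m)) [0..<h] @
            [vacuum M (bool_form n A) \<mu>, vacuum M (bool_form h A) \<nu>]) \<and>
         (\<forall>m<h. \<theta> m =
           (\<Sum>i<s. \<Sum>q<n. smul M (a m i * b q)
             (smul M (c m) (bool_vec M A s (fst (\<delta> (i, q)))) +
              (\<Sum>l\<in>{..<h} - {m}. smul M (c l) (bool_vec M A s i))))) \<and>
         \<mu> =
           (\<Sum>l<h. smul M (c l)
             (smul M (\<Prod>m\<in>{..<h} - {l}. \<Sum>i<s. a m i)
               (\<Sum>i<s. \<Sum>q<n. smul M (a l i * b q) (bool_vec M A n (fst (snd (\<delta> (i, q)))))))) \<and>
         \<nu> =
           (\<Sum>l<h. smul M (c l)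
             (smul M (\<Prod>m\<in>{..<h} - {l}. \<Sum>i<s. a m i)
               (\<Sum>i<s. \<Sum>q<n. \<Sum>r<h. smul M (a l i * b q * c r)
                 (smul M (of_bool (snd (snd (\<delta> (i, q))) = 0))
                    (bool_vec M A h ((r + h - 1) mod h)) +
                  smul M (of_bool (snd (snd (\<delta> (i, q))) = 1))
                    (bool_vec M A h ((r + 1) mod h))))))"
proof -
  interpret sweedler F M by unfold_locales (rule assms(1))
  \<comment> \<open>All spaces used in the derivation must be interpreted. The boolean types come
    from the context of the step; the cut formula \<open>bool_form 2 A\<close> of
    \<open>tapehead\<close> need not be a subformula of it and has its own assumption.\<close>
  have "set (step_forms A s n h) \<subseteq> F"
    by (rule tensor_form_F[OF assms(2)]) (simp add: step_forms_def)
  then have "Bang (bool_form s A) \<in> F" "Bang (bool_form n A) \<in> F" "Bang (bool_form h A) \<in> F"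
    using assms(6) by (auto simp: step_forms_def)
  note BF = this[THEN Bang_F]
  have \<alpha>: "\<alpha> m = comb A s (a m)" if "m < h" for m using assms(8)[OF that] by (simp add: comb_def)
  have \<beta>: "\<beta> = comb A n b" and \<gamma>: "\<gamma> = comb A h c" using assms(9,10) by (simp_all add: comb_def)
  have \<alpha>s: "map (\<lambda>m. (bool_form s A, comb A s (a m))) [0..<h] = map (\<lambda>m. (bool_form s A, \<alpha> m)) [0..<h]"
    using \<alpha> by simp
  note c = assms(4-6) BF assms(3,7)
  have symbol: "ev (symbol A s n h \<delta> m) [(bool_form s A, \<alpha> m), (bool_form n A, \<beta>), (bool_form h A, \<gamma>)]
      (bool_form s A) (symbol_vec A s n h \<delta> a b c m)" if "m < h" for m
    using ev_symbol[OF c that, of a b c] \<alpha>[OF that] \<beta> \<gamma> by simp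
  have state: "ev (state A s n h \<delta>) (map (\<lambda>m. (bool_form s A, \<alpha> m)) [0..<h] @
      [(bool_form n A, \<beta>), (bool_form h A, \<gamma>)]) (bool_form n A) (state_vec A s n h \<delta> a b c)"
    using ev_state[OF c, of a b c] unfolding \<alpha>s \<beta> \<gamma> .
  have tapehead: "ev (tapehead A s n h \<delta>) (map (\<lambda>m. (bool_form s A, \<alpha> m)) [0..<h] @
      [(bool_form n A, \<beta>), (bool_form h A, \<gamma>), (bool_form h A, \<gamma>)]) (bool_form h A) (tapehead_vec A s n h \<delta> a b c)"
    using ev_tapehead[OF c, of a b c] unfolding \<alpha>s \<beta> \<gamma> .
  have \<theta>: "\<theta> m = symbol_vec A s n h \<delta> a b c m" if "m < h" for m
    using evD(4)[OF symbol[OF that]] assms(11)[OF that] by simp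
  have \<mu>: "\<mu> = state_vec A s n h \<delta> a b c"
    using evD(4)[OF state] assms(12) by (simp add: o_def)
  have \<nu>: "\<nu> = tapehead_vec A s n h \<delta> a b c"
    using evD(4)[OF tapehead] assms(13) by (simp add: o_def)
  have "ev (symbol A s n h \<delta> m) [(bool_form s A, \<alpha> m), (bool_form n A, \<beta>), (bool_form h A, \<gamma>)]
      (bool_form s A) (\<theta> m)" if "m < h" for m
    using symbol[OF that] \<theta>[OF that] by simp
  from evD(4)[OF ev_absstep[OF assms(6,2) this state[folded \<mu>] tapehead[folded \<nu>]]] \<theta> \<mu> \<nu>
  show ?thesis by (simp add: symbol_vec_def state_vec_def tapehead_vec_def)
qed

end
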